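(* Let $\alpha_0<1$ and let $\eta_0>0$, $\tau_0>0$ (depending on $\alpha_0$) be constants with property (P) of the context. Then there exist $\tau_2>0$ and $\varepsilon_2>0$, independent of $l$, such that for every $0<\tau<\tau_2$, $0\le\alpha<\alpha_0$, $0<\varepsilon<\varepsilon_2$ and every $l>0$ the following holds. Let $E\subset\mathbb R^d$ be a set of locally finite perimeter, $i\in\{1,\dots,d\}$, and let $t_i^\perp+se_i\in(\partial E)\cap[0,l)^d$, where the slice $E_{t_i^\perp}$ has locally finite perimeter and $s\in\partial E_{t_i^\perp}$. Assume that (a) $\min(|s-l|,|s|)>\eta_0$; (b) $D^j_\eta(E,[0,l)^d)\le\dfrac{\varepsilon^d}{16\,l^d}$ for some $\eta>0$ and some $j\ne i$. Then $$r_{i,\alpha,\tau}(E,t_i^\perp,s)+v_{i,\alpha,\tau}(E,t_i^\perp,s)\ge0 .$$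
   Context: Notation. $|z|_1=\sum_i|z_i|$; $e_1,\dots,e_d$ is the canonical basis of $\mathbb R^d$. For $x\in\mathbb R^d$, $x_i$ denotes the component along $e_i$ (identified either with $\langle x,e_i\rangle e_i$ or with the number $\langle x,e_i\rangle$), and $x_i^\perp=x-x_i$ (identified with a point of $\mathbb R^{d-1}$). For $\alpha<1$ put $p(\alpha)=d+2-\alpha$, $\beta(\alpha)=1-\alpha$ and for $\tau>0$ $$K_{\alpha,\tau}(\zeta)=\frac{1}{(|\zeta|_1+\tau^{1/\beta(\alpha)})^{p(\alpha)}},\qquad \widehat K_{\alpha,\tau}(\zeta_i)=\int_{\mathbb R^{d-1}}K_{\alpha,\tau}(\zeta_i+\zeta_i^\perp)\,d\zeta_i^\perp .$$ For $E\subset\mathbb R^d$ of locally finite perimeter ($\partial E$ is the reduced boundary), the slice in direction $e_i$ is $E_{t_i^\perp}=\{s\in\mathbb R: se_i+t_i^\perp\in E\}$; for a.e. $t_i^\perp$ it is a set of locally finite perimeter in $\mathbb R$, with (locally finite) reduced boundary $\partial E_{t_i^\perp}$. For $s\in\partial E_{t_i^\perp}$, $s^+=\inf\{t'\in\partial E_{t_i^\perp}:t'>s\}$ and $s^-=\sup\{t'\in\partial E_{t_i^\perp}:t'<s\}$. Define $$r_{i,\alpha,\tau}(E,t_i^\perp,s)=-1+\int_{\mathbb R}|\zeta_i|\widehat K_{\alpha,\tau}(\zeta_i)d\zeta_i-\int_{s^-}^s\int_0^{+\infty}|\chi_{E_{t_i^\perp}}(u+\rho)-\chi_{E_{t_i^\perp}}(u)|\widehat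 K_{\alpha,\tau}(\rho)d\rho\,du-\int_s^{s^+}\int_{-\infty}^0|\chi_{E_{t_i^\perp}}(u+\rho)-\chi_{E_{t_i^\perp}}(u)|\widehat K_{\alpha,\tau}(\rho)d\rho\,du,$$ $$f_E(t_i^\perp,t_i,\zeta_i^\perp,\zeta_i)=|\chi_E(t_i+t_i^\perp+\zeta_i)-\chi_E(t_i+t_i^\perp)|\,|\chi_E(t_i+t_i^\perp+\zeta_i^\perp)-\chi_E(t_i+t_i^\perp)|,$$ $$v_{i,\alpha,\tau}(E,t_i^\perp,s)=\frac1{2d}\int_{s^-}^{s^+}\int_{\mathbb R^d}f_E(t_i^\perp,u,\zeta_i^\perp,\zeta_i)K_{\alpha,\tau}(\zeta)\,d\zeta\,du .$$ Property (P) of $(\eta_0,\tau_0)$, for given $\alpha_0<1$: for every $0\le\alpha<\alpha_0$ and $0<\tau<\tau_0$, whenever $E\subset\mathbb R^d$ and $s^-<s<s^+$ are three consecutive points of $\partial E_{t_i^\perp}$ with $\min(|s-s^-|,|s^+-s|)<\eta_0$, one has $r_{i,\alpha,\tau}(E,t_i^\perp,s)>0$. (Such $\eta_0,\tau_0$ exist for every $\alpha_0<1$.) Distance from stripes. For $\eta>0$, $\mathcal A^j_\eta$ is the family of sets $F\subset\mathbb R^d$ which, up to null sets, are unions of stripes with boundaries orthogonal to $e_j$, i.e. $F=\{x:\langle x,e_j\rangle\in\bar F\}$ with $\bar F\subset\mathbb R$ of locally finite perimeter, and such that distinct connected components of the boundary of $F$ (hyperplanes) are at distance at least $\eta$ from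 each other. For a cube $Q$, $$D^j_\eta(E,Q)=\inf\Big\{\frac1{|Q|}\int_Q|\chi_E-\chi_F|:F\in\mathcal A^j_\eta\Big\}.$$ *)

theory Defs
  imports "HOL-Analysis.Analysis"
begin

definition C1_compact_support :: "('a::euclidean_space \<Rightarrow> real) \<Rightarrow> bool" where
  "C1_compact_support \<phi> \<longleftrightarrow>
     \<phi> differentiable_on UNIV \<and>
     (\<forall>b\<in>Basis. continuous_on UNIV (\<lambda>x. frechet_derivative \<phi> (at x) b)) \<and>
     compact (closure {x. \<phi> x \<noteq> 0})"

text \<open>
  The distributional derivative of the characteristic function of \<open>E\<close> is the vector-valued
  measure \<open>\<sigma> \<mu>\<close>, where \<open>\<mu>\<close> is a locally finite Borel measure and \<open>|\<sigma>| = 1\<close> holds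
  \<open>\<mu>\<close>-almost everywhere. Hence \<open>\<mu>\<close> is its total variation, and \<open>\<sigma>\<close> is the inner normal.
  The pair is determined by \<open>E\<close>, up to changing \<open>\<sigma>\<close> on a \<open>\<mu>\<close>-null set.
\<close>
definition polar_derivative ::
    "'a::euclidean_space set \<Rightarrow> 'a measure \<Rightarrow> ('a \<Rightarrow> 'a) \<Rightarrow> bool" where
  "polar_derivative E \<mu> \<sigma> \<longleftrightarrow>
     sets \<mu> = sets borel \<and>
     (\<forall>C. compact C \<longrightarrow> emeasure \<mu> C < \<infinity>) \<and>
     \<sigma> \<in> borel_measurable borel \<and>
     (AE x in \<mu>. norm (\<sigma> x) = 1) \<and>
     (\<forall>\<phi>. C1_compact_support \<phi> \<longrightarrow>
        (\<forall>b\<in>Basis. (LINT x:E|lebesgue. frechet_derivative \<phi> (at x) b)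
                     = - (LINT x|\<mu>. \<phi> x * (\<sigma> x \<bullet> b))))"

definition locally_finite_perimeter :: "'a::euclidean_space set \<Rightarrow> bool" where
  "locally_finite_perimeter E \<longleftrightarrow>
     E \<in> sets lebesgue \<and> (\<exists>\<mu> \<sigma>. polar_derivative E \<mu> \<sigma>)"

text \<open>
  De Giorgi's reduced boundary. By uniqueness of the pair \<open>(\<mu>, \<sigma>)\<close> the existential
  quantifier over it could be replaced by a universal one if \<open>E\<close> has locally finite perimeter.
\<close>
definition reduced_boundary :: "'a::euclidean_space set \<Rightarrow> 'a set" where
  "reduced_boundary E =
     {x. \<exists>\<mu> \<sigma>. polar_derivative E \<mu> \<sigma> \<and>
          (\<forall>r>0. emeasure \<mu> (ball x r) > 0) \<and>
          (\<exists>\<nu>. norm \<nu> = 1 \<and>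
             ((\<lambda>r. (1 / measure \<mu> (ball x r)) *\<^sub>R (LINT y:ball x r|\<mu>. \<sigma> y)) \<longlongrightarrow> \<nu>)
               (at_right 0))}"

abbreviation unit_vec :: "'n::finite \<Rightarrow> real ^ 'n" where
  "unit_vec i \<equiv> axis i 1"

definition par :: "'n::finite \<Rightarrow> real ^ 'n \<Rightarrow> real ^ 'n" where
  "par i x = (x $ i) *\<^sub>R unit_vec i"

definition perp :: "'n::finite \<Rightarrow> real ^ 'n \<Rightarrow> real ^ 'n" where
  "perp i x = x - par i x"

definition l1_norm :: "real ^ 'n::finite \<Rightarrow> real" where
  "l1_norm z = (\<Sum>k\<in>UNIV. \<bar>z $ k\<bar>)"

definition p_exp :: "nat \<Rightarrow> real \<Rightarrow> real" where
  "p_exp d \<alpha> = real d + 2 - \<alpha>"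

definition beta_exp :: "real \<Rightarrow> real" where
  "beta_exp \<alpha> = 1 - \<alpha>"

definition kernel :: "real \<Rightarrow> real \<Rightarrow> real ^ 'n::finite \<Rightarrow> real" where
  "kernel \<alpha> \<tau> \<zeta> =
     1 / (l1_norm \<zeta> + \<tau> powr (1 / beta_exp \<alpha>)) powr p_exp CARD('n) \<alpha>"

text \<open>
  The hyperplane of the vectors orthogonal to \<open>e_i\<close>, with its \<open>(d-1)\<close>-dimensional Lebesgue
  measure, is represented by the coordinates with index different from \<open>i\<close>.
\<close>
definition kernel_hat :: "'n::finite \<Rightarrow> real \<Rightarrow> real \<Rightarrow> real \<Rightarrow> real" where
  "kernel_hat i \<alpha> \<tau> z =
     (LINT g|(\<Pi>\<^sub>M k\<in>UNIV - {i}. lborel). kernel \<alpha> \<tau> (\<chi> k. if k = i then z else g k))"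

definition slice :: "'n::finite \<Rightarrow> (real ^ 'n) set \<Rightarrow> real ^ 'n \<Rightarrow> real set" where
  "slice i E t = {s. s *\<^sub>R unit_vec i + t \<in> E}"

text \<open>
  The neighbours \<open>s\<^sup>+\<close> and \<open>s\<^sup>-\<close> of \<open>s\<close> in the reduced boundary of a set \<open>S\<close> of reals are
  extended reals: they are infinite if there is no further boundary point on that side.
\<close>
definition next_bd :: "real set \<Rightarrow> real \<Rightarrow> ereal" where
  "next_bd S s = (INF t\<in>{t\<in>reduced_boundary S. t > s}. ereal t)"

definition prev_bd :: "real set \<Rightarrow> real \<Rightarrow> ereal" where
  "prev_bd S s = (SUP t\<in>{t\<in>reduced_boundary S. t < s}. ereal t)"

definition r_term ::
    "'n::finite \<Rightarrow> real \<Rightarrow> real \<Rightarrow> (real ^ 'n) set \<Rightarrow> real ^ 'n \<Rightarrow> real \<Rightarrow> real" where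
  "r_term i \<alpha> \<tau> E t s =
     (let S = slice i E t in
       - 1 + (LINT z|lebesgue. \<bar>z\<bar> * kernel_hat i \<alpha> \<tau> z)
       - (LINT u=prev_bd S s..ereal s|lebesgue. (LINT \<rho>=0..\<infinity>|lebesgue.
            (\<bar>indicat_real S (u + \<rho>) - indicat_real S u\<bar> * kernel_hat i \<alpha> \<tau> \<rho>)))
       - (LINT u=ereal s..next_bd S s|lebesgue. (LINT \<rho>=-\<infinity>..0|lebesgue.
            (\<bar>indicat_real S (u + \<rho>) - indicat_real S u\<bar> * kernel_hat i \<alpha> \<tau> \<rho>))))"

text \<open>Arguments in the order \<open>t_i^\<bottom>\<close>, \<open>t_i\<close>, \<open>\<zeta>_i^\<bottom>\<close>, \<open>\<zeta>_i\<close>, all as vectors in the full space.\<close>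
definition f_set ::
    "(real ^ 'n::finite) set \<Rightarrow> real ^ 'n \<Rightarrow> real ^ 'n \<Rightarrow> real ^ 'n \<Rightarrow> real ^ 'n \<Rightarrow> real" where
  "f_set E tp ti zp zi =
     \<bar>indicat_real E (ti + tp + zi) - indicat_real E (ti + tp)\<bar> *
     \<bar>indicat_real E (ti + tp + zp) - indicat_real E (ti + tp)\<bar>"

definition v_term ::
    "'n::finite \<Rightarrow> real \<Rightarrow> real \<Rightarrow> (real ^ 'n) set \<Rightarrow> real ^ 'n \<Rightarrow> real \<Rightarrow> real" where
  "v_term i \<alpha> \<tau> E t s =
     (let S = slice i E t in
       1 / (2 * real CARD('n)) *
       (LINT u=prev_bd S s..next_bd S s|lebesgue. (LINT \<zeta>|lebesgue.
          (f_set E t (u *\<^sub>R unit_vec i) (perp i \<zeta>) (par i \<zeta>) * kernel \<alpha> \<tau> \<zeta>))))"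

text \<open>
  The condition \<open>t $ i = 0\<close> says that \<open>t\<close> is a vector \<open>t_i^\<bottom>\<close> of the hyperplane orthogonal
  to \<open>e_i\<close>; \<open>a < s < b\<close> are three consecutive points of the reduced boundary of the slice.
\<close>
definition property_P :: "'n::finite itself \<Rightarrow> real \<Rightarrow> real \<Rightarrow> real \<Rightarrow> bool" where
  "property_P _ \<alpha>\<^sub>0 \<eta>\<^sub>0 \<tau>\<^sub>0 \<longleftrightarrow>
     (\<forall>\<alpha> \<tau>. 0 \<le> \<alpha> \<and> \<alpha> < \<alpha>\<^sub>0 \<and> 0 < \<tau> \<and> \<tau> < \<tau>\<^sub>0 \<longrightarrow>
       (\<forall>(i::'n) E t a s b.
          locally_finite_perimeter E \<and> t $ i = 0 \<and>
          locally_finite_perimeter (slice i E t) \<and>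
          {a, s, b} \<subseteq> reduced_boundary (slice i E t) \<and> a < s \<and> s < b \<and>
          reduced_boundary (slice i E t) \<inter> {a<..<b} = {s} \<and>
          min \<bar>s - a\<bar> \<bar>b - s\<bar> < \<eta>\<^sub>0
          \<longrightarrow> r_term i \<alpha> \<tau> E t s > 0))"

text \<open>
  Here the boundary of \<open>F\<close> is the reduced boundary, which does not change if \<open>F\<close> is
  modified on a null set.
\<close>
definition stripes :: "'n::finite \<Rightarrow> real \<Rightarrow> (real ^ 'n) set set" where
  "stripes j \<eta> =
     {F. (\<exists>B. locally_finite_perimeter B \<and>
              sym_diff F {x. x \<bullet> unit_vec j \<in> B} \<in> null_sets lebesgue) \<and>
         (\<forall>C\<in>components (reduced_boundary F). \<forall>C'\<in>components (reduced_boundary F).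
            C \<noteq> C' \<longrightarrow> \<eta> \<le> setdist C C')}"

definition stripe_dist ::
    "'n::finite \<Rightarrow> real \<Rightarrow> (real ^ 'n) set \<Rightarrow> (real ^ 'n) set \<Rightarrow> real" where
  "stripe_dist j \<eta> E Q =
     (INF F\<in>stripes j \<eta>.
        1 / measure lebesgue Q * (LINT x:Q|lebesgue. \<bar>indicat_real E x - indicat_real F x\<bar>))"

definition half_open_cube :: "real \<Rightarrow> (real ^ 'n::finite) set" where
  "half_open_cube l = {x. \<forall>k. 0 \<le> x $ k \<and> x $ k < l}"

end

theory Submission
  imports Defs
begin

text \<open>
  Let \<open>M\<close> be the first absolute moment of the integrated kernel \<open>K\<close> and, for \<open>0 < \<delta> \<le> \<infinity>\<close>, let
  \<open>J(\<delta>)\<close> be the integral over \<open>0 < v < \<delta>\<close> of the tail of \<open>K\<close> beyond \<open>v\<close>, so that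
  \<open>M = 2 J(\<infinity>)\<close>. The slice is constant on each of the two gaps next to \<open>s\<close>, hence
  \<open>r \<ge> -1 + M - J(\<delta>) - J(\<delta>')\<close>, where \<open>\<delta>\<close> and \<open>\<delta>'\<close> are the lengths of the gaps; in
  particular \<open>r \<ge> -1\<close>.

  If one gap is shorter than \<open>\<eta>\<^sub>0\<close>, then \<open>r \<ge> 0\<close>. This does not follow from property (P) applied
  to \<open>E\<close>, because the other gap may be infinite. Instead (P) is applied to subsets of a coordinate
  axis, which are null sets and so have finite perimeter. For the slices
  \<open>(-\<infinity>, -\<delta>-1/N) \<union> (-\<delta>, 0) \<union> (N, \<infinity>)\<close> and \<open>N \<rightarrow> \<infinity>\<close> it yields
  \<open>1 + J(\<delta>) + J(\<infinity>) \<le> M\<close> for all \<open>\<delta> < \<eta>\<^sub>0\<close>.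

  If both gaps have length at least \<open>\<eta>\<^sub>0\<close>, then \<open>v \<ge> 1\<close>. The hypothesis on the distance from
  stripes weakens as \<open>\<epsilon>\<close> grows, so \<open>\<epsilon>\<close> may be replaced by \<open>\<epsilon>\<^sub>2\<close>. In a box of side \<open>\<epsilon>\<^sub>2\<close> around
  the jump point, \<open>E\<close> differs from the slice on a fixed fraction of the volume, and for
  \<open>\<tau>\<^sup>1\<^sup>/\<^sup>\<beta> \<le> \<epsilon>\<^sub>2\<close> the kernel is so large there that \<open>v\<close> exceeds a multiple of
  \<open>\<epsilon>\<^sub>2\<^sup>-\<^sup>(\<^sup>1\<^sup>-\<^sup>\<alpha>\<^sup>)\<close>.
\<close>

section \<open>Atoms of the derivative and the reduced boundary\<close>

text \<open>The integrals in r and v are Bochner integrals, equal to 0 when the integrand is not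
  integrable. Upper bounds for the interactions in r survive this convention
  (\<open>set_LINT_lebesgue_le\<close>). Lower bounds, for v and for the interactions of the test
  slices, make sense only once finiteness is known (\<open>set_LINT_lebesgue_eq\<close>), which the
  kernel moments supply. The test slices nearly saturate both interactions. (P) demands three
  consecutive boundary points, so the right gap has to be finite: the ray beyond N closes it and
  escapes as N grows. Almost everything left of 0 lies in the slice while the right gap does not, so
  nearly every shift across 0 from there changes the value and that interaction tends to
  J(\<infinity>). The hole of width 1/N makes -\<delta> a boundary point. The strict inequality of
  (P) becomes weak in the limit, which is enough for r \<ge> 0. That a slice is constant on a gap is
  not built into the reduced boundary, which is defined by averages of the normal. It holds because
  a point off it is no atom, and on the line a ball of mass below 1/2 leaves no room for a
  jump.\<close>

lemma small_punctured_ball: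
  fixes z :: "'a::euclidean_space"
  assumes sets: "sets \<mu> = sets borel" and fin: "\<And>C. compact C \<Longrightarrow> emeasure \<mu> C < \<infinity>" and "0 < e"
  obtains R where "0 < R" "\<And>r. r \<le> R \<Longrightarrow> measure \<mu> (ball z r - {z}) < e"
proof -
  let ?A = "\<lambda>n::nat. ball z (1 / Suc n) - {z}"
  have finA: "emeasure \<mu> (ball z r - {z}) < \<infinity>" for r
  proof -
    have "emeasure \<mu> (ball z r - {z}) \<le> emeasure \<mu> (cball z r)"
      using sets by (intro emeasure_mono) auto
    then show ?thesis using fin[OF compact_cball[of z r]] by (rule order_le_less_trans)
  qed
  have "(\<lambda>n. measure \<mu> (?A n)) \<longlonglongrightarrow> measure \<mu> (\<Inter>n. ?A n)"
  proof (rule Lim_measure_decseq)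
    have "?A n \<in> sets \<mu>" for n unfolding sets by simp
    then show "range ?A \<subseteq> sets \<mu>" by blast
    show "decseq ?A"
    proof (rule decseq_SucI)
      fix n :: nat
      have "1 / real (Suc (Suc n)) \<le> 1 / real (Suc n)" by (simp add: frac_le)
      then show "?A (Suc n) \<subseteq> ?A n" by (intro Diff_mono subset_ball order_refl)
    qed
    show "emeasure \<mu> (?A n) \<noteq> \<infinity>" for n using finA[of "1 / Suc n"] by (simp only: less_irrefl infinity_ennreal_def not_False_eq_True less_top)
  qed
  moreover have "(\<Inter>n. ?A n) = {}"
  proof (rule equals0I)
    fix x assume "x \<in> (\<Inter>n. ?A n)"
    then have x: "dist z x > 0" "\<And>n. dist z x < 1 / Suc n" by auto
    obtain n where "1 / real (Suc n) < dist z x" using nat_approx_posE[OF x(1)] by blast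
    then show False using x(2)[of n] by simp
  qed
  ultimately have "(\<lambda>n. measure \<mu> (?A n)) \<longlonglongrightarrow> 0"
    by (metis (no_types, lifting) measure_empty)
  from order_tendstoD(2)[OF this \<open>0 < e\<close>] obtain n where n: "measure \<mu> (?A n) < e"
    by (auto simp: eventually_sequentially)
  show ?thesis
  proof (rule that[of "1 / Suc n"])
    fix r :: real assume "r \<le> 1 / Suc n"
    then have "measure \<mu> (ball z r - {z}) \<le> measure \<mu> (?A n)"
      using finA[of "1 / Suc n"] sets
      by (intro measure_mono_fmeasurable) (auto simp: fmeasurable_def)
    then show "measure \<mu> (ball z r - {z}) < e" using n by simp
  qed simp
qed

lemma polar_derivative_integrable:
  assumes "polar_derivative E \<mu> \<sigma>" and "A \<in> sets borel" "bounded A"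
  shows "A \<in> fmeasurable \<mu>" "set_integrable \<mu> A \<sigma>"
proof -
  have sets: "sets \<mu> = sets borel" and fin: "emeasure \<mu> (closure A) < \<infinity>"
    and \<sigma>: "\<sigma> \<in> borel_measurable borel" "AE x in \<mu>. norm (\<sigma> x) = 1"
    using assms by (auto simp: polar_derivative_def compact_closure)
  show A: "A \<in> fmeasurable \<mu>"
    using fin emeasure_mono[of A "closure A" \<mu>] sets closure_subset[of A] assms(2)
    by (auto simp: fmeasurable_def intro: order_le_less_trans)
  have m: "\<sigma> \<in> borel_measurable \<mu>" using \<sigma> sets measurable_cong_sets by blast
  have fin': "emeasure \<mu> A < \<infinity>" and As: "A \<in> sets \<mu>" using A by (auto simp: fmeasurable_def)
  show "set_integrable \<mu> A \<sigma>"
    unfolding set_integrable_def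
    by (rule Bochner_Integration.integrable_bound[where f="indicat_real A"])
       (use m As fin' \<sigma> in \<open>auto split: split_indicator\<close>)
qed

text \<open>In a shrinking ball the atom carries almost all of the mass, so the averages of \<sigma>
  tend to \<open>\<sigma> z\<close>. This is a unit vector because a point of positive mass cannot
  lie in the exceptional null set.\<close>

lemma atom_in_reduced_boundary:
  assumes P: "polar_derivative E \<mu> \<sigma>" and z: "measure \<mu> {z} > 0"
  shows "z \<in> reduced_boundary E"
proof -
  have sets: "sets \<mu> = sets borel" and fin: "\<And>C. compact C \<Longrightarrow> emeasure \<mu> C < \<infinity>"
    and AE: "AE x in \<mu>. norm (\<sigma> x) = 1" using P by (auto simp: polar_derivative_def)
  define m where "m = measure \<mu> {z}"
  have m: "m > 0" using z by (simp add: m_def)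
  have "norm (\<sigma> z) = 1"
  proof (rule ccontr)
    assume "norm (\<sigma> z) \<noteq> 1"
    from AE obtain N where N: "{x\<in>space \<mu>. norm (\<sigma> x) \<noteq> 1} \<subseteq> N" "N \<in> null_sets \<mu>"
      by (auto elim!: AE_E simp: null_sets_def)
    have "space \<mu> = UNIV" using sets_eq_imp_space_eq[OF sets] by simp
    with N \<open>norm (\<sigma> z) \<noteq> 1\<close> have "{z} \<subseteq> N" by auto
    then have "emeasure \<mu> {z} \<le> emeasure \<mu> N" using N by (intro emeasure_mono) auto
    with N z show False by (auto simp: measure_def null_sets_def)
  qed
  have ball: "ball z r \<in> fmeasurable \<mu>" "set_integrable \<mu> (ball z r) \<sigma>" for r
    using polar_derivative_integrable[OF P, of "ball z r"] by auto
  have zz: "{z} \<in> fmeasurable \<mu>" "set_integrable \<mu> {z} \<sigma>"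
    using polar_derivative_integrable[OF P, of "{z}"] by auto
  have pb: "ball z r - {z} \<in> fmeasurable \<mu>" "set_integrable \<mu> (ball z r - {z}) \<sigma>" for r
    using polar_derivative_integrable[OF P, of "ball z r - {z}"] by (auto intro: bounded_subset)
  have mball: "measure \<mu> (ball z r) = m + measure \<mu> (ball z r - {z})" if "0 < r" for r
  proof -
    have "ball z r = {z} \<union> (ball z r - {z})" using that by auto
    then show ?thesis unfolding m_def
      using zz(1) pb(1) measure_Un2[of "{z}" \<mu> "ball z r - {z}"] by (metis Diff_idemp measure_Un2)
  qed
  have iball: "(LINT y:ball z r|\<mu>. \<sigma> y) = m *\<^sub>R \<sigma> z + (LINT y:ball z r - {z}|\<mu>. \<sigma> y)" if "0 < r" for r
  proof -
    have e: "ball z r = {z} \<union> (ball z r - {z})" using that by auto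
    have "(LINT y:ball z r|\<mu>. \<sigma> y) = (LINT y:{z}|\<mu>. \<sigma> y) + (LINT y:ball z r - {z}|\<mu>. \<sigma> y)"
      by (subst e, subst set_integral_Un) (use zz pb in auto)
    also have "(LINT y:{z}|\<mu>. \<sigma> y) = (LINT y:{z}|\<mu>. \<sigma> z)"
      unfolding set_lebesgue_integral_def by (rule Bochner_Integration.integral_cong) (auto split: split_indicator)
    also have "\<dots> = m *\<^sub>R \<sigma> z"
      unfolding m_def set_lebesgue_integral_def using zz(1) by (simp add: fmeasurable_def less_top)
    finally show ?thesis .
  qed
  have bound: "norm (LINT y:ball z r - {z}|\<mu>. \<sigma> y) \<le> measure \<mu> (ball z r - {z})" for r
  proof -
    let ?A = "ball z r - {z}"
    have "norm (LINT y:?A|\<mu>. \<sigma> y) \<le> (LINT y|\<mu>. norm (indicator ?A y *\<^sub>R \<sigma> y))"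
      unfolding set_lebesgue_integral_def by (rule integral_norm_bound)
    also have "\<dots> = (LINT y|\<mu>. indicator ?A y)"
    proof (rule integral_cong_AE)
      show "(\<lambda>y. norm (indicat_real ?A y *\<^sub>R \<sigma> y)) \<in> borel_measurable \<mu>"
        using borel_measurable_integrable[OF pb(2)[of r, unfolded set_integrable_def]]
        by (rule measurable_compose[OF _ borel_measurable_norm])
      show "indicat_real ?A \<in> borel_measurable \<mu>" using pb(1)[of r] by (auto simp: fmeasurable_def)
      show "AE y in \<mu>. norm (indicat_real ?A y *\<^sub>R \<sigma> y) = indicat_real ?A y"
        using AE by eventually_elim (auto split: split_indicator)
    qed
    also have "\<dots> = measure \<mu> ?A" using sets_eq_imp_space_eq[OF sets] by simp
    finally show ?thesis .
  qed
  have "((\<lambda>r. (1 / measure \<mu> (ball z r)) *\<^sub>R (LINT y:ball z r|\<mu>. \<sigma> y)) \<longlongrightarrow> \<sigma> z) (at_right 0)"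
  proof (rule tendstoI)
    fix e :: real assume "e > 0"
    \<comment> \<open>The average differs from \<open>\<sigma> z\<close> by at most 2 q / m, where q
      is the mass of the punctured ball.\<close>
    then have "e * m / 2 > 0" using m by simp
    from small_punctured_ball[OF sets fin this, of z] obtain R where R: "0 < R"
      "\<And>r. r \<le> R \<Longrightarrow> measure \<mu> (ball z r - {z}) < e * m / 2" by metis
    show "\<forall>\<^sub>F r in at_right 0. dist ((1 / measure \<mu> (ball z r)) *\<^sub>R (LINT y:ball z r|\<mu>. \<sigma> y)) (\<sigma> z) < e"
      unfolding eventually_at_right_field
    proof (intro exI[of _ R] conjI allI impI)
      fix r :: real assume r: "0 < r" "r < R"
      define q I where "q = measure \<mu> (ball z r - {z})" and "I = (LINT y:ball z r - {z}|\<mu>. \<sigma> y)"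
      have q: "0 \<le> q" "q < e * m / 2" and I: "norm I \<le> q"
        using R r bound unfolding q_def I_def by auto
      have "m + q \<noteq> 0" using m q by linarith
      then have "(1 / measure \<mu> (ball z r)) *\<^sub>R (LINT y:ball z r|\<mu>. \<sigma> y) - \<sigma> z
            = (1 / (m + q)) *\<^sub>R (m *\<^sub>R \<sigma> z + I - (m + q) *\<^sub>R \<sigma> z)"
        by (simp add: mball[OF r(1), folded q_def] iball[OF r(1), folded I_def] scaleR_diff_right)
      also have "\<dots> = (1 / (m + q)) *\<^sub>R (I - q *\<^sub>R \<sigma> z)" by (simp add: algebra_simps)
      finally have "dist ((1 / measure \<mu> (ball z r)) *\<^sub>R (LINT y:ball z r|\<mu>. \<sigma> y)) (\<sigma> z)
          = norm (I - q *\<^sub>R \<sigma> z) / (m + q)" using m q by (simp add: dist_norm)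
      also have "\<dots> \<le> (q + q) / (m + q)"
        using norm_triangle_ineq4[of I "q *\<^sub>R \<sigma> z"] I \<open>norm (\<sigma> z) = 1\<close> m q
        by (intro divide_right_mono) auto
      also have "\<dots> \<le> (q + q) / m" using m q by (intro divide_left_mono) auto
      also have "\<dots> < e" using m q by (simp add: field_simps)
      finally show "dist ((1 / measure \<mu> (ball z r)) *\<^sub>R (LINT y:ball z r|\<mu>. \<sigma> y)) (\<sigma> z) < e" .
    qed (use R in auto)
  qed
  moreover have "emeasure \<mu> (ball z r) > 0" if "r > 0" for r
  proof -
    have "emeasure \<mu> {z} \<le> emeasure \<mu> (ball z r)" using that ball(1) by (intro emeasure_mono) (auto simp: fmeasurable_def)
    moreover have "emeasure \<mu> {z} > 0" using z by (auto simp: measure_def intro: ccontr)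
    ultimately show ?thesis by simp
  qed
  ultimately show ?thesis
    using P \<open>norm (\<sigma> z) = 1\<close> unfolding reduced_boundary_def by blast
qed

section \<open>Test functions and points off the reduced boundary\<close>

lemma C1_compact_supportI:
  fixes \<phi> :: "'a::euclidean_space \<Rightarrow> real"
  assumes D: "\<And>x. (\<phi> has_derivative \<phi>' x) (at x)"
    and cont: "\<And>b. b \<in> Basis \<Longrightarrow> continuous_on UNIV (\<lambda>x. \<phi>' x b)"
    and "bounded A" and out: "\<And>x. x \<notin> A \<Longrightarrow> \<phi> x = 0"
  shows "C1_compact_support \<phi>" "frechet_derivative \<phi> (at x) = \<phi>' x"
proof -
  have eq: "frechet_derivative \<phi> (at x) = \<phi>' x" for x
    using frechet_derivative_at[OF D] by simp
  then show "frechet_derivative \<phi> (at x) = \<phi>' x" .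
  have "bounded {x. \<phi> x \<noteq> 0}"
    by (rule bounded_subset[OF \<open>bounded A\<close>]) (use out in auto)
  then have "compact (closure {x. \<phi> x \<noteq> 0})" by (simp add: compact_closure)
  moreover have "\<phi> differentiable_on UNIV"
    unfolding differentiable_on_def differentiable_def using D by auto
  ultimately show "C1_compact_support \<phi>"
    unfolding C1_compact_support_def eq using cont by auto
qed

text \<open>Continuously differentiable functions that tend pointwise to the indicator of the open
  ball as k grows: with q the squared positive part, \<open>(1 - q) ^ k\<close> tends to 0 exactly
  where q > 0. Squaring the positive part removes the kink on the sphere.\<close>

definition bump :: "'a::euclidean_space \<Rightarrow> real \<Rightarrow> nat \<Rightarrow> 'a \<Rightarrow> real" where
  "bump x r k y = 1 - (1 - (max 0 (1 - (y - x) \<bullet> (y - x) / r\<^sup>2))\<^sup>2) ^ k"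

lemma has_real_derivative_max_0_power2:
  "((\<lambda>w. (max 0 w)\<^sup>2) has_real_derivative 2 * max 0 w) (at w)" for w :: real
proof (cases "w = 0")
  case True
  have "((\<lambda>h. (max 0 h)\<^sup>2 / h) \<longlongrightarrow> 0) (at (0::real))"
  proof (rule Lim_null_comparison)
    show "\<forall>\<^sub>F h in at (0::real). norm ((max 0 h)\<^sup>2 / h) \<le> \<bar>h\<bar>"
      by (rule always_eventually) (auto simp: max_def power2_eq_square)
    show "((\<lambda>h. \<bar>h\<bar>) \<longlongrightarrow> 0) (at (0::real))" by (intro tendsto_eq_intros) auto
  qed
  then show ?thesis by (simp add: True DERIV_def)
next
  case False
  show ?thesis
  proof (cases "w > 0")
    case True
    have D: "((\<lambda>w. w\<^sup>2) has_real_derivative 2 * max 0 w) (at w)"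
      using True by (auto intro!: derivative_eq_intros)
    have "\<forall>\<^sub>F v in nhds w. (max 0 v)\<^sup>2 = v\<^sup>2"
      using eventually_nhds_in_open[of "{0<..}" w] True by (auto elim!: eventually_mono)
    from DERIV_cong_ev[OF refl this refl] D show ?thesis by simp
  next
    case F: False
    have D: "((\<lambda>w. 0) has_real_derivative 2 * max 0 w) (at w)" using F by simp
    have "\<forall>\<^sub>F v in nhds w. (max 0 v)\<^sup>2 = 0"
      using eventually_nhds_in_open[of "{..<0}" w] F False by (auto elim!: eventually_mono)
    from DERIV_cong_ev[OF refl this refl] D show ?thesis by simp
  qed
qed

lemma bump_has_derivative:
  fixes x :: "'a::euclidean_space" and r :: real
  defines "w \<equiv> \<lambda>y. 1 - (y - x) \<bullet> (y - x) / r\<^sup>2"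
  shows "(bump x r k has_derivative
    (\<lambda>v. (real k * (1 - (max 0 (w y))\<^sup>2) ^ (k - 1) * (2 * max 0 (w y))) * (- (2 * ((y - x) \<bullet> v) / r\<^sup>2)))) (at y)"
proof -
  have w: "(w has_derivative (\<lambda>v. - (2 * ((y - x) \<bullet> v) / r\<^sup>2))) (at y)"
    unfolding w_def divide_inverse by (auto intro!: derivative_eq_intros simp: inner_commute algebra_simps)
  have "((\<lambda>u. 1 - (1 - (max 0 u)\<^sup>2) ^ k) has_real_derivative
      real k * (1 - (max 0 (w y))\<^sup>2) ^ (k - 1) * (2 * max 0 (w y))) (at (w y))"
  proof -
    have "((\<lambda>h. 1 - (1 - h) ^ k) has_real_derivative real k * (1 - h) ^ (k - 1)) (at h)" for h :: real
      by (auto intro!: derivative_eq_intros)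
    from DERIV_chain2[OF this has_real_derivative_max_0_power2] show ?thesis by simp
  qed
  from DERIV_compose_FDERIV[OF this w] show ?thesis
    unfolding bump_def[abs_def] w_def by (simp add: mult.commute)
qed

lemma bump_props:
  fixes x :: "'a::euclidean_space"
  assumes "r > 0"
  shows "0 \<le> bump x r k y" "bump x r k y \<le> 1" "y \<notin> ball x r \<Longrightarrow> bump x r k y = 0"
    "y \<in> ball x r \<Longrightarrow> (\<lambda>k. bump x r k y) \<longlonglongrightarrow> 1" "C1_compact_support (bump x r k)"
proof -
  define q where "q = max 0 (1 - (y - x) \<bullet> (y - x) / r\<^sup>2)"
  have q: "0 \<le> q" "q \<le> 1" unfolding q_def by auto
  then have q2: "q\<^sup>2 \<le> 1" "0 \<le> q\<^sup>2" by (auto simp: power_le_one)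
  show "0 \<le> bump x r k y" "bump x r k y \<le> 1"
    unfolding bump_def q_def[symmetric] using q2 by (auto simp: power_le_one)
  have d: "(y - x) \<bullet> (y - x) = (dist x y)\<^sup>2" 
    by (metis dist_norm norm_minus_commute power2_norm_eq_inner)
  show out: "bump x r k y = 0" if "y \<notin> ball x r" for y k
  proof -
    have "r\<^sup>2 \<le> (norm (y - x))\<^sup>2" using that assms
      by (intro power_mono) (auto simp: dist_norm norm_minus_commute)
    then have "1 \<le> (y - x) \<bullet> (y - x) / r\<^sup>2" using assms
      by (simp add: power2_norm_eq_inner)
    then show ?thesis unfolding bump_def by simp
  qed
  show "(\<lambda>k. bump x r k y) \<longlonglongrightarrow> 1" if "y \<in> ball x r"
  proof -
    have "(dist x y)\<^sup>2 < r\<^sup>2" using that assms by (intro power_strict_mono) auto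
    then have "q > 0" unfolding q_def d using assms by simp
    then have "(\<lambda>k. (1 - q\<^sup>2) ^ k) \<longlonglongrightarrow> 0" using q2 by (intro LIMSEQ_realpow_zero) auto
    from tendsto_diff[OF tendsto_const this, of 1] show ?thesis
      unfolding bump_def q_def[symmetric] by simp
  qed
  show "C1_compact_support (bump x r k)"
    by (rule C1_compact_supportI(1)[OF bump_has_derivative _ bounded_ball[of x r] out])
       (intro continuous_intros; use assms in simp)
qed

lemma polar_derivativeD:
  assumes "polar_derivative E \<mu> \<sigma>" "C1_compact_support \<phi>" "b \<in> Basis"
  shows "(LINT x:E|lebesgue. frechet_derivative \<phi> (at x) b) = - (LINT x|\<mu>. \<phi> x * (\<sigma> x \<bullet> b))"
  using assms unfolding polar_derivative_def by blast

text \<open>Testing with the bumps and passing to the limit by dominated convergence shows that the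
  integral of \<sigma> over every smaller ball around x vanishes, so the averages cannot tend to a
  unit vector.\<close>

lemma notin_reduced_boundaryI:
  fixes x :: "'a::euclidean_space"
  assumes "R > 0"
    and zero: "\<And>\<phi> b. C1_compact_support \<phi> \<Longrightarrow> (\<And>y. y \<notin> ball x R \<Longrightarrow> \<phi> y = 0) \<Longrightarrow> b \<in> Basis \<Longrightarrow>
      (LINT y:E|lebesgue. frechet_derivative \<phi> (at y) b) = 0"
  shows "x \<notin> reduced_boundary E"
proof
  assume "x \<in> reduced_boundary E"
  then obtain \<mu> \<sigma> \<nu> where P: "polar_derivative E \<mu> \<sigma>" and \<nu>: "norm \<nu> = 1"
    and lim: "((\<lambda>r. (1 / measure \<mu> (ball x r)) *\<^sub>R (LINT y:ball x r|\<mu>. \<sigma> y)) \<longlongrightarrow> \<nu>) (at_right 0)"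
    unfolding reduced_boundary_def by auto
  have sets: "sets \<mu> = sets borel" and AE: "AE x in \<mu>. norm (\<sigma> x) = 1"
    and \<sigma>: "\<sigma> \<in> borel_measurable borel" using P by (auto simp: polar_derivative_def)
  have [measurable]: "\<sigma> \<in> borel_measurable \<mu>" using \<sigma> sets measurable_cong_sets by blast
  have "(LINT y:ball x r|\<mu>. \<sigma> y) = 0" if r: "0 < r" "r < R" for r
  proof -
    have int: "set_integrable \<mu> (ball x r) \<sigma>" "ball x r \<in> fmeasurable \<mu>"
      using polar_derivative_integrable[OF P, of "ball x r"] by auto
    have "(LINT y:ball x r|\<mu>. \<sigma> y) \<bullet> b = 0" if b: "b \<in> Basis" for b
    proof -
      have meas: "bump x r k \<in> borel_measurable \<mu>" for k
      proof -
        have "continuous_on UNIV (bump x r k)"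
          using bump_has_derivative has_derivative_continuous
          by (metis continuous_at_imp_continuous_on)
        then show ?thesis using sets borel_measurable_continuous_onI measurable_cong_sets by blast
      qed
      have "(\<lambda>k. LINT y|\<mu>. bump x r k y * (\<sigma> y \<bullet> b)) \<longlonglongrightarrow> (LINT y|\<mu>. indicat_real (ball x r) y * (\<sigma> y \<bullet> b))"
      proof (rule integral_dominated_convergence[where w="indicat_real (ball x r)"])
        show "(\<lambda>y. indicat_real (ball x r) y * (\<sigma> y \<bullet> b)) \<in> borel_measurable \<mu>"
          using int(2) by (intro borel_measurable_times borel_measurable_inner) (auto simp: fmeasurable_def)
        show "(\<lambda>y. bump x r k y * (\<sigma> y \<bullet> b)) \<in> borel_measurable \<mu>" for k
          using meas by measurable
        show "integrable \<mu> (indicat_real (ball x r))" using int(2) by (auto simp: fmeasurable_def)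
        show "AE y in \<mu>. (\<lambda>k. bump x r k y * (\<sigma> y \<bullet> b)) \<longlonglongrightarrow> indicat_real (ball x r) y * (\<sigma> y \<bullet> b)"
        proof (rule AE_I2)
          fix y
          have "(\<lambda>k. bump x r k y) \<longlonglongrightarrow> indicat_real (ball x r) y"
            using bump_props(3,4)[OF r(1), where x=x and y=y] by (cases "y \<in> ball x r") auto
          then show "(\<lambda>k. bump x r k y * (\<sigma> y \<bullet> b)) \<longlonglongrightarrow> indicat_real (ball x r) y * (\<sigma> y \<bullet> b)"
            by (intro tendsto_mult tendsto_const)
        qed
        show "AE y in \<mu>. norm (bump x r k y * (\<sigma> y \<bullet> b)) \<le> indicat_real (ball x r) y" for k
          using AE
        proof eventually_elim
          fix y assume "norm (\<sigma> y) = 1"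
          then have "\<bar>\<sigma> y \<bullet> b\<bar> \<le> 1" using Basis_le_norm[OF b, of "\<sigma> y"] by simp
          then show "norm (bump x r k y * (\<sigma> y \<bullet> b)) \<le> indicat_real (ball x r) y"
            using bump_props(1-3)[OF r(1), where x=x and y=y and k=k]
            by (cases "y \<in> ball x r") (auto simp: abs_mult intro!: mult_le_one)
        qed
      qed
      moreover have "(LINT y|\<mu>. bump x r k y * (\<sigma> y \<bullet> b)) = 0" for k
      proof -
        have "(LINT y:E|lebesgue. frechet_derivative (bump x r k) (at y) b) = 0"
          by (rule zero[OF bump_props(5)[OF r(1)] _ b]) (use r in \<open>auto intro!: bump_props(3)\<close>)
        with polar_derivativeD[OF P bump_props(5)[OF r(1)] b, of x k] show ?thesis by simp
      qed
      ultimately have "(\<lambda>k. 0) \<longlonglongrightarrow> (LINT y|\<mu>. indicat_real (ball x r) y * (\<sigma> y \<bullet> b))" by simp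
      from LIMSEQ_unique[OF this tendsto_const]
      have "(LINT y|\<mu>. indicat_real (ball x r) y * (\<sigma> y \<bullet> b)) = 0" .
      moreover have "(LINT y:ball x r|\<mu>. \<sigma> y) \<bullet> b = (LINT y|\<mu>. indicat_real (ball x r) y * (\<sigma> y \<bullet> b))"
        unfolding set_lebesgue_integral_def
        using integral_inner_left[of b \<mu> "\<lambda>y. indicat_real (ball x r) y *\<^sub>R \<sigma> y"] int(1)
        by (simp add: set_integrable_def)
      ultimately show ?thesis by simp
    qed
    then show ?thesis by (metis euclidean_all_zero_iff)
  qed
  then have "\<forall>\<^sub>F r in at_right 0. (1 / measure \<mu> (ball x r)) *\<^sub>R (LINT y:ball x r|\<mu>. \<sigma> y) = 0"
    unfolding eventually_at_right_field using \<open>R > 0\<close> by (intro exI[of _ R]) auto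
  from tendsto_cong[OF this] lim have "((\<lambda>_. 0) \<longlongrightarrow> \<nu>) (at_right (0::real))" by blast
  from tendsto_unique[OF trivial_limit_at_right_real this tendsto_const] have "\<nu> = 0" .
  then show False using \<nu> by simp
qed

section \<open>Sets of finite perimeter on the line\<close>

lemma AE_open_False:
  fixes U :: "'a::euclidean_space set"
  assumes "open U" "U \<noteq> {}" and AE: "AE x in lborel. x \<notin> U"
  shows False
proof -
  have "emeasure lborel U = 0" using emeasure_eq_0_AE[OF AE] by simp
  then have "U \<in> null_sets lborel" using assms(1) by (intro null_setsI) auto
  then have "negligible U" by (simp add: negligible_iff_null_sets null_sets_completionI)
  with open_not_negligible assms show False by blast
qed

text \<open>The points near which S is full and those near which it is null form two disjoint open
  sets that cover I, and connectedness leaves only one of them.\<close>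

lemma connected_AE_const:
  fixes I :: "'a::euclidean_space set"
  assumes "open I" "connected I"
    and loc: "\<And>z. z \<in> I \<Longrightarrow> \<exists>r>0. \<exists>c. AE x in lborel. x \<in> ball z r \<longrightarrow> (x \<in> S) = c"
  shows "\<exists>c. AE x in lborel. x \<in> I \<longrightarrow> (x \<in> S) = c"
proof -
  define A where "A c = {z\<in>I. \<exists>r>0. AE x in lborel. x \<in> ball z r \<longrightarrow> (x \<in> S) = c}" for c
  have op: "open (A c)" for c
    unfolding open_contains_ball
  proof
    fix z assume "z \<in> A c"
    then obtain r where r: "r > 0" "AE x in lborel. x \<in> ball z r \<longrightarrow> (x \<in> S) = c" and "z \<in> I"
      by (auto simp: A_def)
    from \<open>z \<in> I\<close> \<open>open I\<close> obtain q where q: "q > 0" "ball z q \<subseteq> I"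
      by (meson open_contains_ball)
    have "y \<in> A c" if "y \<in> ball z (min q r)" for y
    proof -
      have sub: "ball y (r - dist z y) \<subseteq> ball z r"
      proof
        fix x assume "x \<in> ball y (r - dist z y)"
        then show "x \<in> ball z r" using dist_triangle[of z x y] by simp
      qed
      have "AE x in lborel. x \<in> ball y (r - dist z y) \<longrightarrow> (x \<in> S) = c"
        using r(2) by eventually_elim (use sub in blast)
      then show ?thesis using that q unfolding A_def by (auto intro!: exI[of _ "r - dist z y"])
    qed
    then show "\<exists>e>0. ball z e \<subseteq> A c" using q r by (intro exI[of _ "min q r"]) auto
  qed
  have "A True \<inter> A False \<inter> I = {}"
  proof (rule equals0I)
    fix z assume "z \<in> A True \<inter> A False \<inter> I"
    then obtain r r' where r: "r > 0" "AE x in lborel. x \<in> ball z r \<longrightarrow> (x \<in> S) = True"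
      and r': "r' > 0" "AE x in lborel. x \<in> ball z r' \<longrightarrow> (x \<in> S) = False"
      by (auto simp: A_def)
    have "AE x in lborel. x \<notin> ball z (min r r')"
      using r(2) r'(2) by eventually_elim auto
    then show False using r(1) r'(1) by (intro AE_open_False[of "ball z (min r r')"]) auto
  qed
  moreover have "I \<subseteq> A True \<union> A False"
  proof
    fix z assume "z \<in> I"
    with loc obtain r c where "r > 0" "AE x in lborel. x \<in> ball z r \<longrightarrow> (x \<in> S) = c" by blast
    then show "z \<in> A True \<union> A False" using \<open>z \<in> I\<close> by (cases c) (auto simp: A_def)
  qed
  ultimately have "A True \<inter> I = {} \<or> A False \<inter> I = {}"
    using connectedD[OF \<open>connected I\<close> op op] by blast
  with \<open>I \<subseteq> A True \<union> A False\<close> obtain c where c: "I \<subseteq> A c" by blast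
  \<comment> \<open>Each of uncountably many balls comes with its own null set; a countable subcover
    merges them into a single one.\<close>
  define \<F> where "\<F> = {U. open U \<and> (AE x in lborel. x \<in> U \<longrightarrow> (x \<in> S) = c)}"
  obtain \<F>' where F': "\<F>' \<subseteq> \<F>" "countable \<F>'" "\<Union>\<F>' = \<Union>\<F>"
    using Lindelof[of \<F>] unfolding \<F>_def by auto
  have "I \<subseteq> \<Union>\<F>"
  proof
    fix z assume "z \<in> I"
    with c obtain r where "r > 0" "AE x in lborel. x \<in> ball z r \<longrightarrow> (x \<in> S) = c" by (auto simp: A_def)
    then have "ball z r \<in> \<F>" "z \<in> ball z r" unfolding \<F>_def by auto
    then show "z \<in> \<Union>\<F>" by blast
  qed
  moreover have "AE x in lborel. \<forall>U\<in>\<F>'. x \<in> U \<longrightarrow> (x \<in> S) = c"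
    using F' by (intro AE_ball_countable[THEN iffD2]) (auto simp: \<F>_def)
  ultimately have "AE x in lborel. x \<in> I \<longrightarrow> (x \<in> S) = c"
    using F'(3) by (elim eventually_mono) blast
  then show ?thesis by blast
qed

section \<open>Calculus of test functions on the line\<close>

lemma C1_real:
  fixes \<phi> :: "real \<Rightarrow> real"
  assumes \<phi>: "C1_compact_support \<phi>"
  defines "D \<equiv> \<lambda>x. frechet_derivative \<phi> (at x) 1"
  shows C1_real_deriv: "(\<phi> has_real_derivative D x) (at x)"
    and C1_real_cont: "continuous_on UNIV D"
    and C1_real_support: "\<exists>R>0. \<forall>x. R \<le> \<bar>x\<bar> \<longrightarrow> \<phi> x = 0 \<and> D x = 0"
proof -
  show deriv: "(\<phi> has_real_derivative D x) (at x)" for x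
  proof -
    have "\<phi> differentiable (at x)" 
      using \<phi> unfolding C1_compact_support_def differentiable_on_def by simp
    then have d: "(\<phi> has_derivative frechet_derivative \<phi> (at x)) (at x)"
      by (simp add: frechet_derivative_works)
    have "frechet_derivative \<phi> (at x) = (*) (D x)"
    proof
      fix v :: real
      show "frechet_derivative \<phi> (at x) v = D x * v"
        using linear_cmul[OF has_derivative_linear[OF d], of v 1] by (simp add: D_def mult.commute)
    qed
    with d show ?thesis by (simp add: has_field_derivative_def)
  qed
  show "continuous_on UNIV D" using \<phi> by (simp add: C1_compact_support_def D_def)
  have "bounded {x. \<phi> x \<noteq> 0}"
    using \<phi> unfolding C1_compact_support_def by (meson bounded_subset closure_subset compact_imp_bounded)
  then obtain B where B: "\<And>x. \<phi> x \<noteq> 0 \<Longrightarrow> \<bar>x\<bar> \<le> B" by (auto simp: bounded_iff)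
  show "\<exists>R>0. \<forall>x. R \<le> \<bar>x\<bar> \<longrightarrow> \<phi> x = 0 \<and> D x = 0"
  proof (intro exI[of _ "\<bar>B\<bar> + 1"] conjI allI impI)
    fix x assume x: "\<bar>B\<bar> + 1 \<le> \<bar>x\<bar>"
    then show "\<phi> x = 0" using B[of x] by force
    have "\<forall>\<^sub>F y in nhds x. \<phi> y = 0"
    proof -
      have "\<forall>\<^sub>F y in nhds x. y \<in> - {-B..B}" using x by (intro eventually_nhds_in_open) auto
      then show ?thesis by eventually_elim (use B in force)
    qed
    from DERIV_cong_ev[OF refl this refl] deriv[of x] have "((\<lambda>y. 0) has_real_derivative D x) (at x)" by simp
    then show "D x = 0" using DERIV_const DERIV_unique by blast
  qed simp
qed

text \<open>Half-lines are the building blocks: up to a null set, the indicator of a finite union of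
  intervals is a signed sum of 1 and of indicators of half-lines, which is how
  \<open>four_point_set\<close> finds its derivative.\<close>

lemma C1_real_integrals:
  fixes \<phi> :: "real \<Rightarrow> real"
  assumes \<phi>: "C1_compact_support \<phi>"
  defines "D \<equiv> \<lambda>x. frechet_derivative \<phi> (at x) 1"
  shows "integrable lborel D" "(LINT x|lborel. D x) = 0" "(LINT x|lborel. indicat_real {..<c} x * D x) = \<phi> c"
proof -
  note D = C1_real_deriv[OF \<phi>] C1_real_cont[OF \<phi>]
  obtain R where R: "R > 0" "\<And>x. R \<le> \<bar>x\<bar> \<Longrightarrow> \<phi> x = 0 \<and> D x = 0"
    using C1_real_support[OF \<phi>] unfolding D_def by blast
  have cont: "isCont D x" for x using D(2) unfolding D_def by (simp add: continuous_on_eq_continuous_at)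
  have FTC: "has_bochner_integral lborel (\<lambda>x. D x * indicator {a..b} x) (\<phi> b - \<phi> a)" if "a \<le> b" for a b
    using that D(1) cont unfolding D_def by (intro has_bochner_integral_FTC_Icc_real) auto
  have "(\<lambda>x. D x * indicator {-R..R} x) = D"
  proof
    fix x show "D x * indicator {-R..R} x = D x" using R(2)[of x] by (auto split: split_indicator)
  qed
  then have "has_bochner_integral lborel D (\<phi> R - \<phi> (-R))" using FTC[of "-R" R] R(1) by simp
  then show "integrable lborel D" "(LINT x|lborel. D x) = 0"
    using R by (auto simp: has_bochner_integral_iff)
  \<comment> \<open>At or left of both c and the support, so that the boundary term
    \<open>\<phi> a\<close> is 0.\<close>
  define a where "a = min c (-R)"
  have "(LINT x|lborel. indicat_real {..<c} x * D x) = (LINT x|lborel. D x * indicator {a..c} x)"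
  proof (rule integral_cong_AE)
    have [measurable]: "D \<in> borel_measurable borel"
      using D(2) unfolding D_def by (rule borel_measurable_continuous_onI)
    show "(\<lambda>x. indicat_real {..<c} x * D x) \<in> borel_measurable lborel"
      "(\<lambda>x. D x * indicator {a..c} x) \<in> borel_measurable lborel" by measurable
    show "AE x in lborel. indicat_real {..<c} x * D x = D x * indicator {a..c} x"
      using AE_lborel_singleton[of c]
    proof eventually_elim
      fix x assume "x \<noteq> c"
      then show "indicat_real {..<c} x * D x = D x * indicator {a..c} x"
        using R(2)[of x] by (auto simp: a_def split: split_indicator)
    qed
  qed
  also have "\<dots> = \<phi> c" using FTC[of a c] R(1) R(2)[of a] by (auto simp: has_bochner_integral_iff a_def)
  finally show "(LINT x|lborel. indicat_real {..<c} x * D x) = \<phi> c" .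
qed

text \<open>The derivative of a test function supported in the ball has total integral 0, and S
  picks up either all of that integral or nothing.\<close>

lemma AE_const_notin_reduced_boundary:
  fixes S :: "real set"
  assumes S: "S \<in> sets lebesgue" and "r > 0" and AE: "AE x in lborel. x \<in> ball z r \<longrightarrow> (x \<in> S) = c"
  shows "z \<notin> reduced_boundary S"
proof (rule notin_reduced_boundaryI[OF \<open>r > 0\<close>])
  fix \<phi> :: "real \<Rightarrow> real" and b :: real
  assume \<phi>: "C1_compact_support \<phi>" and out: "\<And>y. y \<notin> ball z r \<Longrightarrow> \<phi> y = 0" and "b \<in> Basis"
  define D where "D = (\<lambda>x. frechet_derivative \<phi> (at x) 1)"
  note i = C1_real_integrals[OF \<phi>, folded D_def]
  \<comment> \<open>Vanishing off the closed ball is enough, since the two endpoints are excluded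
    almost everywhere.\<close>
  have D0: "D y = 0" if "r < \<bar>y - z\<bar>" for y
  proof -
    have "\<forall>\<^sub>F x in nhds y. x \<in> - cball z r"
      using that by (intro eventually_nhds_in_open) (auto simp: dist_real_def)
    then have "\<forall>\<^sub>F x in nhds y. \<phi> x = 0" by eventually_elim (use out in force)
    from DERIV_cong_ev[OF refl this refl] C1_real_deriv[OF \<phi>, of y]
    have "((\<lambda>y. 0) has_real_derivative D y) (at y)" by (simp add: D_def)
    then show ?thesis using DERIV_const DERIV_unique by blast
  qed
  have [measurable]: "D \<in> borel_measurable borel"
    using C1_real_cont[OF \<phi>] unfolding D_def by (rule borel_measurable_continuous_onI)
  have Dl: "D \<in> borel_measurable lebesgue" by (rule measurable_completion) simp
  have "(LINT y:S|lebesgue. D y) = (LINT y|lebesgue. (if c then 1 else 0) * D y)"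
    unfolding set_lebesgue_integral_def
  proof (rule integral_cong_AE)
    show "(\<lambda>x. indicat_real S x *\<^sub>R D x) \<in> borel_measurable lebesgue"
      using S Dl by (intro borel_measurable_scaleR borel_measurable_indicator) auto
    show "(\<lambda>y. (if c then 1 else 0) * D y) \<in> borel_measurable lebesgue"
      using Dl by (intro borel_measurable_times) auto
    have "AE x in lborel. indicat_real S x *\<^sub>R D x = (if c then 1 else 0) * D x"
      using AE AE_lborel_singleton[of "z + r"] AE_lborel_singleton[of "z - r"]
    proof eventually_elim
      fix x assume x: "x \<in> ball z r \<longrightarrow> (x \<in> S) = c" "x \<noteq> z + r" "x \<noteq> z - r"
      show "indicat_real S x *\<^sub>R D x = (if c then 1 else 0) * D x"
      proof (cases "x \<in> ball z r")
        case False
        then have "r < \<bar>x - z\<bar>" using x by (auto simp: dist_real_def)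
        then show ?thesis using D0 by simp
      qed (use x in auto)
    qed
    then show "AE x in lebesgue. indicat_real S x *\<^sub>R D x = (if c then 1 else 0) * D x"
      by (rule AE_completion)
  qed
  also have "\<dots> = (LINT y|lborel. (if c then 1 else 0) * D y)"
    by (rule integral_completion) simp
  also have "\<dots> = 0" using i(2) by simp
  finally show "(LINT y:S|lebesgue. frechet_derivative \<phi> (at y) b) = 0"
    using \<open>b \<in> Basis\<close> by (simp add: D_def)
qed

text \<open>The density is a normalised Urysohn function that is 1 on a compact K inside A and 0
  outside an open neighbourhood U of K, cut to J, with U - K small.\<close>

lemma concentrated_continuous:
  fixes A J :: "'a::euclidean_space set"
  assumes A: "A \<in> lmeasurable" "measure lebesgue A > 0" "A \<subseteq> J" and J: "open J" "bounded J" and "e > 0"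
  obtains \<psi> :: "'a \<Rightarrow> real" where "continuous_on UNIV \<psi>" "\<And>x. 0 \<le> \<psi> x" "\<And>x. x \<notin> J \<Longrightarrow> \<psi> x = 0"
    "integrable lebesgue \<psi>" "(LINT x|lebesgue. \<psi> x) = 1" "(LINT x:-A|lebesgue. \<psi> x) \<le> e"
proof -
  define m where "m = measure lebesgue A"
  have m: "m > 0" using A by (simp add: m_def)
  \<comment> \<open>Losing less than m / 2 leaves K with positive measure k, against which the error
    e * k of the outer set is measured below.\<close>
  obtain K where K: "closed K" "K \<subseteq> A" "A - K \<in> lmeasurable" "emeasure lebesgue (A - K) < ennreal (m/2)"
    using sets_lebesgue_inner_closed[of A "m/2"] A m by auto
  have Kl: "K \<in> lmeasurable"
    using K J A by (intro lmeasurable_compact) (meson bounded_subset compact_eq_bounded_closed)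
  define k where "k = measure lebesgue K"
  have "measure lebesgue (A - K) < m/2"
    using K m by (simp add: emeasure_eq_measure2 ennreal_less_iff)
  moreover have "measure lebesgue (A - K) = m - k"
    unfolding m_def k_def using A(1) Kl K(2) by (intro measurable_measure_Diff) auto
  ultimately have k: "k > 0" using m by simp
  obtain U where U: "open U" "K \<subseteq> U" "U - K \<in> lmeasurable" "emeasure lebesgue (U - K) < ennreal (e * k)"
    using sets_lebesgue_outer_open[of K "e * k"] Kl k \<open>e > 0\<close> by auto
  have Uk: "measure lebesgue (U - K) < e * k"
    using U k \<open>e > 0\<close> by (simp add: emeasure_eq_measure2 ennreal_less_iff)
  obtain f :: "'a \<Rightarrow> real" where f: "continuous_on UNIV f" "\<And>x. f x \<in> closed_segment 1 0"
    "\<And>x. x \<in> K \<Longrightarrow> f x = 1" "\<And>x. x \<in> - (U \<inter> J) \<Longrightarrow> f x = 0"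
    by (rule Urysohn[of K "- (U \<inter> J)" 1 0]) (use K U J A in auto)
  have f01: "0 \<le> f x" "f x \<le> 1" for x using f(2)[of x] by (auto simp: closed_segment_eq_real_ivl)
  have fm: "f \<in> borel_measurable lebesgue"
    by (rule measurable_completion) (simp add: borel_measurable_continuous_onI[OF f(1)])
  have fi: "integrable lebesgue f"
  proof (rule Bochner_Integration.integrable_bound[OF _ fm])
    show "integrable lebesgue (indicat_real J)" using lmeasurable_open[OF J(2,1)] by (simp add: lmeasurable_iff_integrable)
    show "AE x in lebesgue. norm (f x) \<le> norm (indicat_real J x)"
      using f01 f(4) by (intro AE_I2) (auto split: split_indicator)
  qed
  define M where "M = (LINT x|lebesgue. f x)"
  have "k = (LINT x|lebesgue. indicat_real K x)" by (simp add: k_def)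
  also have "\<dots> \<le> M" unfolding M_def
    using Kl fi f01 f(3)
    by (intro integral_mono) (auto simp: lmeasurable_iff_integrable[symmetric] split: split_indicator)
  finally have M: "k \<le> M" .
  have "(LINT x:-A|lebesgue. f x) \<le> (LINT x|lebesgue. indicat_real (U - K) x)"
    unfolding set_lebesgue_integral_def
  proof (rule integral_mono')
    show "integrable lebesgue (indicat_real (U - K))" using U by (simp add: lmeasurable_iff_integrable)
    show "indicat_real (- A) x *\<^sub>R f x \<le> indicat_real (U - K) x" for x
      using f01(2)[of x] f(4)[of x] K(2) by (auto split: split_indicator)
  qed simp
  also have "\<dots> < e * k" using Uk by simp
  also have "\<dots> \<le> e * M" using M \<open>e > 0\<close> by simp
  finally have fA: "(LINT x:-A|lebesgue. f x) \<le> e * M" by simp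
  show ?thesis
  proof (rule that[of "\<lambda>x. f x / M"])
    show "continuous_on UNIV (\<lambda>x. f x / M)" using f(1) M k by (intro continuous_intros) auto
    show "0 \<le> f x / M" for x using f01 M k by simp
    show "f x / M = 0" if "x \<notin> J" for x using f(4) that by simp
    show "integrable lebesgue (\<lambda>x. f x / M)" using fi by simp
    show "(LINT x|lebesgue. f x / M) = 1" using M k M_def by simp
    show "(LINT x:-A|lebesgue. f x / M) \<le> e" using fA M k by (simp add: field_simps)
  qed
qed

text \<open>
  If neither \<open>S\<close> nor its complement were null in the ball, a test function with values in
  \<open>[-1, 1]\<close> whose derivative has positive mass 1 almost entirely on \<open>S\<close> and negative mass 1
  almost entirely off \<open>S\<close> would violate the bound by \<open>\<mu>\<close> of the ball.
\<close>
lemma light_ball_AE_const: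
  fixes S :: "real set"
  assumes P: "polar_derivative S \<mu> \<sigma>" and S: "S \<in> sets lebesgue" and "r > 0"
    and light: "measure \<mu> (ball z r) < 1/2"
  shows "\<exists>c. AE x in lborel. x \<in> ball z r \<longrightarrow> (x \<in> S) = c"
proof (rule ccontr)
  assume neg: "\<not> ?thesis"
  define J where "J = ball z r"
  have J: "open J" "bounded J" "J \<in> lmeasurable" by (auto simp: J_def)
  have l: "S \<inter> J \<in> lmeasurable" "J - S \<in> lmeasurable"
    using J(3) S by (auto intro: fmeasurable_Int_fmeasurable simp: Int_commute fmeasurable_Diff)
  have pos: "measure lebesgue B > 0" if "B \<in> lmeasurable" "\<And>x. x \<notin> B \<Longrightarrow> x \<in> J \<longrightarrow> (x \<in> S) = c" for B c
  proof (rule ccontr)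
    assume "\<not> measure lebesgue B > 0"
    then have "measure lebesgue B = 0" using measure_nonneg[of lebesgue B] by linarith
    then have "emeasure lebesgue B = 0" using that(1) by (simp add: emeasure_eq_measure2)
    then have "B \<in> null_sets lebesgue" using that(1) by (intro null_setsI) auto
    then have "AE x in lebesgue. x \<notin> B" by (rule AE_not_in)
    then have "AE x in lborel. x \<notin> B" by (simp add: AE_completion_iff)
    then have "AE x in lborel. x \<in> J \<longrightarrow> (x \<in> S) = c" by eventually_elim (use that(2) in blast)
    with neg show False unfolding J_def by blast
  qed
  have p1: "measure lebesgue (S \<inter> J) > 0" using pos[OF l(1), of False] by auto
  have p2: "measure lebesgue (J - S) > 0" using pos[OF l(2), of True] by auto
  \<comment> \<open>With leaks of 1/8 each, the integral of \<psi> over S is at least 1 - 1/8 - 1/8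
    = 3/4, above the bound 1/2 that the light ball imposes.\<close>
  obtain f :: "real \<Rightarrow> real" where f: "continuous_on UNIV f" "\<And>x. 0 \<le> f x" "\<And>x. x \<notin> J \<Longrightarrow> f x = 0"
    "integrable lebesgue f" "(LINT x|lebesgue. f x) = 1" "(LINT x:-(S \<inter> J)|lebesgue. f x) \<le> 1/8"
    by (rule concentrated_continuous[OF l(1) p1 _ J(1,2), of "1/8"]) auto
  obtain g :: "real \<Rightarrow> real" where g: "continuous_on UNIV g" "\<And>x. 0 \<le> g x" "\<And>x. x \<notin> J \<Longrightarrow> g x = 0"
    "integrable lebesgue g" "(LINT x|lebesgue. g x) = 1" "(LINT x:-(J - S)|lebesgue. g x) \<le> 1/8"
    by (rule concentrated_continuous[OF l(2) p2 _ J(1,2), of "1/8"]) auto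
  have [measurable]: "f \<in> borel_measurable borel" "g \<in> borel_measurable borel"
    using f(1) g(1) by (auto intro: borel_measurable_continuous_onI)
  have fb: "integrable lborel f" "(LINT x|lborel. f x) = 1" and gb: "integrable lborel g" "(LINT x|lborel. g x) = 1"
    using f(4,5) g(4,5) by (auto simp: integrable_completion integral_completion)
  define \<psi> where "\<psi> = (\<lambda>x. f x - g x)"
  have c\<psi>: "continuous_on UNIV \<psi>" unfolding \<psi>_def using f(1) g(1) by (intro continuous_intros)
  then have iso: "isCont \<psi> x" for x by (simp add: continuous_on_eq_continuous_at)
  obtain F where F: "\<And>x. (F has_real_derivative \<psi> x) (at x)"
    using einterval_antiderivative[of "-\<infinity>" "\<infinity>" \<psi>] iso
    by (auto simp: has_real_derivative_iff_has_vector_derivative)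
  define a where "a = z - r"
  define \<phi> where "\<phi> x = F x - F a" for x
  have FTC: "has_bochner_integral lborel (\<lambda>y. \<psi> y * indicator {a..x} y) (\<phi> x)" if "a \<le> x" for x
    unfolding \<phi>_def using that F iso by (intro has_bochner_integral_FTC_Icc_real) auto
  \<comment> \<open>The partial masses of f and g both lie in [0, 1], so their difference is at most
    1 in absolute value.\<close>
  have bd: "\<bar>\<phi> x\<bar> \<le> 1" if "a \<le> x" for x
  proof -
    have i: "integrable lborel (\<lambda>y. h y * indicator {a..x} y)" if "integrable lborel h" for h :: "real \<Rightarrow> real"
      using integrable_mult_indicator[OF _ that, of "{a..x}"] by (simp add: mult.commute)
    have "\<phi> x = (LINT y|lborel. f y * indicator {a..x} y - g y * indicator {a..x} y)"
      using FTC[OF that] by (simp add: has_bochner_integral_iff \<psi>_def left_diff_distrib)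
    also have "\<dots> = (LINT y|lborel. f y * indicator {a..x} y) - (LINT y|lborel. g y * indicator {a..x} y)"
      using i[OF fb(1)] i[OF gb(1)] by simp
    finally have e: "\<phi> x = (LINT y|lborel. f y * indicator {a..x} y) - (LINT y|lborel. g y * indicator {a..x} y)" .
    have "(LINT y|lborel. f y * indicator {a..x} y) \<le> (LINT y|lborel. f y)"
      using f(2) fb i[OF fb(1)] by (intro integral_mono) (auto split: split_indicator)
    moreover have "(LINT y|lborel. g y * indicator {a..x} y) \<le> (LINT y|lborel. g y)"
      using g(2) gb i[OF gb(1)] by (intro integral_mono) (auto split: split_indicator)
    moreover have "0 \<le> (LINT y|lborel. f y * indicator {a..x} y)" "0 \<le> (LINT y|lborel. g y * indicator {a..x} y)"
      using f(2) g(2) by (auto intro!: integral_nonneg_AE)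
    ultimately show ?thesis using e fb gb by linarith
  qed
  have zero: "\<phi> x = 0" if "x \<notin> J" for x
  proof (cases "x \<le> a")
    case True
    have \<psi>0: "\<psi> y * indicator {x..a} y = 0" for y
      using f(3)[of y] g(3)[of y] by (auto simp: J_def a_def \<psi>_def dist_real_def split: split_indicator)
    have "has_bochner_integral lborel (\<lambda>y. \<psi> y * indicator {x..a} y) (F a - F x)"
      using True F iso by (intro has_bochner_integral_FTC_Icc_real) auto
    then show ?thesis by (simp add: \<psi>0 \<phi>_def has_bochner_integral_iff)
  next
    case False
    \<comment> \<open>Right of the ball the antiderivative has returned to 0, because f and g have
      equal total mass.\<close>
    then have x: "z + r \<le> x" using that by (auto simp: J_def a_def dist_real_def)
    have "(\<lambda>y. \<psi> y * indicator {a..x} y) = \<psi>"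
    proof
      fix y show "\<psi> y * indicator {a..x} y = \<psi> y"
        using x f(3)[of y] g(3)[of y] by (auto simp: J_def a_def \<psi>_def dist_real_def split: split_indicator)
    qed
    with FTC[of x] False have "\<phi> x = (LINT y|lborel. \<psi> y)" by (simp add: has_bochner_integral_iff)
    then show ?thesis using fb gb by (simp add: \<psi>_def)
  qed
  have d: "(\<phi> has_derivative (\<lambda>v. \<psi> x * v)) (at x)" for x
    using F[of x] unfolding \<phi>_def has_field_derivative_def by (auto intro!: derivative_eq_intros)
  have C1: "C1_compact_support \<phi>" "frechet_derivative \<phi> (at x) = (\<lambda>v. \<psi> x * v)" for x
    using C1_compact_supportI[OF d _ J(2) zero] c\<psi> by auto
  have "(LINT x:S|lebesgue. \<psi> x) = - (LINT x|\<mu>. \<phi> x * \<sigma> x)"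
    using polar_derivativeD[OF P C1(1), of 1] by (simp add: C1(2))
  also have "\<dots> \<le> \<bar>LINT x|\<mu>. \<phi> x * \<sigma> x\<bar>" by simp
  also have "\<dots> \<le> (LINT x|\<mu>. \<bar>\<phi> x * \<sigma> x\<bar>)" by (rule integral_abs_bound)
  also have "\<dots> \<le> (LINT x|\<mu>. indicator J x)"
  proof (rule integral_mono_AE')
    have "J \<in> fmeasurable \<mu>" using polar_derivative_integrable(1)[OF P, of J] J by auto
    then show "integrable \<mu> (indicat_real J)" by (auto simp: fmeasurable_def)
    have "AE x in \<mu>. norm (\<sigma> x) = 1" using P by (simp add: polar_derivative_def)
    then show "AE x in \<mu>. \<bar>\<phi> x * \<sigma> x\<bar> \<le> indicator J x"
    proof eventually_elim
      fix x assume "norm (\<sigma> x) = 1"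
      then show "\<bar>\<phi> x * \<sigma> x\<bar> \<le> indicator J x"
        using zero[of x] bd[of x] by (auto simp: abs_mult J_def a_def dist_real_def split: split_indicator)
    qed
  qed simp
  also have "\<dots> < 1/2"
  proof -
    have "space \<mu> = UNIV" using P sets_eq_imp_space_eq[of \<mu> borel] by (simp add: polar_derivative_def)
    then show ?thesis using light by (simp add: J_def)
  qed
  finally have upper: "(LINT x:S|lebesgue. \<psi> x) < 1/2" .
  have si: "integrable lebesgue (\<lambda>x. indicat_real B x * h x)" if "B \<in> sets lebesgue" "integrable lebesgue h" for B h
    using integrable_mult_indicator[OF that] by simp
  have cl: "-(S \<inter> J) \<in> sets lebesgue" "-(J - S) \<in> sets lebesgue"
    using l by (auto simp only: fmeasurableD Compl_in_sets_lebesgue)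
  have "(LINT x:S|lebesgue. \<psi> x) = (LINT x|lebesgue. indicat_real S x * f x) - (LINT x|lebesgue. indicat_real S x * g x)"
    unfolding set_lebesgue_integral_def \<psi>_def using si[OF S f(4)] si[OF S g(4)] by (simp add: right_diff_distrib)
  moreover have "1 - (LINT x|lebesgue. indicat_real S x * f x) \<le> 1/8"
  proof -
    have "1 - (LINT x|lebesgue. indicat_real S x * f x) = (LINT x|lebesgue. f x - indicat_real S x * f x)"
      using si[OF S f(4)] f(4,5) by simp
    also have "\<dots> \<le> (LINT x|lebesgue. indicat_real (-(S \<inter> J)) x * f x)"
      using si[OF S f(4)] si[OF cl(1) f(4)] f(4) f(2)
      by (intro integral_mono) (auto split: split_indicator)
    also have "\<dots> \<le> 1/8" using f(6) by (simp add: set_lebesgue_integral_def)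
    finally show ?thesis .
  qed
  moreover have "(LINT x|lebesgue. indicat_real S x * g x) \<le> (LINT x|lebesgue. indicat_real (-(J - S)) x * g x)"
    using si[OF S g(4)] si[OF cl(2) g(4)] g(2) by (intro integral_mono) (auto split: split_indicator)
  moreover have "(LINT x|lebesgue. indicat_real (-(J - S)) x * g x) \<le> 1/8" using g(6) by (simp add: set_lebesgue_integral_def)
  ultimately show False using upper by linarith
qed

text \<open>By \<open>atom_in_reduced_boundary\<close> the point is no atom, so a small ball around
  it has mass below 1/2 and \<open>light_ball_AE_const\<close> applies.\<close>

lemma notin_reduced_boundary_AE_const:
  fixes S :: "real set"
  assumes "locally_finite_perimeter S" "z \<notin> reduced_boundary S"
  shows "\<exists>r>0. \<exists>c. AE x in lborel. x \<in> ball z r \<longrightarrow> (x \<in> S) = c"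
proof -
  obtain \<mu> \<sigma> where P: "polar_derivative S \<mu> \<sigma>" and S: "S \<in> sets lebesgue"
    using assms(1) by (auto simp: locally_finite_perimeter_def)
  have sets: "sets \<mu> = sets borel" and fin: "\<And>C. compact C \<Longrightarrow> emeasure \<mu> C < \<infinity>"
    using P by (auto simp: polar_derivative_def)
  have "measure \<mu> {z} = 0"
    using atom_in_reduced_boundary[OF P, of z] assms(2) measure_nonneg[of \<mu> "{z}"] by linarith
  moreover obtain R where R: "R > 0" "\<And>r. r \<le> R \<Longrightarrow> measure \<mu> (ball z r - {z}) < 1/2"
    using small_punctured_ball[OF sets fin, of "1/2" z] by auto
  moreover have "measure \<mu> (ball z R) \<le> measure \<mu> ({z} \<union> (ball z R - {z}))"
    using R(1) by (simp add: insert_absorb)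
  moreover have "\<dots> \<le> measure \<mu> {z} + measure \<mu> (ball z R - {z})"
    using polar_derivative_integrable(1)[OF P] bounded_subset[OF bounded_ball[of z R]]
    by (intro measure_Un_le) (auto simp: fmeasurable_def)
  ultimately have "measure \<mu> (ball z R) < 1/2" using R(2)[of R] by linarith
  from light_ball_AE_const[OF P S R(1) this] R(1) show ?thesis by blast
qed

lemma no_reduced_boundary_AE_const:
  fixes S :: "real set"
  assumes "locally_finite_perimeter S" "open I" "connected I" "I \<inter> reduced_boundary S = {}"
  shows "\<exists>c. AE x in lborel. x \<in> I \<longrightarrow> (x \<in> S) = c"
  using assms by (intro connected_AE_const notin_reduced_boundary_AE_const) auto

section \<open>Null sets and an explicit slice\<close>

lemma locally_finite_perimeter_negligible:
  fixes E :: "'a::euclidean_space set"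
  assumes "negligible E"
  shows "locally_finite_perimeter E"
proof -
  have N: "E \<in> null_sets lebesgue" using assms by (simp add: negligible_iff_null_sets)
  \<comment> \<open>The zero field is admissible, since its norm has to be 1 only almost everywhere
    with respect to the zero measure.\<close>
  have "polar_derivative E (null_measure borel) (\<lambda>_. 0)"
    unfolding polar_derivative_def
  proof (intro conjI allI impI ballI)
    show "AE x in null_measure borel. norm (0::'a) = 1"
      by (rule AE_I[of _ _ UNIV]) auto
    fix \<phi> :: "'a \<Rightarrow> real" and b :: 'a
    have "AE x in lebesgue. indicat_real E x *\<^sub>R frechet_derivative \<phi> (at x) b = 0"
      using AE_not_in[OF N] by eventually_elim auto
    then have "(LINT x:E|lebesgue. frechet_derivative \<phi> (at x) b) = 0"
      unfolding set_lebesgue_integral_def by (rule integral_eq_zero_AE)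
    then show "(LINT x:E|lebesgue. frechet_derivative \<phi> (at x) b) = - (LINT x|null_measure borel. \<phi> x * (0 \<bullet> b))"
      by simp
  qed auto
  then show ?thesis using N unfolding locally_finite_perimeter_def by auto
qed

lemma reduced_boundary_empty [simp]: "reduced_boundary ({} :: 'a::euclidean_space set) = {}"
  using notin_reduced_boundaryI[where R=1 and E="{} :: 'a set"] by (auto simp: set_lebesgue_integral_def)

text \<open>Makes the family under the infimum in \<open>stripe_dist\<close> nonempty, so that a
  value below a bound yields a competitor.\<close>

lemma empty_in_stripes: "{} \<in> stripes j \<eta>"
  unfolding stripes_def by (auto intro!: exI[of _ "{}"] locally_finite_perimeter_negligible)

text \<open>With a second coordinate k, the i-th axis lies in the null hyperplane where the k-th
  coordinate vanishes. Hence any S whatsoever is the slice of a null set, and (P) can be tested on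
  one-dimensional sets of choice.\<close>

lemma locally_finite_perimeter_on_axis:
  fixes i :: "'n::finite"
  assumes "CARD('n) \<noteq> 1"
  obtains E :: "(real ^ 'n) set" where "locally_finite_perimeter E" "slice i E 0 = S"
proof -
  define E :: "(real ^ 'n) set" where "E = (\<lambda>u. u *\<^sub>R unit_vec i) ` S"
  obtain k where k: "k \<noteq> i"
    using assms by (metis UNIV_eq_I card_1_singleton_iff insertI1 singleton_iff is_singletonI is_singleton_altdef UNIV_I)
  have "E \<subseteq> {x. axis k 1 \<bullet> x = 0}" using k by (auto simp: E_def inner_axis_axis inner_commute)
  moreover have "negligible {x::real ^ 'n. axis k 1 \<bullet> x = 0}" by (intro negligible_hyperplane) (auto simp: axis_eq_0_iff)
  ultimately have "negligible E" by (rule negligible_subset[rotated])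
  moreover have "slice i E 0 = S"
    unfolding slice_def E_def by (auto simp: image_iff axis_eq_0_iff)
  ultimately show ?thesis using that locally_finite_perimeter_negligible by blast
qed

text \<open>The derivative of S is a signed counting measure on the endpoints, with sign 1 where S
  begins and -1 where it ends. Each endpoint is an atom, and away from the endpoints S is locally
  constant.\<close>

lemma four_point_set:
  fixes a b c s :: real
  assumes ord: "c < a" "a < s" "s < b"
  defines "S \<equiv> {..<c} \<union> {a<..<s} \<union> {b<..}"
  shows "locally_finite_perimeter S" "{a, s, b} \<subseteq> reduced_boundary S"
    "reduced_boundary S \<inter> {a<..<b} = {s}"
proof -
  define P where "P = {c, a, s, b}"
  have fP: "finite P" by (simp add: P_def)
  define \<mu> where "\<mu> = distr (count_space P) borel (\<lambda>x. x)"
  define \<sigma> where "\<sigma> x = (if x \<in> {a, b} then 1 else - 1 :: real)" for x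
  have [measurable]: "\<sigma> \<in> borel_measurable borel" unfolding \<sigma>_def by measurable
  have em: "emeasure \<mu> X = of_nat (card (X \<inter> P))" if "X \<in> sets borel" for X
    using that fP unfolding \<mu>_def by (simp add: emeasure_distr)
  have SB [measurable]: "S \<in> sets borel" unfolding S_def by simp
  have "polar_derivative S \<mu> \<sigma>"
    unfolding polar_derivative_def
  proof (intro conjI allI impI ballI)
    show "sets \<mu> = sets borel" by (simp add: \<mu>_def)
    show "emeasure \<mu> C < \<infinity>" if "compact C" for C
      using that by (simp add: em borel_compact of_nat_less_top)
    show "\<sigma> \<in> borel_measurable borel" by simp
    show "AE x in \<mu>. norm (\<sigma> x) = 1" by (rule AE_I2) (simp add: \<sigma>_def)
    fix \<phi> :: "real \<Rightarrow> real" and e :: real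
    assume \<phi>: "C1_compact_support \<phi>" and e: "e \<in> Basis"
    define D where "D = (\<lambda>x. frechet_derivative \<phi> (at x) 1)"
    have [measurable]: "D \<in> borel_measurable borel"
      using C1_real_cont[OF \<phi>] unfolding D_def by (rule borel_measurable_continuous_onI)
    have [measurable]: "\<phi> \<in> borel_measurable borel"
      using C1_real_deriv[OF \<phi>] by (intro borel_measurable_continuous_onI) (meson DERIV_isCont continuous_at_imp_continuous_on)
    note I = C1_real_integrals[OF \<phi>, folded D_def]
    have Ic: "(LINT x|lborel. indicat_real {..<q} x * D x) = \<phi> q" for q
      using C1_real_integrals(3)[OF \<phi>, of q] by (simp add: D_def)
    have Ii: "integrable lborel (\<lambda>x. indicat_real {..<q} x * D x)" for q
      using integrable_mult_indicator[OF _ I(1), of "{..<q}"] by simp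
    have "(LINT x:S|lebesgue. D x) = (LINT x|lborel. indicat_real S x * D x)"
      unfolding set_lebesgue_integral_def using SB by (subst integral_completion) auto
    also have "\<dots> = (LINT x|lborel. indicat_real {..<c} x * D x - indicat_real {..<a} x * D x
        + indicat_real {..<s} x * D x - indicat_real {..<b} x * D x + D x)"
    proof (rule integral_cong_AE)
      show "AE x in lborel. indicat_real S x * D x = indicat_real {..<c} x * D x - indicat_real {..<a} x * D x
        + indicat_real {..<s} x * D x - indicat_real {..<b} x * D x + D x"
        using AE_lborel_singleton[of a] AE_lborel_singleton[of b]
      proof eventually_elim
        fix x assume "x \<noteq> a" "x \<noteq> b"
        then show "indicat_real S x * D x = indicat_real {..<c} x * D x - indicat_real {..<a} x * D x
        + indicat_real {..<s} x * D x - indicat_real {..<b} x * D x + D x"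
          using ord by (auto simp: S_def split: split_indicator)
      qed
    qed measurable
    also have "\<dots> = \<phi> c - \<phi> a + \<phi> s - \<phi> b" using I(1,2) Ic Ii by simp
    also have "\<dots> = - (LINT x|\<mu>. \<phi> x * \<sigma> x)"
    proof -
      have "(LINT x|\<mu>. \<phi> x * \<sigma> x) = (\<Sum>x\<in>P. \<phi> x * \<sigma> x)"
        unfolding \<mu>_def using fP by (simp add: integral_distr lebesgue_integral_count_space_finite)
      then show ?thesis using ord by (simp add: P_def \<sigma>_def)
    qed
    finally show "(LINT x:S|lebesgue. frechet_derivative \<phi> (at x) e) = - (LINT x|\<mu>. \<phi> x * (\<sigma> x \<bullet> e))"
      using e by (simp add: D_def)
  qed
  note pol = this
  then show "locally_finite_perimeter S" using SB unfolding locally_finite_perimeter_def by auto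
  have "x \<in> reduced_boundary S" if "x \<in> P" for x
  proof (rule atom_in_reduced_boundary[OF pol])
    have "{x} \<inter> P = {x}" using that by auto
    then show "measure \<mu> {x} > 0" by (simp add: measure_def em)
  qed
  then show sub: "{a, s, b} \<subseteq> reduced_boundary S" by (auto simp: P_def)
  have "x \<notin> reduced_boundary S" if x: "a < x" "x < b" "x \<noteq> s" for x
  proof -
    define r where "r = Min {x - a, b - x, \<bar>x - s\<bar>}"
    have r: "r > 0" "r \<le> x - a" "r \<le> b - x" "r \<le> \<bar>x - s\<bar>" unfolding r_def using x by auto
    have "AE y in lborel. y \<in> ball x r \<longrightarrow> (y \<in> S) = (x < s)"
      using r ord by (intro AE_I2) (auto simp: S_def dist_real_def)
    with SB r(1) show ?thesis by (intro AE_const_notin_reduced_boundary) auto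
  qed
  then show "reduced_boundary S \<inter> {a<..<b} = {s}" using sub ord by force
qed

section \<open>Splitting off one coordinate\<close>

definition insert_coord :: "'n::finite \<Rightarrow> real \<Rightarrow> ('n \<Rightarrow> real) \<Rightarrow> real ^ 'n" where
  "insert_coord i z g = (\<chi> k. if k = i then z else g k)"

abbreviation perp_measure :: "'n::finite \<Rightarrow> ('n \<Rightarrow> real) measure" where
  "perp_measure i \<equiv> \<Pi>\<^sub>M k\<in>UNIV - {i}. lborel"

text \<open>The restriction makes the value an extensional function, hence a point of the space of
  \<open>perp_measure i\<close>. Together with the i-th coordinate it inverts
  \<open>insert_coord\<close> there.\<close>

definition perp_coords :: "'n::finite \<Rightarrow> real ^ 'n \<Rightarrow> 'n \<Rightarrow> real" where
  "perp_coords i x = restrict (\<lambda>k. x $ k) (UNIV - {i})"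

lemma insert_coord_nth [simp]: "insert_coord i z g $ k = (if k = i then z else g k)"
  by (simp add: insert_coord_def)

lemma measurable_insert_coord:
  "(\<lambda>(z, g). insert_coord i z g) \<in> borel_measurable (lborel \<Otimes>\<^sub>M perp_measure i)"
proof (subst borel_measurable_euclidean_space, intro ballI)
  fix b :: "real ^ 'a" assume "b \<in> Basis"
  then obtain k where b: "b = axis k 1" by (auto simp: Basis_vec_def)
  have "(\<lambda>\<omega>. (case \<omega> of (z, g) \<Rightarrow> insert_coord i z g) \<bullet> b) = (if k = i then fst else (\<lambda>\<omega>. snd \<omega> k))"
    by (auto simp: b inner_axis fun_eq_iff)
  then show "(\<lambda>\<omega>. (case \<omega> of (z, g) \<Rightarrow> insert_coord i z g) \<bullet> b) \<in> borel_measurable (lborel \<Otimes>\<^sub>M perp_measure i)"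
    by simp
qed

lemma measurable_insert_coord' [measurable (raw)]:
  assumes "f \<in> borel_measurable M" "g \<in> measurable M (perp_measure i)"
  shows "(\<lambda>x. insert_coord i (f x) (g x)) \<in> borel_measurable M"
proof -
  have "(\<lambda>x. (f x, g x)) \<in> measurable M (lborel \<Otimes>\<^sub>M perp_measure i)" using assms by simp
  from measurable_compose[OF this measurable_insert_coord] show ?thesis by simp
qed

lemma measurable_perp_coords: "(\<lambda>x. (x $ i, perp_coords i x)) \<in> measurable lborel (lborel \<Otimes>\<^sub>M perp_measure i)"
  unfolding perp_coords_def by (intro measurable_Pair measurable_restrict) (auto intro: borel_measurable_continuous_onI continuous_intros)

lemma sigma_finite_perp_measure: "sigma_finite_measure (perp_measure i)"
proof -
  interpret product_sigma_finite "\<lambda>_ :: 'a. lborel :: real measure" ..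
  show ?thesis by (rule sigma_finite) simp
qed

text \<open>Lebesgue measure is determined by its values on boxes, and a box pulls back to an
  interval times a product of intervals.\<close>

lemma lborel_eq_insert_coord:
  "lborel = distr (lborel \<Otimes>\<^sub>M perp_measure i) borel (\<lambda>(z, g). insert_coord i z g)"
proof (rule lborel_eqI)
  interpret product_sigma_finite "\<lambda>_ :: 'a. lborel :: real measure" ..
  interpret H: sigma_finite_measure "perp_measure i" by (rule sigma_finite_perp_measure)
  fix l u :: "real ^ 'a" assume "\<And>b. b \<in> Basis \<Longrightarrow> l \<bullet> b \<le> u \<bullet> b"
  then have lu: "l $ k \<le> u $ k" for k
    using \<open>\<And>b. b \<in> Basis \<Longrightarrow> l \<bullet> b \<le> u \<bullet> b\<close>[of "axis k 1"] by (simp add: inner_axis axis_in_Basis_iff)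
  let ?M = "lborel \<Otimes>\<^sub>M perp_measure i"
  have "emeasure (distr ?M borel (\<lambda>(z, g). insert_coord i z g)) (box l u)
      = emeasure ?M ((\<lambda>(z, g). insert_coord i z g) -` box l u \<inter> space ?M)"
    using measurable_insert_coord by (rule emeasure_distr) simp
  also have "(\<lambda>(z, g). insert_coord i z g) -` box l u \<inter> space ?M
      = {l $ i<..<u $ i} \<times> (\<Pi>\<^sub>E k\<in>UNIV - {i}. {l $ k<..<u $ k})"
  proof -
    have "insert_coord i z g \<in> box l u \<longleftrightarrow> z \<in> {l $ i<..<u $ i} \<and> (\<forall>k\<in>UNIV - {i}. g k \<in> {l $ k<..<u $ k})" for z g
    proof -
      have "insert_coord i z g \<in> box l u \<longleftrightarrow> (\<forall>k\<in>insert i (UNIV - {i}). insert_coord i z g $ k \<in> {l $ k<..<u $ k})"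
        unfolding mem_box_cart by (simp add: insert_UNIV)
      also have "\<dots> \<longleftrightarrow> z \<in> {l $ i<..<u $ i} \<and> (\<forall>k\<in>UNIV - {i}. g k \<in> {l $ k<..<u $ k})"
        unfolding ball_simps(7) by (intro conj_cong ball_cong) auto
      finally show ?thesis .
    qed
    then show ?thesis
      by (intro set_eqI) (simp add: space_pair_measure space_PiM PiE_iff mem_Times_iff case_prod_unfold conj_ac)
  qed
  also have "emeasure ?M \<dots> = emeasure lborel {l $ i<..<u $ i} * emeasure (perp_measure i) (\<Pi>\<^sub>E k\<in>UNIV - {i}. {l $ k<..<u $ k})"
    by (intro H.emeasure_pair_measure_Times) auto
  also have "emeasure (perp_measure i) (\<Pi>\<^sub>E k\<in>UNIV - {i}. {l $ k<..<u $ k}) = (\<Prod>k\<in>UNIV - {i}. ennreal (u $ k - l $ k))"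
    using lu by (subst emeasure_PiM) auto
  also have "emeasure lborel {l $ i<..<u $ i} * \<dots> = (\<Prod>k\<in>UNIV. ennreal (u $ k - l $ k))"
    using lu by (simp add: prod.remove[of UNIV i "\<lambda>k. ennreal (u $ k - l $ k)"])
  also have "\<dots> = ennreal (\<Prod>k\<in>UNIV. u $ k - l $ k)" using lu by (intro prod_ennreal) auto
  also have "(\<Prod>k\<in>UNIV. u $ k - l $ k) = (\<Prod>b\<in>Basis. (u - l) \<bullet> b)"
  proof -
    have "(\<Prod>b\<in>Basis. (u - l) \<bullet> b) = (\<Prod>b\<in>range (\<lambda>k. axis k 1). (u - l) \<bullet> b)"
      by (rule prod.cong) (auto simp: Basis_vec_def)
    also have "\<dots> = (\<Prod>k\<in>UNIV. (u - l) \<bullet> axis k 1)"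
      by (subst prod.reindex) (auto simp: inj_on_def axis_eq_axis)
    finally show ?thesis by (simp add: inner_axis)
  qed
  finally show "emeasure (distr ?M borel (\<lambda>(z, g). insert_coord i z g)) (box l u) = (\<Prod>b\<in>Basis. (u - l) \<bullet> b)" .
qed simp

text \<open>This direction carries almost-everywhere statements about the perpendicular coordinates
  back to the full space, as in \<open>AE_perp_coords\<close>.\<close>

lemma pair_eq_perp_coords:
  "lborel \<Otimes>\<^sub>M perp_measure i = distr lborel (lborel \<Otimes>\<^sub>M perp_measure i) (\<lambda>x. (x $ i, perp_coords i x))"
proof -
  let ?M = "lborel \<Otimes>\<^sub>M perp_measure i"
  have "distr lborel ?M (\<lambda>x. (x $ i, perp_coords i x)) =
      distr (distr ?M borel (\<lambda>(z, g). insert_coord i z g)) ?M (\<lambda>x. (x $ i, perp_coords i x))"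
    using lborel_eq_insert_coord[of i] by simp
  also have "\<dots> = distr ?M ?M ((\<lambda>x. (x $ i, perp_coords i x)) \<circ> (\<lambda>(z, g). insert_coord i z g))"
    using measurable_perp_coords measurable_insert_coord by (intro distr_distr) simp_all
  also have "\<dots> = distr ?M ?M (\<lambda>\<omega>. \<omega>)"
    by (rule distr_cong) (auto simp: space_pair_measure space_PiM perp_coords_def fun_eq_iff PiE_def extensional_def)
  also have "\<dots> = ?M" by (rule distr_id)
  finally show ?thesis by simp
qed

lemma nn_integral_insert_coord:
  assumes [measurable]: "f \<in> borel_measurable borel"
  shows "(\<integral>\<^sup>+x. f x \<partial>lborel) = (\<integral>\<^sup>+z. \<integral>\<^sup>+g. f (insert_coord i z g) \<partial>perp_measure i \<partial>lborel)"
proof -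
  interpret H: sigma_finite_measure "perp_measure i" by (rule sigma_finite_perp_measure)
  have "(\<integral>\<^sup>+x. f x \<partial>lborel) = (\<integral>\<^sup>+x. f x \<partial>distr (lborel \<Otimes>\<^sub>M perp_measure i) borel (\<lambda>(z, g). insert_coord i z g))"
    using lborel_eq_insert_coord[of i] by simp
  also have "\<dots> = (\<integral>\<^sup>+\<omega>. f (insert_coord i (fst \<omega>) (snd \<omega>)) \<partial>(lborel \<Otimes>\<^sub>M perp_measure i))"
    using measurable_insert_coord[of i] by (subst nn_integral_distr) (auto simp: case_prod_unfold)
  also have "\<dots> = (\<integral>\<^sup>+z. \<integral>\<^sup>+g. f (insert_coord i z g) \<partial>perp_measure i \<partial>lborel)"
    by (subst H.nn_integral_fst[symmetric]) auto
  finally show ?thesis .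
qed

section \<open>Null sets under the coordinate maps\<close>

lemma AE_insert_coord:
  assumes "AE x in lborel. P x"
  shows "AE z in lborel. AE g in perp_measure i. P (insert_coord i z g)"
proof -
  interpret H: sigma_finite_measure "perp_measure i" by (rule sigma_finite_perp_measure)
  interpret pair_sigma_finite lborel "perp_measure i" ..
  have "AE x in distr (lborel \<Otimes>\<^sub>M perp_measure i) borel (\<lambda>(z, g). insert_coord i z g). P x"
    using assms by (simp only: lborel_eq_insert_coord[of i, symmetric])
  from AE_distrD[OF measurable_insert_coord this]
  have "AE \<omega> in lborel \<Otimes>\<^sub>M perp_measure i. P (case \<omega> of (z, g) \<Rightarrow> insert_coord i z g)" .
  from AE_pair[OF this] show ?thesis by simp
qed

lemma AE_coord:
  fixes i :: "'n::finite" and P :: "real \<Rightarrow> bool"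
  assumes "AE z in lborel. P z"
  shows "AE x in lborel. P (x $ i)"
proof -
  obtain N where N: "{z. \<not> P z} \<subseteq> N" "N \<in> null_sets lborel" using assms by (auto elim!: AE_E simp: null_sets_def)
  have [measurable]: "N \<in> sets borel" using N by auto
  have m: "(\<lambda>x::real ^ 'n. x $ i) \<in> borel_measurable borel"
    by (auto intro: borel_measurable_continuous_onI continuous_intros)
  have "(\<integral>\<^sup>+x. indicator N ((x::real ^ 'n) $ i) \<partial>lborel)
      = (\<integral>\<^sup>+z. \<integral>\<^sup>+g. indicator N z \<partial>perp_measure i \<partial>lborel)"
    using m by (subst nn_integral_insert_coord[of _ i]) auto
  also have "\<dots> = (\<integral>\<^sup>+z. indicator N z * emeasure (perp_measure i) (space (perp_measure i)) \<partial>lborel)"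
    by (simp add: mult.commute)
  also have "\<dots> = emeasure lborel N * emeasure (perp_measure i) (space (perp_measure i))"
    by (subst nn_integral_multc) auto
  \<comment> \<open>The second factor may be infinite; 0 times infinity is 0 in
    \<open>ennreal\<close>.\<close>
  also have "\<dots> = 0" using N by auto
  finally have "AE x in lborel. indicator N ((x::real ^ 'n) $ i) = (0::ennreal)"
    using m by (subst (asm) nn_integral_0_iff_AE) auto
  then show ?thesis by eventually_elim (use N in \<open>auto split: split_indicator_asm\<close>)
qed

lemma AE_perp_coords:
  assumes "AE g in perp_measure i. P g"
  shows "AE x in lborel. P (perp_coords i x)"
proof -
  interpret H: sigma_finite_measure "perp_measure i" by (rule sigma_finite_perp_measure)
  obtain N where N: "{g\<in>space (perp_measure i). \<not> P g} \<subseteq> N" "N \<in> null_sets (perp_measure i)"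
    using assms by (auto elim!: AE_E simp: null_sets_def)
  have "AE \<omega> in lborel \<Otimes>\<^sub>M perp_measure i. P (snd \<omega>)"
  proof (rule AE_I)
    show "{\<omega> \<in> space (lborel \<Otimes>\<^sub>M perp_measure i). \<not> P (snd \<omega>)} \<subseteq> UNIV \<times> N"
      using N(1) by (auto simp: space_pair_measure)
    show "UNIV \<times> N \<in> sets (lborel \<Otimes>\<^sub>M perp_measure i)" using N(2) by auto
    show "emeasure (lborel \<Otimes>\<^sub>M perp_measure i) (UNIV \<times> N) = 0"
      using N(2) by (subst H.emeasure_pair_measure_Times) auto
  qed
  then have "AE \<omega> in distr lborel (lborel \<Otimes>\<^sub>M perp_measure i) (\<lambda>x. (x $ i, perp_coords i x)). P (snd \<omega>)"
    by (simp only: pair_eq_perp_coords[of i, symmetric])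
  from AE_distrD[OF measurable_perp_coords this] show ?thesis by simp
qed

section \<open>The kernel and its tails\<close>

lemma nn_integral_reflect:
  fixes f :: "real \<Rightarrow> ennreal"
  assumes "f \<in> borel_measurable borel"
  shows "(\<integral>\<^sup>+x. f (t - x) \<partial>lborel) = (\<integral>\<^sup>+x. f x \<partial>lborel)"
  using nn_integral_real_affine[OF assms, of "-1" t] by simp

lemma nn_integral_powr_abs_finite:
  fixes a c :: real
  assumes "c > 0" "a > 1"
  shows "(\<integral>\<^sup>+z. ennreal ((c + \<bar>z\<bar>) powr - a) \<partial>lborel) < \<infinity>"
proof -
  define h :: "real \<Rightarrow> ennreal" where "h z = ennreal ((c + z) powr - a) * indicator {0..} z" for z
  define F where "F x = (c + x) powr (1 - a) / (1 - a)" for x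
  have [measurable]: "h \<in> borel_measurable borel" unfolding h_def by measurable
  have "(\<integral>\<^sup>+z. h z \<partial>lborel) = ennreal (0 - F 0)"
    unfolding h_def
  proof (rule nn_integral_FTC_atLeast)
    show "(F has_real_derivative (c + x) powr - a) (at x)" if "0 \<le> x" for x
    proof -
      have "((\<lambda>x. (c + x) powr (1 - a)) has_real_derivative (1 - a) * (c + x) powr - a) (at x)"
        using that assms by (auto intro!: derivative_eq_intros)
      from DERIV_cdivide[OF this, of "1 - a"] assms show ?thesis unfolding F_def by simp
    qed
    have "filterlim (\<lambda>x. c + x) at_top (at_top :: real filter)"
      by (intro filterlim_tendsto_add_at_top[OF tendsto_const] filterlim_ident)
    then have "((\<lambda>x. (c + x) powr (1 - a)) \<longlongrightarrow> 0) at_top"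
      using assms by (intro tendsto_neg_powr) auto
    from tendsto_divide_zero[OF this] show "(F \<longlongrightarrow> 0) at_top" unfolding F_def .
  qed auto
  then have fin: "(\<integral>\<^sup>+z. h z \<partial>lborel) < \<infinity>" by simp
  have "(\<integral>\<^sup>+z. ennreal ((c + \<bar>z\<bar>) powr - a) \<partial>lborel) \<le> (\<integral>\<^sup>+z. h z + h (0 - z) \<partial>lborel)"
    unfolding h_def by (intro nn_integral_mono) (auto split: split_indicator)
  also have "\<dots> = (\<integral>\<^sup>+z. h z \<partial>lborel) + (\<integral>\<^sup>+z. h z \<partial>lborel)"
    by (subst nn_integral_add) (auto simp: nn_integral_reflect[of h 0, simplified])
  also have "\<dots> < \<infinity>" using fin by simp
  finally show ?thesis .
qed

lemma l1_norm_nonneg: "0 \<le> l1_norm z"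
  by (simp add: l1_norm_def sum_nonneg)

lemma component_le_l1_norm: "\<bar>z $ k\<bar> \<le> l1_norm z"
  unfolding l1_norm_def by (rule member_le_sum) auto

lemma measurable_l1_norm [measurable]: "l1_norm \<in> borel_measurable borel"
proof -
  have "continuous_on UNIV (l1_norm :: real ^ 'a \<Rightarrow> real)"
    unfolding l1_norm_def[abs_def] by (intro continuous_intros)
  then show ?thesis by (rule borel_measurable_continuous_onI)
qed

text \<open>The base dominates c plus the absolute value of each coordinate. Spreading the exponent
  evenly over the n coordinates therefore bounds the integrand by a product of one-dimensional
  powers, whose exponent q / n exceeds 1.\<close>

lemma nn_integral_l1_norm_powr_finite:
  assumes "c > 0" "q > real CARD('n::finite)"
  shows "(\<integral>\<^sup>+z. ennreal ((l1_norm (z :: real ^ 'n) + c) powr - q) \<partial>lborel) < \<infinity>"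
proof -
  define n where "n = real CARD('n)"
  have n: "n > 0" by (simp add: n_def)
  define f :: "real \<Rightarrow> ennreal" where "f x = ennreal ((c + \<bar>x\<bar>) powr - (q / n))" for x
  have "ennreal ((l1_norm z + c) powr - q) \<le> (\<Prod>b\<in>Basis. f (z \<bullet> b))" for z :: "real ^ 'n"
  proof -
    have "(l1_norm z + c) powr - q = (\<Prod>k::'n\<in>UNIV. (l1_norm z + c) powr - (q / n))"
    proof -
      have "l1_norm z + c > 0" using assms(1) l1_norm_nonneg[of z] by linarith
      then have "((l1_norm z + c) powr - (q / n)) ^ CARD('n) = (l1_norm z + c) powr (- (q / n) * n)"
        by (subst powr_realpow[symmetric]) (auto simp: powr_powr n_def)
      then show ?thesis using n by simp
    qed
    also have "\<dots> \<le> (\<Prod>k\<in>UNIV. (c + \<bar>z $ k\<bar>) powr - (q / n))"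
    proof (intro prod_mono conjI)
      fix k
      have "- (q / n) \<le> 0" using assms n by (simp add: n_def)
      then show "(l1_norm z + c) powr - (q / n) \<le> (c + \<bar>z $ k\<bar>) powr - (q / n)"
        using component_le_l1_norm[of z k] assms by (intro powr_mono2') auto
    qed simp
    finally have "ennreal ((l1_norm z + c) powr - q) \<le> (\<Prod>k\<in>UNIV. f (z $ k))"
      unfolding f_def by (subst prod_ennreal) (auto intro: ennreal_leI)
    also have "\<dots> = (\<Prod>k\<in>UNIV. f (z \<bullet> axis k 1))" by (simp add: inner_axis)
    also have "\<dots> = (\<Prod>b\<in>range (\<lambda>k. axis k 1). f (z \<bullet> b))"
      by (subst prod.reindex) (auto simp: inj_on_def axis_eq_axis)
    also have "\<dots> = (\<Prod>b\<in>Basis. f (z \<bullet> b))" by (rule prod.cong) (auto simp: Basis_vec_def)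
    finally show ?thesis .
  qed
  then have "(\<integral>\<^sup>+z. ennreal ((l1_norm (z :: real ^ 'n) + c) powr - q) \<partial>lborel) \<le> (\<integral>\<^sup>+z. (\<Prod>b\<in>Basis. f ((z :: real ^ 'n) \<bullet> b)) \<partial>lborel)"
    by (rule nn_integral_mono)
  also have "\<dots> = (\<Prod>b\<in>(Basis :: (real ^ 'n) set). \<integral>\<^sup>+x. f x \<partial>lborel)"
    by (rule nn_integral_lborel_prod) (auto simp: f_def)
  also have "\<dots> < \<infinity>"
  proof -
    have "(\<integral>\<^sup>+x. f x \<partial>lborel) < \<infinity>"
      unfolding f_def using assms n by (intro nn_integral_powr_abs_finite) (auto simp: n_def)
    then show ?thesis by (simp add: power_less_top_ennreal)
  qed
  finally show ?thesis .
qed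

lemma measurable_kernel [measurable]: "kernel \<alpha> \<tau> \<in> borel_measurable borel"
  unfolding kernel_def[abs_def] by measurable

lemma kernel_nonneg: "0 \<le> kernel \<alpha> \<tau> z"
  by (simp add: kernel_def)

context
  fixes i :: "'n::finite" and \<alpha> \<tau> :: real
  assumes at: "\<alpha> < 1" "\<tau> > 0"
begin

lemma kernel_eq_powr:
  "kernel \<alpha> \<tau> (z :: real ^ 'n) = (l1_norm z + \<tau> powr (1 / beta_exp \<alpha>)) powr - p_exp CARD('n) \<alpha>"
  by (simp add: kernel_def powr_minus_divide)

lemma nn_integral_kernel_finite: "(\<integral>\<^sup>+z. ennreal (kernel \<alpha> \<tau> (z :: real ^ 'n)) \<partial>lborel) < \<infinity>"
  unfolding kernel_eq_powr using at
  by (intro nn_integral_l1_norm_powr_finite) (auto simp: p_exp_def)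

lemma nn_integral_coord_kernel_finite:
  "(\<integral>\<^sup>+z. ennreal (\<bar>z $ i\<bar> * kernel \<alpha> \<tau> (z :: real ^ 'n)) \<partial>lborel) < \<infinity>"
proof -
  define c p where "c = \<tau> powr (1 / beta_exp \<alpha>)" and "p = p_exp CARD('n) \<alpha>"
  have c: "c > 0" using at by (simp add: c_def)
  have "\<bar>z $ i\<bar> * kernel \<alpha> \<tau> z \<le> (l1_norm z + c) powr - (p - 1)" for z :: "real ^ 'n"
  proof -
    have pos: "l1_norm z + c > 0" using c l1_norm_nonneg[of z] by linarith
    have "\<bar>z $ i\<bar> * kernel \<alpha> \<tau> z \<le> (l1_norm z + c) * (l1_norm z + c) powr - p"
      unfolding kernel_eq_powr c_def[symmetric] p_def[symmetric]
      using component_le_l1_norm[of z i] c by (intro mult_right_mono) auto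
    also have "\<dots> = (l1_norm z + c) powr (1 + - p)" using pos by (subst powr_add) auto
    finally show ?thesis by simp
  qed
  then have "(\<integral>\<^sup>+z. ennreal (\<bar>z $ i\<bar> * kernel \<alpha> \<tau> (z :: real ^ 'n)) \<partial>lborel)
      \<le> (\<integral>\<^sup>+z. ennreal ((l1_norm (z :: real ^ 'n) + c) powr - (p - 1)) \<partial>lborel)"
    by (intro nn_integral_mono ennreal_leI)
  \<comment> \<open>The coordinate costs one power of the base: with d the dimension, p - 1 = d + 1
    - \<alpha> still exceeds d because \<alpha> < 1.\<close>
  also have "\<dots> < \<infinity>" using at c by (intro nn_integral_l1_norm_powr_finite) (auto simp: p_def p_exp_def)
  finally show ?thesis .
qed

lemma kernel_hat_eq: "kernel_hat i \<alpha> \<tau> z = (LINT g|perp_measure i. kernel \<alpha> \<tau> (insert_coord i z g))"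
  by (simp add: kernel_hat_def insert_coord_def)

lemma kernel_hat_nonneg: "0 \<le> kernel_hat i \<alpha> \<tau> z"
  unfolding kernel_hat_eq by (intro integral_nonneg_AE) (auto simp: kernel_nonneg)

lemma kernel_hat_minus: "kernel_hat i \<alpha> \<tau> (- z) = kernel_hat i \<alpha> \<tau> z"
proof -
  have "l1_norm (insert_coord i (- z) g) = l1_norm (insert_coord i z g)" for g
    unfolding l1_norm_def by (rule sum.cong) auto
  then show ?thesis unfolding kernel_hat_eq kernel_def by simp
qed

lemma measurable_kernel_hat [measurable]: "kernel_hat i \<alpha> \<tau> \<in> borel_measurable borel"
proof -
  interpret H: sigma_finite_measure "perp_measure i" by (rule sigma_finite_perp_measure)
  show ?thesis unfolding kernel_hat_eq[abs_def] by measurable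
qed

text \<open>The Bochner integral in \<open>kernel_hat\<close> takes the default value 0 where the
  integrand is not integrable. The kernel has finite total mass, so Tonelli confines this to a null
  set of z.\<close>

lemma AE_kernel_hat:
  "AE z in lborel. ennreal (kernel_hat i \<alpha> \<tau> z) = (\<integral>\<^sup>+g. ennreal (kernel \<alpha> \<tau> (insert_coord i z g)) \<partial>perp_measure i)"
proof -
  interpret H: sigma_finite_measure "perp_measure i" by (rule sigma_finite_perp_measure)
  have "(\<integral>\<^sup>+z. \<integral>\<^sup>+g. ennreal (kernel \<alpha> \<tau> (insert_coord i z g)) \<partial>perp_measure i \<partial>lborel) \<noteq> \<infinity>"
    using nn_integral_kernel_finite by (subst (asm) nn_integral_insert_coord[of _ i]) auto
  then have "AE z in lborel. (\<integral>\<^sup>+g. ennreal (kernel \<alpha> \<tau> (insert_coord i z g)) \<partial>perp_measure i) \<noteq> \<infinity>"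
    by (intro nn_integral_PInf_AE) auto
  then show ?thesis
  proof eventually_elim
    fix z assume fin: "(\<integral>\<^sup>+g. ennreal (kernel \<alpha> \<tau> (insert_coord i z g)) \<partial>perp_measure i) \<noteq> \<infinity>"
    have "kernel_hat i \<alpha> \<tau> z = enn2real (\<integral>\<^sup>+g. ennreal (kernel \<alpha> \<tau> (insert_coord i z g)) \<partial>perp_measure i)"
      unfolding kernel_hat_eq by (rule integral_eq_nn_integral) (auto simp: kernel_nonneg)
    then show "ennreal (kernel_hat i \<alpha> \<tau> z) = (\<integral>\<^sup>+g. ennreal (kernel \<alpha> \<tau> (insert_coord i z g)) \<partial>perp_measure i)"
      using fin by (simp add: less_top)
  qed
qed

lemma nn_integral_kernel_hat:
  assumes [measurable]: "f \<in> borel_measurable borel"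
  shows "(\<integral>\<^sup>+z. f z * ennreal (kernel_hat i \<alpha> \<tau> z) \<partial>lborel) = (\<integral>\<^sup>+x. f (x $ i) * ennreal (kernel \<alpha> \<tau> x) \<partial>lborel)"
proof -
  interpret H: sigma_finite_measure "perp_measure i" by (rule sigma_finite_perp_measure)
  have [measurable]: "(\<lambda>x::real ^ 'n. x $ i) \<in> borel_measurable borel"
    by (auto intro: borel_measurable_continuous_onI continuous_intros)
  have "(\<integral>\<^sup>+z. f z * ennreal (kernel_hat i \<alpha> \<tau> z) \<partial>lborel)
     = (\<integral>\<^sup>+z. f z * (\<integral>\<^sup>+g. ennreal (kernel \<alpha> \<tau> (insert_coord i z g)) \<partial>perp_measure i) \<partial>lborel)"
    using AE_kernel_hat by (intro nn_integral_cong_AE) auto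
  also have "\<dots> = (\<integral>\<^sup>+z. (\<integral>\<^sup>+g. f z * ennreal (kernel \<alpha> \<tau> (insert_coord i z g)) \<partial>perp_measure i) \<partial>lborel)"
    by (intro nn_integral_cong nn_integral_cmult[symmetric]) auto
  also have "\<dots> = (\<integral>\<^sup>+x. f (x $ i) * ennreal (kernel \<alpha> \<tau> x) \<partial>lborel)"
    by (subst nn_integral_insert_coord[of _ i]) auto
  finally show ?thesis .
qed

lemma nn_integral_kernel_hat_finite:
  "(\<integral>\<^sup>+z. ennreal (kernel_hat i \<alpha> \<tau> z) \<partial>lborel) < \<infinity>"
  "(\<integral>\<^sup>+z. ennreal \<bar>z\<bar> * ennreal (kernel_hat i \<alpha> \<tau> z) \<partial>lborel) < \<infinity>"
  using nn_integral_kernel_hat[of "\<lambda>_. 1"] nn_integral_kernel_finite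
    nn_integral_kernel_hat[of "\<lambda>z. ennreal \<bar>z\<bar>"] nn_integral_coord_kernel_finite
  by (auto simp: ennreal_mult kernel_nonneg)

definition kernel_tail :: "real \<Rightarrow> ennreal" where
  "kernel_tail v = (\<integral>\<^sup>+\<rho>. ennreal (kernel_hat i \<alpha> \<tau> \<rho>) * indicator {v<..} \<rho> \<partial>lborel)"

lemma measurable_kernel_tail [measurable]: "kernel_tail \<in> borel_measurable borel"
proof -
  have "kernel_tail = (\<lambda>v. \<integral>\<^sup>+\<rho>. ennreal (kernel_hat i \<alpha> \<tau> \<rho>) * indicator {x. fst x < snd x} (v, \<rho>) \<partial>lborel)"
    unfolding kernel_tail_def by (intro ext nn_integral_cong) (auto split: split_indicator)
  also have "\<dots> \<in> borel_measurable borel"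
    by (rule lborel.borel_measurable_nn_integral) simp
  finally show ?thesis .
qed

text \<open>A shift \<rho> > 0 is counted once for every v in (0, \<rho>), so Tonelli gives it the
  weight \<rho>; the factor 2 comes from the evenness of the kernel.\<close>

lemma nn_integral_kernel_tail:
  "2 * (\<integral>\<^sup>+v. kernel_tail v * indicator {0<..} v \<partial>lborel) = (\<integral>\<^sup>+z. ennreal \<bar>z\<bar> * ennreal (kernel_hat i \<alpha> \<tau> z) \<partial>lborel)"
proof -
  let ?k = "\<lambda>z. ennreal (kernel_hat i \<alpha> \<tau> z)"
  have [measurable]: "Measurable.pred (lborel \<Otimes>\<^sub>M lborel) (\<lambda>x::real\<times>real. 0 < fst x \<and> fst x < snd x)" by measurable
  have "(\<integral>\<^sup>+v. kernel_tail v * indicator {0<..} v \<partial>lborel)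
      = (\<integral>\<^sup>+v. \<integral>\<^sup>+\<rho>. ?k \<rho> * indicator {x. 0 < fst x \<and> fst x < snd x} (v, \<rho>) \<partial>lborel \<partial>lborel)"
    unfolding kernel_tail_def
    by (intro nn_integral_cong, subst nn_integral_multc[symmetric], simp)
       (intro nn_integral_cong, auto split: split_indicator)
  also have "\<dots> = (\<integral>\<^sup>+\<rho>. \<integral>\<^sup>+v. ?k \<rho> * indicator {x. 0 < fst x \<and> fst x < snd x} (v, \<rho>) \<partial>lborel \<partial>lborel)"
    by (rule lborel_pair.Fubini') simp
  also have "\<dots> = (\<integral>\<^sup>+\<rho>. ennreal (max 0 \<rho>) * ?k \<rho> \<partial>lborel)"
  proof (rule nn_integral_cong)
    fix \<rho> :: real
    have "(\<integral>\<^sup>+v. ?k \<rho> * indicator {x. 0 < fst x \<and> fst x < snd x} (v, \<rho>) \<partial>lborel) = (\<integral>\<^sup>+v. ?k \<rho> * indicator {0<..<\<rho>} v \<partial>lborel)"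
      by (intro nn_integral_cong) (auto split: split_indicator)
    also have "\<dots> = ?k \<rho> * emeasure lborel {0<..<\<rho>}" by (simp add: nn_integral_cmult)
    also have "emeasure lborel {0<..<\<rho>} = ennreal (max 0 \<rho>)" by (cases "0 \<le> \<rho>") auto
    finally show "(\<integral>\<^sup>+v. ?k \<rho> * indicator {x. 0 < fst x \<and> fst x < snd x} (v, \<rho>) \<partial>lborel) = ennreal (max 0 \<rho>) * ?k \<rho>"
      by (simp add: mult.commute)
  qed
  finally have e: "(\<integral>\<^sup>+v. kernel_tail v * indicator {0<..} v \<partial>lborel) = (\<integral>\<^sup>+\<rho>. ennreal (max 0 \<rho>) * ?k \<rho> \<partial>lborel)" .
  have "(\<integral>\<^sup>+z. ennreal \<bar>z\<bar> * ?k z \<partial>lborel) = (\<integral>\<^sup>+z. ennreal (max 0 z) * ?k z + ennreal (max 0 (0 - z)) * ?k (0 - z) \<partial>lborel)"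
    by (intro nn_integral_cong) (auto simp: kernel_hat_minus max_def)
  also have "\<dots> = (\<integral>\<^sup>+z. ennreal (max 0 z) * ?k z \<partial>lborel) + (\<integral>\<^sup>+z. ennreal (max 0 (0 - z)) * ?k (0 - z) \<partial>lborel)"
    by (rule nn_integral_add) auto
  also have "(\<integral>\<^sup>+z. ennreal (max 0 (0 - z)) * ?k (0 - z) \<partial>lborel) = (\<integral>\<^sup>+z. ennreal (max 0 z) * ?k z \<partial>lborel)"
    by (rule nn_integral_reflect) simp
  finally show ?thesis unfolding e by (simp add: mult_2)
qed

text \<open>For fixed z the admissible u fill an interval of length 2 |z|, which leads to the first
  moment. In \<open>v_term_ge\<close> this controls the pairs for which the shift by z carries u
  across a boundary point q.\<close>

lemma nn_integral_strip_finite: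
  "(\<integral>\<^sup>+u. \<integral>\<^sup>+z. ennreal (kernel_hat i \<alpha> \<tau> z) * indicator {z. \<bar>u - q\<bar> \<le> \<bar>z\<bar>} z \<partial>lborel \<partial>lborel) < \<infinity>"
proof -
  let ?k = "\<lambda>z. ennreal (kernel_hat i \<alpha> \<tau> z)"
  have "(\<integral>\<^sup>+u. \<integral>\<^sup>+z. ?k z * indicator {z. \<bar>u - q\<bar> \<le> \<bar>z\<bar>} z \<partial>lborel \<partial>lborel)
    = (\<integral>\<^sup>+u. \<integral>\<^sup>+z. ?k z * indicator {x. \<bar>fst x - q\<bar> \<le> \<bar>snd x\<bar>} (u, z) \<partial>lborel \<partial>lborel)"
    by (intro nn_integral_cong) (auto split: split_indicator)
  also have "\<dots> = (\<integral>\<^sup>+z. \<integral>\<^sup>+u. ?k z * indicator {x. \<bar>fst x - q\<bar> \<le> \<bar>snd x\<bar>} (u, z) \<partial>lborel \<partial>lborel)"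
    by (rule lborel_pair.Fubini') simp
  also have "\<dots> = (\<integral>\<^sup>+z. 2 * (ennreal \<bar>z\<bar> * ?k z) \<partial>lborel)"
  proof (rule nn_integral_cong)
    fix z :: real
    have "(\<integral>\<^sup>+u. ?k z * indicator {x. \<bar>fst x - q\<bar> \<le> \<bar>snd x\<bar>} (u, z) \<partial>lborel) = (\<integral>\<^sup>+u. ?k z * indicator {q - \<bar>z\<bar>..q + \<bar>z\<bar>} u \<partial>lborel)"
      by (intro nn_integral_cong) (auto split: split_indicator)
    also have "\<dots> = ?k z * ennreal (2 * \<bar>z\<bar>)" by (simp add: nn_integral_cmult)
    finally show "(\<integral>\<^sup>+u. ?k z * indicator {x. \<bar>fst x - q\<bar> \<le> \<bar>snd x\<bar>} (u, z) \<partial>lborel) = 2 * (ennreal \<bar>z\<bar> * ?k z)"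
      by (simp add: ennreal_mult mult_ac)
  qed
  also have "\<dots> = 2 * (\<integral>\<^sup>+z. ennreal \<bar>z\<bar> * ?k z \<partial>lborel)" by (rule nn_integral_cmult) simp
  also have "\<dots> < \<infinity>" using nn_integral_kernel_hat_finite(2) by (simp add: ennreal_mult_less_top)
  finally show ?thesis .
qed

end

section \<open>Bounds for the one-dimensional interaction\<close>

lemma AE_translate:
  fixes P :: "'a::euclidean_space \<Rightarrow> bool"
  assumes "AE x in lborel. P x"
  shows "AE x in lborel. P (t + x)"
proof -
  have "AE x in distr lborel borel ((+) t). P x" using assms by (simp only: lborel_distr_plus)
  from AE_distrD[OF _ this] show ?thesis by simp
qed

text \<open>If the Bochner integral does not exist, its value is 0 and the bound is trivial.\<close>

lemma set_LINT_lebesgue_le: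
  fixes f :: "'a::euclidean_space \<Rightarrow> real"
  assumes f: "\<And>u. 0 \<le> f u" and le: "AE u in lborel. u \<in> A \<longrightarrow> ennreal (f u) \<le> G u"
  shows "ennreal (LINT u:A|lebesgue. f u) \<le> (\<integral>\<^sup>+u. G u * indicator A u \<partial>lborel)"
proof (cases "integrable lebesgue (\<lambda>u. indicat_real A u *\<^sub>R f u)")
  case True
  have "ennreal (LINT u:A|lebesgue. f u) = (\<integral>\<^sup>+u. ennreal (indicat_real A u *\<^sub>R f u) \<partial>lebesgue)"
    unfolding set_lebesgue_integral_def
    by (rule nn_integral_eq_integral[OF True, symmetric]) (use f in auto)
  also have "\<dots> = (\<integral>\<^sup>+u. ennreal (indicat_real A u *\<^sub>R f u) \<partial>lborel)" by (rule nn_integral_completion)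
  also have "\<dots> \<le> (\<integral>\<^sup>+u. G u * indicator A u \<partial>lborel)"
    by (rule nn_integral_mono_AE) (use le in eventually_elim, auto split: split_indicator)
  finally show ?thesis .
qed (simp add: set_lebesgue_integral_def not_integrable_integral_eq)

text \<open>Finiteness excludes the default value 0. On A the function f agrees almost everywhere
  with the Borel function G, from which it inherits measurability.\<close>

lemma set_LINT_lebesgue_eq:
  fixes f :: "'a::euclidean_space \<Rightarrow> real"
  assumes f: "\<And>u. 0 \<le> f u" and eq: "AE u in lborel. u \<in> A \<longrightarrow> ennreal (f u) = G u"
    and [measurable]: "G \<in> borel_measurable borel" "A \<in> sets borel"
    and fin: "(\<integral>\<^sup>+u. G u * indicator A u \<partial>lborel) < \<infinity>"
  shows "ennreal (LINT u:A|lebesgue. f u) = (\<integral>\<^sup>+u. G u * indicator A u \<partial>lborel)"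
proof -
  define h where "h u = enn2real (G u * indicator A u)" for u
  have h: "AE u in lborel. h u = indicat_real A u *\<^sub>R f u"
    using eq
  proof eventually_elim
    fix u assume "u \<in> A \<longrightarrow> ennreal (f u) = G u"
    then show "h u = indicat_real A u *\<^sub>R f u"
      by (cases "u \<in> A") (auto simp: h_def f enn2real_ennreal dest: sym)
  qed
  have [measurable]: "h \<in> borel_measurable borel" unfolding h_def by measurable
  have hl: "h \<in> borel_measurable lebesgue" by (rule measurable_completion) simp
  have fl: "(\<lambda>u. indicat_real A u *\<^sub>R f u) \<in> borel_measurable lebesgue"
    by (rule borel_measurable_AE[OF hl AE_completion[OF h]])
  have "(\<integral>\<^sup>+u. ennreal (indicat_real A u *\<^sub>R f u) \<partial>lebesgue) = (\<integral>\<^sup>+u. G u * indicator A u \<partial>lborel)"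
    unfolding nn_integral_completion
    by (rule nn_integral_cong_AE) (use eq in eventually_elim, auto split: split_indicator)
  moreover have "(LINT u:A|lebesgue. f u) = enn2real (\<integral>\<^sup>+u. ennreal (indicat_real A u *\<^sub>R f u) \<partial>lebesgue)"
    unfolding set_lebesgue_integral_def using fl f by (intro integral_eq_nn_integral) auto
  ultimately show ?thesis using fin by simp
qed

lemma next_bd_ge: "ereal s \<le> next_bd S s"
  unfolding next_bd_def by (rule INF_greatest) auto

lemma prev_bd_le: "prev_bd S s \<le> ereal s"
  unfolding prev_bd_def by (rule SUP_least) auto

lemma connected_einterval: "connected (einterval a b)"
  unfolding is_interval_connected_1[symmetric] is_interval_1
proof (intro ballI allI impI)
  fix x y z assume "x \<in> einterval a b" "y \<in> einterval a b" "x \<le> z \<and> z \<le> y"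
  then have "a < ereal x" "ereal x \<le> ereal z" "ereal z \<le> ereal y" "ereal y < b"
    by (auto simp: einterval_iff)
  then show "z \<in> einterval a b" unfolding einterval_iff by (meson order_le_less_trans order_less_le_trans)
qed

lemma neighbours_AE_const:
  assumes "locally_finite_perimeter S"
  shows "\<exists>c. AE x in lborel. x \<in> einterval (prev_bd S s) (ereal s) \<longrightarrow> (x \<in> S) = c"
    "\<exists>c. AE x in lborel. x \<in> einterval (ereal s) (next_bd S s) \<longrightarrow> (x \<in> S) = c"
proof -
  have "x \<notin> reduced_boundary S" if "x \<in> einterval (prev_bd S s) (ereal s)" for x
  proof
    assume "x \<in> reduced_boundary S"
    then have "ereal x \<le> prev_bd S s"
      using that unfolding prev_bd_def by (intro SUP_upper) (auto simp: einterval_iff)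
    then show False using that by (auto simp: einterval_iff)
  qed
  then show "\<exists>c. AE x in lborel. x \<in> einterval (prev_bd S s) (ereal s) \<longrightarrow> (x \<in> S) = c"
    by (intro no_reduced_boundary_AE_const assms connected_einterval) auto
  have "x \<notin> reduced_boundary S" if "x \<in> einterval (ereal s) (next_bd S s)" for x
  proof
    assume "x \<in> reduced_boundary S"
    then have "next_bd S s \<le> ereal x"
      using that unfolding next_bd_def by (intro INF_lower) (auto simp: einterval_iff)
    then show False using that by (auto simp: einterval_iff)
  qed
  then show "\<exists>c. AE x in lborel. x \<in> einterval (ereal s) (next_bd S s) \<longrightarrow> (x \<in> S) = c"
    by (intro no_reduced_boundary_AE_const assms connected_einterval) auto
qed

context
  fixes i :: "'n::finite" and \<alpha> \<tau> :: real
  assumes at: "\<alpha> < 1" "\<tau> > 0"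
begin

text \<open>In the notation of the overview, J(\<delta>) is \<open>tail_mass {0<..<\<delta>}\<close>
  and J(\<infinity>) is \<open>tail_mass {0<..}\<close>. The set D stands for the distances from s
  to the points of a gap.\<close>

definition tail_mass :: "real set \<Rightarrow> ennreal" where
  "tail_mass D = (\<integral>\<^sup>+v. kernel_tail i \<alpha> \<tau> v * indicator D v \<partial>lborel)"

lemma tail_mass_mono: "D \<subseteq> D' \<Longrightarrow> tail_mass D \<le> tail_mass D'"
  unfolding tail_mass_def by (intro nn_integral_mono) (auto split: split_indicator)

lemma tail_mass_moment: "2 * tail_mass {0<..} = (\<integral>\<^sup>+z. ennreal \<bar>z\<bar> * ennreal (kernel_hat i \<alpha> \<tau> z) \<partial>lborel)"
  unfolding tail_mass_def by (rule nn_integral_kernel_tail[OF at])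

lemma tail_mass_finite: "D \<subseteq> {0<..} \<Longrightarrow> tail_mass D < \<infinity>"
  using tail_mass_mono[of D "{0<..}"] tail_mass_moment nn_integral_kernel_hat_finite(2)[OF at, of i]
  by (metis ennreal_mult_less_top infinity_ennreal_def order_le_less_trans top.not_eq_extremum
      mult_eq_0_iff zero_neq_numeral ennreal_mult_eq_top_iff)

lemma moment_eq: "(LINT z|lebesgue. \<bar>z\<bar> * kernel_hat i \<alpha> \<tau> z) = 2 * enn2real (tail_mass {0<..})"
proof -
  note [measurable] = measurable_kernel_hat[OF at]
  have "(LINT z|lebesgue. \<bar>z\<bar> * kernel_hat i \<alpha> \<tau> z) = (LINT z|lborel. \<bar>z\<bar> * kernel_hat i \<alpha> \<tau> z)"
    by (rule integral_completion) simp
  also have "\<dots> = enn2real (\<integral>\<^sup>+z. ennreal (\<bar>z\<bar> * kernel_hat i \<alpha> \<tau> z) \<partial>lborel)"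
    by (rule integral_eq_nn_integral) (auto simp: kernel_hat_nonneg[OF at])
  also have "\<dots> = enn2real (2 * tail_mass {0<..})"
    unfolding tail_mass_moment by (simp add: ennreal_mult kernel_hat_nonneg[OF at])
  finally show ?thesis by (simp add: enn2real_mult)
qed

text \<open>A positive shift can leave the left gap only through s. Hence a point at distance v = s
  - u from s sees a change of value only for shifts beyond v, up to null sets.\<close>

lemma left_interaction_le:
  assumes a: "a \<le> ereal s" and S: "AE x in lborel. x \<in> einterval a (ereal s) \<longrightarrow> (x \<in> S) = c"
  shows "ennreal (LINT u=a..ereal s|lebesgue. (LINT \<rho>=0..\<infinity>|lebesgue.
            (\<bar>indicat_real S (u + \<rho>) - indicat_real S u\<bar> * kernel_hat i \<alpha> \<tau> \<rho>)))
     \<le> tail_mass {v. 0 < v \<and> a < ereal (s - v)}" (is "ennreal ?L \<le> _")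
proof -
  note [measurable] = measurable_kernel_hat[OF at] measurable_kernel_tail[OF at]
  let ?D = "{v. 0 < v \<and> a < ereal (s - v)}"
  have "?L = (LINT u:einterval a (ereal s)|lebesgue. (LINT \<rho>:einterval 0 \<infinity>|lebesgue.
      (\<bar>indicat_real S (u + \<rho>) - indicat_real S u\<bar> * kernel_hat i \<alpha> \<tau> \<rho>)))"
    using a by (simp add: interval_lebesgue_integral_def)
  also have "ennreal \<dots> \<le> (\<integral>\<^sup>+u. kernel_tail i \<alpha> \<tau> (s - u) * indicator (einterval a (ereal s)) u \<partial>lborel)"
  proof (rule set_LINT_lebesgue_le)
    show "0 \<le> (LINT \<rho>:einterval 0 \<infinity>|lebesgue.
      (\<bar>indicat_real S (u + \<rho>) - indicat_real S u\<bar> * kernel_hat i \<alpha> \<tau> \<rho>))" for u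
      unfolding set_lebesgue_integral_def by (intro integral_nonneg_AE AE_I2) (auto simp: kernel_hat_nonneg[OF at])
    show "AE u in lborel. u \<in> einterval a (ereal s) \<longrightarrow> ennreal (LINT \<rho>:einterval 0 \<infinity>|lebesgue.
      (\<bar>indicat_real S (u + \<rho>) - indicat_real S u\<bar> * kernel_hat i \<alpha> \<tau> \<rho>)) \<le> kernel_tail i \<alpha> \<tau> (s - u)"
      using S
    proof eventually_elim
      fix u assume u: "u \<in> einterval a (ereal s) \<longrightarrow> (u \<in> S) = c"
      show "u \<in> einterval a (ereal s) \<longrightarrow> ennreal (LINT \<rho>:einterval 0 \<infinity>|lebesgue.
        (\<bar>indicat_real S (u + \<rho>) - indicat_real S u\<bar> * kernel_hat i \<alpha> \<tau> \<rho>)) \<le> kernel_tail i \<alpha> \<tau> (s - u)"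
      proof
        assume uI: "u \<in> einterval a (ereal s)"
        have "ennreal (LINT \<rho>:einterval 0 \<infinity>|lebesgue.
          (\<bar>indicat_real S (u + \<rho>) - indicat_real S u\<bar> * kernel_hat i \<alpha> \<tau> \<rho>))
          \<le> (\<integral>\<^sup>+\<rho>. (ennreal (kernel_hat i \<alpha> \<tau> \<rho>) * indicator {s - u<..} \<rho>) * indicator (einterval 0 \<infinity>) \<rho> \<partial>lborel)"
        proof (rule set_LINT_lebesgue_le)
          show "0 \<le> \<bar>indicat_real S (u + \<rho>) - indicat_real S u\<bar> * kernel_hat i \<alpha> \<tau> \<rho>" for \<rho>
            by (simp add: kernel_hat_nonneg[OF at])
          show "AE \<rho> in lborel. \<rho> \<in> einterval 0 \<infinity> \<longrightarrow>
            ennreal (\<bar>indicat_real S (u + \<rho>) - indicat_real S u\<bar> * kernel_hat i \<alpha> \<tau> \<rho>)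
              \<le> ennreal (kernel_hat i \<alpha> \<tau> \<rho>) * indicator {s - u<..} \<rho>"
            using AE_translate[OF S, of u] AE_lborel_singleton[of "s - u"]
          proof eventually_elim
            fix \<rho> assume \<rho>: "u + \<rho> \<in> einterval a (ereal s) \<longrightarrow> (u + \<rho> \<in> S) = c" "\<rho> \<noteq> s - u"
            show "\<rho> \<in> einterval 0 \<infinity> \<longrightarrow>
              ennreal (\<bar>indicat_real S (u + \<rho>) - indicat_real S u\<bar> * kernel_hat i \<alpha> \<tau> \<rho>)
              \<le> ennreal (kernel_hat i \<alpha> \<tau> \<rho>) * indicator {s - u<..} \<rho>"
            proof
              assume \<rho>I: "\<rho> \<in> einterval 0 \<infinity>"
              show "ennreal (\<bar>indicat_real S (u + \<rho>) - indicat_real S u\<bar> * kernel_hat i \<alpha> \<tau> \<rho>)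
                \<le> ennreal (kernel_hat i \<alpha> \<tau> \<rho>) * indicator {s - u<..} \<rho>"
              proof (cases "\<rho> > s - u")
              case False
              with \<rho>I have "0 < \<rho>" "\<rho> < s - u" using False \<rho>(2) by (auto simp: einterval_iff)
              moreover have "a < ereal u" using uI by (simp add: einterval_iff)
              ultimately have "a < ereal (u + \<rho>)" "u + \<rho> < s"
                by (auto intro: less_trans)
              then have "u + \<rho> \<in> einterval a (ereal s)" by (simp add: einterval_iff)
              with \<rho>(1) u uI have "(u + \<rho> \<in> S) = (u \<in> S)" by blast
              then show ?thesis by (auto split: split_indicator)
              qed (auto simp: kernel_hat_nonneg[OF at] split: split_indicator)
            qed
          qed
        qed
        also have "\<dots> \<le> kernel_tail i \<alpha> \<tau> (s - u)"
          unfolding kernel_tail_def[OF at] by (intro nn_integral_mono) (auto split: split_indicator)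
        finally show "ennreal (LINT \<rho>:einterval 0 \<infinity>|lebesgue.
          (\<bar>indicat_real S (u + \<rho>) - indicat_real S u\<bar> * kernel_hat i \<alpha> \<tau> \<rho>)) \<le> kernel_tail i \<alpha> \<tau> (s - u)" .
      qed
    qed
  qed
  also have "\<dots> = (\<integral>\<^sup>+u. (\<lambda>v. kernel_tail i \<alpha> \<tau> v * indicator ?D v) (s - u) \<partial>lborel)"
    by (intro nn_integral_cong) (auto simp: einterval_iff split: split_indicator)
  also have "\<dots> = tail_mass ?D"
    unfolding tail_mass_def by (rule nn_integral_reflect) measurable
  finally show ?thesis .
qed

lemma kernel_tail_reflect:
  "(\<integral>\<^sup>+\<rho>. ennreal (kernel_hat i \<alpha> \<tau> \<rho>) * indicator {..<- v} \<rho> \<partial>lborel) = kernel_tail i \<alpha> \<tau> v"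
proof -
  note [measurable] = measurable_kernel_hat[OF at]
  have "kernel_tail i \<alpha> \<tau> v = (\<integral>\<^sup>+\<rho>. ennreal (kernel_hat i \<alpha> \<tau> (0 - \<rho>)) * indicator {v<..} (0 - \<rho>) \<partial>lborel)"
    unfolding kernel_tail_def[OF at] by (rule nn_integral_reflect[symmetric]) measurable
  also have "\<dots> = (\<integral>\<^sup>+\<rho>. ennreal (kernel_hat i \<alpha> \<tau> \<rho>) * indicator {..<- v} \<rho> \<partial>lborel)"
    by (intro nn_integral_cong) (auto simp: kernel_hat_minus[OF at] split: split_indicator)
  finally show ?thesis by simp
qed

text \<open>Mirror image of \<open>left_interaction_le\<close>: a negative shift leaves the right
  gap only through s, and the kernel is even.\<close>

lemma right_interaction_le:
  assumes b: "ereal s \<le> b" and S: "AE x in lborel. x \<in> einterval (ereal s) b \<longrightarrow> (x \<in> S) = c"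
  shows "ennreal (LINT u=ereal s..b|lebesgue. (LINT \<rho>=-\<infinity>..0|lebesgue.
            (\<bar>indicat_real S (u + \<rho>) - indicat_real S u\<bar> * kernel_hat i \<alpha> \<tau> \<rho>)))
     \<le> tail_mass {v. 0 < v \<and> ereal (s + v) < b}" (is "ennreal ?L \<le> _")
proof -
  note [measurable] = measurable_kernel_hat[OF at] measurable_kernel_tail[OF at]
  let ?D = "{v. 0 < v \<and> ereal (s + v) < b}"
  have "?L = (LINT u:einterval (ereal s) b|lebesgue. (LINT \<rho>:einterval (-\<infinity>) 0|lebesgue.
      (\<bar>indicat_real S (u + \<rho>) - indicat_real S u\<bar> * kernel_hat i \<alpha> \<tau> \<rho>)))"
    using b by (simp add: interval_lebesgue_integral_def)
  also have "ennreal \<dots> \<le> (\<integral>\<^sup>+u. kernel_tail i \<alpha> \<tau> (u - s) * indicator (einterval (ereal s) b) u \<partial>lborel)"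
  proof (rule set_LINT_lebesgue_le)
    show "0 \<le> (LINT \<rho>:einterval (-\<infinity>) 0|lebesgue.
      (\<bar>indicat_real S (u + \<rho>) - indicat_real S u\<bar> * kernel_hat i \<alpha> \<tau> \<rho>))" for u
      unfolding set_lebesgue_integral_def by (intro integral_nonneg_AE AE_I2) (auto simp: kernel_hat_nonneg[OF at])
    show "AE u in lborel. u \<in> einterval (ereal s) b \<longrightarrow> ennreal (LINT \<rho>:einterval (-\<infinity>) 0|lebesgue.
      (\<bar>indicat_real S (u + \<rho>) - indicat_real S u\<bar> * kernel_hat i \<alpha> \<tau> \<rho>)) \<le> kernel_tail i \<alpha> \<tau> (u - s)"
      using S
    proof eventually_elim
      fix u assume u: "u \<in> einterval (ereal s) b \<longrightarrow> (u \<in> S) = c"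
      show "u \<in> einterval (ereal s) b \<longrightarrow> ennreal (LINT \<rho>:einterval (-\<infinity>) 0|lebesgue.
        (\<bar>indicat_real S (u + \<rho>) - indicat_real S u\<bar> * kernel_hat i \<alpha> \<tau> \<rho>)) \<le> kernel_tail i \<alpha> \<tau> (u - s)"
      proof
        assume uI: "u \<in> einterval (ereal s) b"
        have "ennreal (LINT \<rho>:einterval (-\<infinity>) 0|lebesgue.
          (\<bar>indicat_real S (u + \<rho>) - indicat_real S u\<bar> * kernel_hat i \<alpha> \<tau> \<rho>))
          \<le> (\<integral>\<^sup>+\<rho>. (ennreal (kernel_hat i \<alpha> \<tau> \<rho>) * indicator {..<- (u - s)} \<rho>) * indicator (einterval (-\<infinity>) 0) \<rho> \<partial>lborel)"
        proof (rule set_LINT_lebesgue_le)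
          show "0 \<le> \<bar>indicat_real S (u + \<rho>) - indicat_real S u\<bar> * kernel_hat i \<alpha> \<tau> \<rho>" for \<rho>
            by (simp add: kernel_hat_nonneg[OF at])
          show "AE \<rho> in lborel. \<rho> \<in> einterval (-\<infinity>) 0 \<longrightarrow>
            ennreal (\<bar>indicat_real S (u + \<rho>) - indicat_real S u\<bar> * kernel_hat i \<alpha> \<tau> \<rho>)
              \<le> ennreal (kernel_hat i \<alpha> \<tau> \<rho>) * indicator {..<- (u - s)} \<rho>"
            using AE_translate[OF S, of u] AE_lborel_singleton[of "s - u"]
          proof eventually_elim
            fix \<rho> assume \<rho>: "u + \<rho> \<in> einterval (ereal s) b \<longrightarrow> (u + \<rho> \<in> S) = c" "\<rho> \<noteq> s - u"
            show "\<rho> \<in> einterval (-\<infinity>) 0 \<longrightarrow>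
              ennreal (\<bar>indicat_real S (u + \<rho>) - indicat_real S u\<bar> * kernel_hat i \<alpha> \<tau> \<rho>)
              \<le> ennreal (kernel_hat i \<alpha> \<tau> \<rho>) * indicator {..<- (u - s)} \<rho>"
            proof
              assume \<rho>I: "\<rho> \<in> einterval (-\<infinity>) 0"
              show "ennreal (\<bar>indicat_real S (u + \<rho>) - indicat_real S u\<bar> * kernel_hat i \<alpha> \<tau> \<rho>)
                \<le> ennreal (kernel_hat i \<alpha> \<tau> \<rho>) * indicator {..<- (u - s)} \<rho>"
              proof (cases "\<rho> < - (u - s)")
              case False
              with \<rho>I have r: "\<rho> < 0" "s - u < \<rho>" using False \<rho>(2) by (auto simp: einterval_iff zero_ereal_def)
              have "ereal (u + \<rho>) < ereal u" using r by simp
              also have "ereal u < b" using uI by (simp add: einterval_iff)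
              finally have "u + \<rho> \<in> einterval (ereal s) b" using r by (simp add: einterval_iff)
              with \<rho>(1) u uI have "(u + \<rho> \<in> S) = (u \<in> S)" by blast
              then show ?thesis by (auto split: split_indicator)
              qed (auto simp: kernel_hat_nonneg[OF at] split: split_indicator)
            qed
          qed
        qed
        also have "\<dots> \<le> (\<integral>\<^sup>+\<rho>. ennreal (kernel_hat i \<alpha> \<tau> \<rho>) * indicator {..<- (u - s)} \<rho> \<partial>lborel)"
          by (intro nn_integral_mono) (auto split: split_indicator)
        also have "\<dots> = kernel_tail i \<alpha> \<tau> (u - s)" by (rule kernel_tail_reflect)
        finally show "ennreal (LINT \<rho>:einterval (-\<infinity>) 0|lebesgue.
          (\<bar>indicat_real S (u + \<rho>) - indicat_real S u\<bar> * kernel_hat i \<alpha> \<tau> \<rho>)) \<le> kernel_tail i \<alpha> \<tau> (u - s)" .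
      qed
    qed
  qed
  also have "\<dots> = (\<integral>\<^sup>+u. (\<lambda>v. kernel_tail i \<alpha> \<tau> v * indicator ?D v) (-s + 1 * u) \<partial>lborel)"
    by (intro nn_integral_cong) (auto simp: einterval_iff split: split_indicator)
  also have "\<dots> = tail_mass ?D"
    unfolding tail_mass_def
    by (subst nn_integral_real_affine[where c=1 and t="-s"]) (auto)
  finally show ?thesis .
qed

lemma r_term_ge:
  fixes E :: "(real ^ 'n) set" and t :: "real ^ 'n" and s :: real
  defines "S \<equiv> slice i E t"
  assumes S: "locally_finite_perimeter S"
  shows "- 1 + 2 * enn2real (tail_mass {0<..}) - enn2real (tail_mass {v. 0 < v \<and> prev_bd S s < ereal (s - v)})
    - enn2real (tail_mass {v. 0 < v \<and> ereal (s + v) < next_bd S s}) \<le> r_term i \<alpha> \<tau> E t s"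
proof -
  have le: "x \<le> enn2real y" if "ennreal x \<le> y" "y < \<infinity>" for x y
    using enn2real_mono[OF that(1)] that(2) by (cases "0 \<le> x") (auto intro: order_trans[OF _ enn2real_nonneg])
  obtain c1 where c1: "AE x in lborel. x \<in> einterval (prev_bd S s) (ereal s) \<longrightarrow> (x \<in> S) = c1"
    using neighbours_AE_const(1)[OF S, of s] by blast
  obtain c2 where c2: "AE x in lborel. x \<in> einterval (ereal s) (next_bd S s) \<longrightarrow> (x \<in> S) = c2"
    using neighbours_AE_const(2)[OF S, of s] by blast
  have sub: "{v. 0 < v \<and> prev_bd S s < ereal (s - v)} \<subseteq> {0<..}"
    "{v. 0 < v \<and> ereal (s + v) < next_bd S s} \<subseteq> {0<..}" by auto
  show ?thesis
    unfolding r_term_def Let_def S_def[symmetric] moment_eq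
    using le[OF left_interaction_le[OF prev_bd_le c1] tail_mass_finite[OF sub(1)]]
      le[OF right_interaction_le[OF next_bd_ge c2] tail_mass_finite[OF sub(2)]]
    by linarith
qed

end

section \<open>Consequences of property (P) for the tails\<close>

context
  fixes i :: "'n::finite" and \<alpha> \<tau> :: real
  assumes at: "\<alpha> < 1" "\<tau> > 0"
begin

text \<open>Exploiting (P) takes lower bounds for the interactions of the test slices, hence their
  exact values. The inner integral is at most the total mass of \<open>kernel_hat\<close>, so a gap
  of finite length makes everything finite.\<close>

lemma interaction_eq:
  assumes [measurable]: "S \<in> sets borel" "I \<in> sets borel" "K \<in> sets borel" and fin: "emeasure lborel I < \<infinity>"
  shows "ennreal (LINT u:I|lebesgue. (LINT \<rho>:K|lebesgue. (\<bar>indicat_real S (u + \<rho>) - indicat_real S u\<bar> * kernel_hat i \<alpha> \<tau> \<rho>)))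
    = (\<integral>\<^sup>+u. (\<integral>\<^sup>+\<rho>. ennreal (\<bar>indicat_real S (u + \<rho>) - indicat_real S u\<bar> * kernel_hat i \<alpha> \<tau> \<rho>) * indicator K \<rho> \<partial>lborel) * indicator I u \<partial>lborel)"
proof -
  note [measurable] = measurable_kernel_hat[OF at]
  let ?f = "\<lambda>u \<rho>. \<bar>indicat_real S (u + \<rho>) - indicat_real S u\<bar> * kernel_hat i \<alpha> \<tau> \<rho>"
  have nonneg: "0 \<le> ?f u \<rho>" for u \<rho> by (simp add: kernel_hat_nonneg[OF at])
  let ?C = "\<integral>\<^sup>+\<rho>. ennreal (kernel_hat i \<alpha> \<tau> \<rho>) \<partial>lborel"
  have le: "(\<integral>\<^sup>+\<rho>. ennreal (?f u \<rho>) * indicator K \<rho> \<partial>lborel) \<le> ?C" for u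
  proof (rule nn_integral_mono)
    fix \<rho>
    have "?f u \<rho> \<le> 1 * kernel_hat i \<alpha> \<tau> \<rho>"
      by (rule mult_right_mono) (auto simp: kernel_hat_nonneg[OF at] split: split_indicator)
    then show "ennreal (?f u \<rho>) * indicator K \<rho> \<le> ennreal (kernel_hat i \<alpha> \<tau> \<rho>)"
      by (auto intro: ennreal_leI split: split_indicator)
  qed
  have C: "?C < \<infinity>" by (rule nn_integral_kernel_hat_finite(1)[OF at])
  show ?thesis
  proof (rule set_LINT_lebesgue_eq)
    show "0 \<le> (LINT \<rho>:K|lebesgue. ?f u \<rho>)" for u
      unfolding set_lebesgue_integral_def by (intro integral_nonneg_AE AE_I2) (use nonneg in auto)
    show "AE u in lborel. u \<in> I \<longrightarrow> ennreal (LINT \<rho>:K|lebesgue. ?f u \<rho>) = (\<integral>\<^sup>+\<rho>. ennreal (?f u \<rho>) * indicator K \<rho> \<partial>lborel)"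
    proof (intro AE_I2 impI)
      fix u
      show "ennreal (LINT \<rho>:K|lebesgue. ?f u \<rho>) = (\<integral>\<^sup>+\<rho>. ennreal (?f u \<rho>) * indicator K \<rho> \<partial>lborel)"
        by (rule set_LINT_lebesgue_eq) (use nonneg le[of u] C in \<open>auto intro: order_le_less_trans\<close>)
    qed
    show "(\<lambda>u. \<integral>\<^sup>+\<rho>. ennreal (?f u \<rho>) * indicator K \<rho> \<partial>lborel) \<in> borel_measurable borel"
      by (rule lborel.borel_measurable_nn_integral) simp
    have "(\<integral>\<^sup>+u. (\<integral>\<^sup>+\<rho>. ennreal (?f u \<rho>) * indicator K \<rho> \<partial>lborel) * indicator I u \<partial>lborel)
      \<le> (\<integral>\<^sup>+u. ?C * indicator I u \<partial>lborel)"
      by (intro nn_integral_mono mult_right_mono le) simp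
    also have "\<dots> = ?C * emeasure lborel I" by (simp add: nn_integral_cmult)
    also have "\<dots> < \<infinity>" using C fin by (simp add: ennreal_mult_less_top)
    finally show "(\<integral>\<^sup>+u. (\<integral>\<^sup>+\<rho>. ennreal (?f u \<rho>) * indicator K \<rho> \<partial>lborel) * indicator I u \<partial>lborel) < \<infinity>" .
  qed auto
qed

lemma tail_mass_pair:
  assumes [measurable]: "D \<in> sets borel"
  shows "tail_mass i \<alpha> \<tau> D = (\<integral>\<^sup>+\<omega>. ennreal (kernel_hat i \<alpha> \<tau> (snd \<omega>)) * indicator {\<omega>. fst \<omega> \<in> D \<and> fst \<omega> < snd \<omega>} \<omega> \<partial>(lborel \<Otimes>\<^sub>M lborel))"
proof -
  note [measurable] = measurable_kernel_hat[OF at]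
  have "tail_mass i \<alpha> \<tau> D = (\<integral>\<^sup>+v. \<integral>\<^sup>+\<rho>. ennreal (kernel_hat i \<alpha> \<tau> \<rho>) * indicator {\<omega>. fst \<omega> \<in> D \<and> fst \<omega> < snd \<omega>} (v, \<rho>) \<partial>lborel \<partial>lborel)"
    unfolding tail_mass_def[OF at] kernel_tail_def[OF at]
    by (intro nn_integral_cong, subst nn_integral_multc[symmetric], simp)
       (intro nn_integral_cong, auto split: split_indicator)
  also have "\<dots> = (\<integral>\<^sup>+\<omega>. ennreal (kernel_hat i \<alpha> \<tau> (snd \<omega>)) * indicator {\<omega>. fst \<omega> \<in> D \<and> fst \<omega> < snd \<omega>} \<omega> \<partial>(lborel \<Otimes>\<^sub>M lborel))"
    by (subst lborel.nn_integral_fst[symmetric]) auto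
  finally show ?thesis .
qed

text \<open>Dominated convergence on the pairs (v, \<rho>): the regions \<open>W n\<close> stay
  inside the region that defines the tail mass, and almost every pair of that region eventually
  belongs to them.\<close>

lemma tail_mass_limit:
  assumes [measurable]: "D \<in> sets borel" "\<And>n::nat. W n \<in> sets (borel \<Otimes>\<^sub>M borel)" and D: "D \<subseteq> {0<..}"
    and sub: "\<And>n v \<rho>. (v, \<rho>) \<in> W n \<Longrightarrow> v \<in> D \<and> v < \<rho>"
    and ev: "AE \<omega> in lborel \<Otimes>\<^sub>M lborel. fst \<omega> \<in> D \<and> fst \<omega> < snd \<omega> \<longrightarrow> (\<forall>\<^sub>F n in sequentially. \<omega> \<in> W n)"
  shows "(\<lambda>n. \<integral>\<^sup>+v. \<integral>\<^sup>+\<rho>. ennreal (kernel_hat i \<alpha> \<tau> \<rho>) * indicator (W n) (v, \<rho>) \<partial>lborel \<partial>lborel) \<longlonglongrightarrow> tail_mass i \<alpha> \<tau> D"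
proof -
  note [measurable] = measurable_kernel_hat[OF at]
  let ?w = "\<lambda>\<omega>. ennreal (kernel_hat i \<alpha> \<tau> (snd \<omega>)) * indicator {\<omega>. fst \<omega> \<in> D \<and> fst \<omega> < snd \<omega>} \<omega>"
  have "(\<lambda>n. \<integral>\<^sup>+\<omega>. ennreal (kernel_hat i \<alpha> \<tau> (snd \<omega>)) * indicator (W n) \<omega> \<partial>(lborel \<Otimes>\<^sub>M lborel))
    \<longlonglongrightarrow> (\<integral>\<^sup>+\<omega>. ?w \<omega> \<partial>(lborel \<Otimes>\<^sub>M lborel))"
  proof (rule nn_integral_dominated_convergence)
    show "AE \<omega> in lborel \<Otimes>\<^sub>M lborel. ennreal (kernel_hat i \<alpha> \<tau> (snd \<omega>)) * indicator (W n) \<omega> \<le> ?w \<omega>" for n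
      using sub by (intro AE_I2) (auto split: split_indicator)
    show "(\<integral>\<^sup>+\<omega>. ?w \<omega> \<partial>(lborel \<Otimes>\<^sub>M lborel)) < \<infinity>"
      using tail_mass_finite[OF at D, of i] tail_mass_pair[of D] by simp
    show "AE \<omega> in lborel \<Otimes>\<^sub>M lborel. (\<lambda>n. ennreal (kernel_hat i \<alpha> \<tau> (snd \<omega>)) * indicator (W n) \<omega>) \<longlonglongrightarrow> ?w \<omega>"
      using ev
    proof eventually_elim
      fix \<omega> assume e: "fst \<omega> \<in> D \<and> fst \<omega> < snd \<omega> \<longrightarrow> (\<forall>\<^sub>F n in sequentially. \<omega> \<in> W n)"
      show "(\<lambda>n. ennreal (kernel_hat i \<alpha> \<tau> (snd \<omega>)) * indicator (W n) \<omega>) \<longlonglongrightarrow> ?w \<omega>"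
      proof (cases "fst \<omega> \<in> D \<and> fst \<omega> < snd \<omega>")
        case True
        with e have "\<forall>\<^sub>F n in sequentially. \<omega> \<in> W n" by blast
        then have "\<forall>\<^sub>F n in sequentially. ennreal (kernel_hat i \<alpha> \<tau> (snd \<omega>)) * indicator (W n) \<omega> = ?w \<omega>"
          by eventually_elim (use True in auto)
        then show ?thesis by (rule tendsto_eventually)
      next
        case False
        then have "\<omega> \<notin> W n" for n using sub[of "fst \<omega>" "snd \<omega>" n] by auto
        then show ?thesis using False by simp
      qed
    qed
  qed measurable
  moreover have "(\<integral>\<^sup>+\<omega>. ennreal (kernel_hat i \<alpha> \<tau> (snd \<omega>)) * indicator (W n) \<omega> \<partial>(lborel \<Otimes>\<^sub>M lborel))
    = (\<integral>\<^sup>+v. \<integral>\<^sup>+\<rho>. ennreal (kernel_hat i \<alpha> \<tau> \<rho>) * indicator (W n) (v, \<rho>) \<partial>lborel \<partial>lborel)" for n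
    by (subst lborel.nn_integral_fst[symmetric]) auto
  ultimately show ?thesis using tail_mass_pair[of D] by simp
qed

text \<open>The first double integral collects the pairs (v, \<rho>) with -v in the left gap, inside
  the test slice, and -v + \<rho> in the right gap, outside it. In the second one v lies in the
  right gap and v - \<rho> in the slice. They bound the two interactions from below, and (P) bounds
  the sum of the interactions by M - 1.\<close>

lemma property_P_tail_mass_step:
  fixes N :: nat
  assumes P: "property_P TYPE('n) \<alpha>\<^sub>0 \<eta>\<^sub>0 \<tau>\<^sub>0" and "CARD('n) \<noteq> 1" and "0 \<le> \<alpha>" "\<alpha> < \<alpha>\<^sub>0" "\<tau> < \<tau>\<^sub>0" and \<delta>: "0 < \<delta>" "\<delta> < \<eta>\<^sub>0"
  shows "1 + (\<integral>\<^sup>+v. \<integral>\<^sup>+\<rho>. ennreal (kernel_hat i \<alpha> \<tau> \<rho>) *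
      indicator {\<omega>. 0 < fst \<omega> \<and> fst \<omega> < \<delta> \<and> fst \<omega> < snd \<omega> \<and> snd \<omega> < fst \<omega> + real (Suc N)} (v, \<rho>) \<partial>lborel \<partial>lborel)
    + (\<integral>\<^sup>+v. \<integral>\<^sup>+\<rho>. ennreal (kernel_hat i \<alpha> \<tau> \<rho>) *
      indicator {\<omega>. 0 < fst \<omega> \<and> fst \<omega> < real (Suc N) \<and> fst \<omega> < snd \<omega> \<and>
        (fst \<omega> - snd \<omega> < - \<delta> - 1 / real (Suc N) \<or> - \<delta> < fst \<omega> - snd \<omega>)} (v, \<rho>) \<partial>lborel \<partial>lborel)
    \<le> 2 * tail_mass i \<alpha> \<tau> {0<..}" (is "1 + ?X + ?Y \<le> _")
proof -
  note [measurable] = measurable_kernel_hat[OF at]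
  define S where "S = {..<- \<delta> - 1 / real (Suc N)} \<union> {-\<delta><..<0} \<union> {real (Suc N)<..}"
  have [measurable]: "S \<in> sets borel" unfolding S_def by simp
  have "- \<delta> - 1 / real (Suc N) < - \<delta>" "- \<delta> < 0" "0 < real (Suc N)" using \<delta> by auto
  note S = four_point_set[OF this, folded S_def] and ord = this
  obtain E :: "(real ^ 'n) set" where E: "locally_finite_perimeter E" "slice i E 0 = S"
    using locally_finite_perimeter_on_axis[OF \<open>CARD('n) \<noteq> 1\<close>] by blast
  have "r_term i \<alpha> \<tau> E 0 0 > 0"
  proof -
    have "min \<bar>0 - - \<delta>\<bar> \<bar>real (Suc N) - 0\<bar> < \<eta>\<^sub>0" using \<delta> by auto
    with E S have *: "locally_finite_perimeter E \<and> (0 :: real ^ 'n) $ i = 0 \<and> locally_finite_perimeter (slice i E 0) \<and>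
        {- \<delta>, 0, real (Suc N)} \<subseteq> reduced_boundary (slice i E 0) \<and> - \<delta> < 0 \<and> 0 < real (Suc N) \<and>
        reduced_boundary (slice i E 0) \<inter> {- \<delta><..<real (Suc N)} = {0} \<and>
        min \<bar>0 - - \<delta>\<bar> \<bar>real (Suc N) - 0\<bar> < \<eta>\<^sub>0"
      using ord by (simp only: zero_index simp_thms)
    have "0 \<le> \<alpha> \<and> \<alpha> < \<alpha>\<^sub>0 \<and> 0 < \<tau> \<and> \<tau> < \<tau>\<^sub>0" using at assms by simp
    from P[unfolded property_P_def, rule_format, OF this *] show ?thesis .
  qed
  moreover have prev: "prev_bd S 0 = ereal (- \<delta>)"
    unfolding prev_bd_def
  proof (rule antisym)
    show "(SUP t\<in>{t \<in> reduced_boundary S. t < 0}. ereal t) \<le> ereal (- \<delta>)"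
    proof (rule SUP_least)
      fix t assume t: "t \<in> {t \<in> reduced_boundary S. t < 0}"
      have "t \<notin> {- \<delta><..<real (Suc N)}"
      proof
        assume "t \<in> {- \<delta><..<real (Suc N)}"
        with t have "t \<in> reduced_boundary S \<inter> {- \<delta><..<real (Suc N)}" by blast
        then show False using t unfolding S(3) by simp
      qed
      then show "ereal t \<le> ereal (- \<delta>)" using t by auto
    qed
    show "ereal (- \<delta>) \<le> (SUP t\<in>{t \<in> reduced_boundary S. t < 0}. ereal t)"
      using S(2) \<delta> by (intro SUP_upper) auto
  qed
  moreover have "next_bd S 0 = ereal (real (Suc N))"
    unfolding next_bd_def
  proof (rule antisym)
    show "ereal (real (Suc N)) \<le> (INF t\<in>{t \<in> reduced_boundary S. 0 < t}. ereal t)"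
    proof (rule INF_greatest)
      fix t assume t: "t \<in> {t \<in> reduced_boundary S. 0 < t}"
      have "t \<notin> {- \<delta><..<real (Suc N)}"
      proof
        assume "t \<in> {- \<delta><..<real (Suc N)}"
        with t have "t \<in> reduced_boundary S \<inter> {- \<delta><..<real (Suc N)}" by blast
        then show False using t unfolding S(3) by simp
      qed
      then show "ereal (real (Suc N)) \<le> ereal t" using t \<delta> by auto
    qed
    show "(INF t\<in>{t \<in> reduced_boundary S. 0 < t}. ereal t) \<le> ereal (real (Suc N))"
      using S(2) by (intro INF_lower) auto
  qed
  moreover define A where "A = (LINT u:einterval (ereal (-\<delta>)) (ereal 0)|lebesgue. (LINT \<rho>:einterval 0 \<infinity>|lebesgue. (\<bar>indicat_real S (u + \<rho>) - indicat_real S u\<bar> * kernel_hat i \<alpha> \<tau> \<rho>)))"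
  moreover define B where "B = (LINT u:einterval (ereal 0) (ereal (real (Suc N)))|lebesgue. (LINT \<rho>:einterval (-\<infinity>) 0|lebesgue. (\<bar>indicat_real S (u + \<rho>) - indicat_real S u\<bar> * kernel_hat i \<alpha> \<tau> \<rho>)))"
  ultimately have AB: "0 < - 1 + 2 * enn2real (tail_mass i \<alpha> \<tau> {0<..}) - A - B"
    using \<delta> unfolding r_term_def Let_def E(2) moment_eq[OF at] interval_lebesgue_integral_def by simp
  have eA: "einterval (ereal (-\<delta>)) (ereal 0) = {-\<delta><..<0}" and eB: "einterval (ereal 0) (ereal (real (Suc N))) = {0<..<real (Suc N)}"
    and e1: "einterval 0 \<infinity> = {0<..}" and e2: "einterval (-\<infinity>) 0 = {..<0}"
    by (auto simp: einterval_iff zero_ereal_def)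
  have "?X \<le> ennreal A"
  proof -
    let ?g = "\<lambda>u. (\<integral>\<^sup>+\<rho>. ennreal (\<bar>indicat_real S (u + \<rho>) - indicat_real S u\<bar> * kernel_hat i \<alpha> \<tau> \<rho>) * indicator {0<..} \<rho> \<partial>lborel) * indicator {-\<delta><..<0} u"
    have [measurable]: "(\<lambda>u. \<integral>\<^sup>+\<rho>. ennreal (\<bar>indicat_real S (u + \<rho>) - indicat_real S u\<bar> * kernel_hat i \<alpha> \<tau> \<rho>) * indicator {0<..} \<rho> \<partial>lborel) \<in> borel_measurable borel"
      by (rule lborel.borel_measurable_nn_integral) simp
    \<comment> \<open>\<open>0 - v\<close> is the point of the left gap at distance v from 0;
      \<open>nn_integral_reflect\<close> then undoes the substitution.\<close>
    have "?X \<le> (\<integral>\<^sup>+v. ?g (0 - v) \<partial>lborel)"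
    proof (rule nn_integral_mono)
      fix v :: real
      show "(\<integral>\<^sup>+\<rho>. ennreal (kernel_hat i \<alpha> \<tau> \<rho>) *
        indicator {\<omega>. 0 < fst \<omega> \<and> fst \<omega> < \<delta> \<and> fst \<omega> < snd \<omega> \<and> snd \<omega> < fst \<omega> + real (Suc N)} (v, \<rho>) \<partial>lborel) \<le> ?g (0 - v)"
      proof (cases "0 < v \<and> v < \<delta>")
        case True
        have "(\<integral>\<^sup>+\<rho>. ennreal (kernel_hat i \<alpha> \<tau> \<rho>) *
            indicator {\<omega>. 0 < fst \<omega> \<and> fst \<omega> < \<delta> \<and> fst \<omega> < snd \<omega> \<and> snd \<omega> < fst \<omega> + real (Suc N)} (v, \<rho>) \<partial>lborel)
          \<le> (\<integral>\<^sup>+\<rho>. ennreal (\<bar>indicat_real S (0 - v + \<rho>) - indicat_real S (0 - v)\<bar> * kernel_hat i \<alpha> \<tau> \<rho>) * indicator {0<..} \<rho> \<partial>lborel)"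
        proof (rule nn_integral_mono)
          fix \<rho>
          have "0 - v \<in> S" using True by (simp add: S_def)
          moreover have "0 - v + \<rho> \<notin> S" if "v < \<rho>" "\<rho> < v + real (Suc N)"
          proof -
            have "- \<delta> - 1 / real (Suc N) < 0" using ord(1,2) by linarith
            then show ?thesis using that unfolding S_def by auto
          qed
          ultimately show "ennreal (kernel_hat i \<alpha> \<tau> \<rho>) *
            indicator {\<omega>. 0 < fst \<omega> \<and> fst \<omega> < \<delta> \<and> fst \<omega> < snd \<omega> \<and> snd \<omega> < fst \<omega> + real (Suc N)} (v, \<rho>)
            \<le> ennreal (\<bar>indicat_real S (0 - v + \<rho>) - indicat_real S (0 - v)\<bar> * kernel_hat i \<alpha> \<tau> \<rho>) * indicator {0<..} \<rho>"
            using True by (auto simp: indicator_def)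
        qed
        then show ?thesis using True by simp
      next
        case False
        then have "indicator {\<omega>. 0 < fst \<omega> \<and> fst \<omega> < \<delta> \<and> fst \<omega> < snd \<omega> \<and> snd \<omega> < fst \<omega> + real (Suc N)} (v, \<rho>) = (0::ennreal)" for \<rho>
          by auto
        then show ?thesis by simp
      qed
    qed
    also have "\<dots> = (\<integral>\<^sup>+v. ?g v \<partial>lborel)" by (rule nn_integral_reflect) measurable
    also have "\<dots> = ennreal A"
      unfolding A_def eA e1 by (rule interaction_eq[symmetric]) (use \<delta> in auto)
    finally show ?thesis .
  qed
  moreover have "?Y \<le> ennreal B"
  proof -
    have "?Y \<le> (\<integral>\<^sup>+u. (\<integral>\<^sup>+\<rho>. ennreal (\<bar>indicat_real S (u + \<rho>) - indicat_real S u\<bar> * kernel_hat i \<alpha> \<tau> \<rho>) * indicator {..<0} \<rho> \<partial>lborel) * indicator {0<..<real (Suc N)} u \<partial>lborel)"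
    proof (rule nn_integral_mono)
      fix u :: real
      let ?h = "\<lambda>\<rho>. ennreal (\<bar>indicat_real S (u + \<rho>) - indicat_real S u\<bar> * kernel_hat i \<alpha> \<tau> \<rho>) * indicator {..<0} \<rho>"
      let ?W = "{\<omega>. 0 < fst \<omega> \<and> fst \<omega> < real (Suc N) \<and> fst \<omega> < snd \<omega> \<and>
        (fst \<omega> - snd \<omega> < - \<delta> - 1 / real (Suc N) \<or> - \<delta> < fst \<omega> - snd \<omega>)}"
      show "(\<integral>\<^sup>+\<rho>. ennreal (kernel_hat i \<alpha> \<tau> \<rho>) * indicator ?W (u, \<rho>) \<partial>lborel) \<le> (\<integral>\<^sup>+\<rho>. ?h \<rho> \<partial>lborel) * indicator {0<..<real (Suc N)} u"
      proof (cases "0 < u \<and> u < real (Suc N)")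
        case True
        have "(\<integral>\<^sup>+\<rho>. ennreal (kernel_hat i \<alpha> \<tau> \<rho>) * indicator ?W (u, \<rho>) \<partial>lborel) \<le> (\<integral>\<^sup>+\<rho>. ?h (0 - \<rho>) \<partial>lborel)"
        proof (rule nn_integral_mono)
          fix \<rho>
          have "- \<delta> - 1 / real (Suc N) < 0" using ord(1,2) by linarith
          then have "u \<notin> S" using True unfolding S_def by auto
          moreover have "u - \<rho> \<in> S" if "u < \<rho>" "u - \<rho> < - \<delta> - 1 / real (Suc N) \<or> - \<delta> < u - \<rho>"
            using that by (auto simp: S_def)
          ultimately show "ennreal (kernel_hat i \<alpha> \<tau> \<rho>) * indicator ?W (u, \<rho>) \<le> ?h (0 - \<rho>)"
            using True by (auto simp: indicator_def kernel_hat_minus[OF at])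
        qed
        also have "\<dots> = (\<integral>\<^sup>+\<rho>. ?h \<rho> \<partial>lborel)" by (rule nn_integral_reflect) measurable
        finally show ?thesis using True by simp
      next
        case False
        then have "indicator ?W (u, \<rho>) = (0::ennreal)" for \<rho> by auto
        then show ?thesis by simp
      qed
    qed
    also have "\<dots> = ennreal B"
      unfolding B_def eB e2 by (rule interaction_eq[symmetric]) (use \<delta> in auto)
    finally show ?thesis .
  qed
  moreover have "1 + ennreal A + ennreal B \<le> 2 * tail_mass i \<alpha> \<tau> {0<..}"
  proof -
    have nn: "0 \<le> A" "0 \<le> B" unfolding A_def B_def set_lebesgue_integral_def
      by (intro integral_nonneg_AE AE_I2; auto intro!: integral_nonneg_AE mult_nonneg_nonneg simp: kernel_hat_nonneg[OF at])+
    then have "1 + ennreal A + ennreal B = ennreal (1 + A + B)" by simp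
    also have "\<dots> \<le> ennreal (2 * enn2real (tail_mass i \<alpha> \<tau> {0<..}))" using AB by (intro ennreal_leI) simp
    also have "\<dots> = 2 * tail_mass i \<alpha> \<tau> {0<..}"
      using tail_mass_finite[OF at, of "{0<..}" i] by (simp add: ennreal_mult)
    finally show ?thesis .
  qed
  ultimately show ?thesis by (meson add_mono order_refl order_trans)
qed

lemma property_P_tail_mass:
  assumes "property_P TYPE('n) \<alpha>\<^sub>0 \<eta>\<^sub>0 \<tau>\<^sub>0" "CARD('n) \<noteq> 1" "0 \<le> \<alpha>" "\<alpha> < \<alpha>\<^sub>0" "\<tau> < \<tau>\<^sub>0" "0 < \<delta>" "\<delta> < \<eta>\<^sub>0"
  shows "1 + tail_mass i \<alpha> \<tau> {0<..<\<delta>} + tail_mass i \<alpha> \<tau> {0<..} \<le> 2 * tail_mass i \<alpha> \<tau> {0<..}"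
proof (rule LIMSEQ_le_const2[OF _ exI[of _ 0]])
  let ?W = "\<lambda>N. {\<omega>. 0 < fst \<omega> \<and> fst \<omega> < \<delta> \<and> fst \<omega> < snd \<omega> \<and> snd \<omega> < fst \<omega> + real (Suc N)}"
  let ?V = "\<lambda>N. {\<omega>. 0 < fst \<omega> \<and> fst \<omega> < real (Suc N) \<and> fst \<omega> < snd \<omega> \<and>
        (fst \<omega> - snd \<omega> < - \<delta> - 1 / real (Suc N) \<or> - \<delta> < fst \<omega> - snd \<omega>)}"
  let ?I = "\<lambda>W. \<integral>\<^sup>+v. \<integral>\<^sup>+\<rho>. ennreal (kernel_hat i \<alpha> \<tau> \<rho>) * indicator W (v, \<rho>) \<partial>lborel \<partial>lborel"
  have big: "\<forall>\<^sub>F N in sequentially. x < real (Suc N)" for x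
    using eventually_gt_at_top[of "nat \<lceil>x\<rceil>"] by eventually_elim linarith
  have W: "(\<lambda>N. ?I (?W N)) \<longlonglongrightarrow> tail_mass i \<alpha> \<tau> {0<..<\<delta>}"
  proof (rule tail_mass_limit)
    show "AE \<omega> in lborel \<Otimes>\<^sub>M lborel. fst \<omega> \<in> {0<..<\<delta>} \<and> fst \<omega> < snd \<omega> \<longrightarrow> (\<forall>\<^sub>F N in sequentially. \<omega> \<in> ?W N)"
    proof (intro AE_I2 impI)
      fix \<omega> :: "real \<times> real" assume \<omega>: "fst \<omega> \<in> {0<..<\<delta>} \<and> fst \<omega> < snd \<omega>"
      show "\<forall>\<^sub>F N in sequentially. \<omega> \<in> ?W N"
        using big[of "snd \<omega> - fst \<omega>"] by eventually_elim (use \<omega> in auto)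
    qed
    have "{\<omega> \<in> space (borel \<Otimes>\<^sub>M borel). \<omega> \<in> ?W N} \<in> sets (borel \<Otimes>\<^sub>M borel)" for N
      unfolding mem_Collect_eq by measurable
    then show "?W N \<in> sets (borel \<Otimes>\<^sub>M borel)" for N by (simp add: space_pair_measure)
  qed auto
  have V: "(\<lambda>N. ?I (?V N)) \<longlonglongrightarrow> tail_mass i \<alpha> \<tau> {0<..}"
  proof (rule tail_mass_limit)
    \<comment> \<open>Pairs with v - \<rho> = -\<delta> belong to no region \<open>?V N\<close>, but
      they form a line, which is null.\<close>
    have "AE \<omega> in lborel \<Otimes>\<^sub>M lborel. fst \<omega> - snd \<omega> \<noteq> - \<delta>"
    proof (rule lborel_pair.AE_pair_measure)
      show "AE x in lborel. AE y in lborel. fst (x, y) - snd (x, y) \<noteq> - \<delta>"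
      proof (rule AE_I2)
        fix x
        show "AE y in lborel. fst (x, y) - snd (x, y) \<noteq> - \<delta>"
          using AE_lborel_singleton[of "x + \<delta>"] by eventually_elim auto
      qed
    qed measurable
    then show "AE \<omega> in lborel \<Otimes>\<^sub>M lborel. fst \<omega> \<in> {0<..} \<and> fst \<omega> < snd \<omega> \<longrightarrow> (\<forall>\<^sub>F N in sequentially. \<omega> \<in> ?V N)"
    proof eventually_elim
      fix \<omega> :: "real \<times> real" assume ne: "fst \<omega> - snd \<omega> \<noteq> - \<delta>"
      show "fst \<omega> \<in> {0<..} \<and> fst \<omega> < snd \<omega> \<longrightarrow> (\<forall>\<^sub>F N in sequentially. \<omega> \<in> ?V N)"
      proof
        assume \<omega>: "fst \<omega> \<in> {0<..} \<and> fst \<omega> < snd \<omega>"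
        \<comment> \<open>If positive, this is how far the shifted point lies below -\<delta>. The
          point is left of the hole as soon as the width \<open>1 / real (Suc N)\<close> is
          smaller.\<close>
        let ?q = "- \<delta> - (fst \<omega> - snd \<omega>)"
        show "\<forall>\<^sub>F N in sequentially. \<omega> \<in> ?V N"
          using big[of "fst \<omega>"] big[of "1 / ?q"]
        proof eventually_elim
          fix N assume N: "fst \<omega> < real (Suc N)" "1 / ?q < real (Suc N)"
          have "1 / real (Suc N) < ?q" if "?q > 0" using N(2) that by (simp add: field_simps)
          then show "\<omega> \<in> ?V N" using N(1) \<omega> ne by force
        qed
      qed
    qed
    have "{\<omega> \<in> space (borel \<Otimes>\<^sub>M borel). \<omega> \<in> ?V N} \<in> sets (borel \<Otimes>\<^sub>M borel)" for N
      unfolding mem_Collect_eq by measurable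
    then show "?V N \<in> sets (borel \<Otimes>\<^sub>M borel)" for N by (simp add: space_pair_measure)
  qed auto
  show "(\<lambda>N. 1 + ?I (?W N) + ?I (?V N)) \<longlonglongrightarrow> 1 + tail_mass i \<alpha> \<tau> {0<..<\<delta>} + tail_mass i \<alpha> \<tau> {0<..}"
    by (intro tendsto_add W V tendsto_const)
  show "\<forall>N\<ge>0. 1 + ?I (?W N) + ?I (?V N) \<le> 2 * tail_mass i \<alpha> \<tau> {0<..}"
    using property_P_tail_mass_step[OF assms] by blast
qed

end

section \<open>The cross interaction\<close>

lemma measurable_vec_nth [measurable (raw)]:
  assumes "f \<in> borel_measurable M"
  shows "(\<lambda>x. (f x :: real ^ 'n::finite) $ k) \<in> borel_measurable M"
proof -
  have "(\<lambda>x::real ^ 'n. x $ k) \<in> borel_measurable borel"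
    by (intro borel_measurable_continuous_onI continuous_intros)
  from measurable_compose[OF assms this] show ?thesis .
qed

text \<open>Finite perimeter only gives Lebesgue measurability, whereas the Tonelli arguments run
  over products of Borel spaces.\<close>

lemma lebesgue_AE_borel:
  fixes A :: "'a::euclidean_space set"
  assumes "A \<in> sets lebesgue"
  obtains A' where "A' \<in> sets borel" "AE x in lborel. (x \<in> A') = (x \<in> A)"
  using AE_in_main_part[of A lborel] main_part_sets[of A lborel] assms that[of "main_part lborel A"] by simp

lemma half_open_cube:
  fixes l :: real
  assumes "l > 0"
  shows "half_open_cube l \<in> sets (borel :: (real ^ 'n::finite) measure)"
    and "measure lebesgue (half_open_cube l :: (real ^ 'n) set) = l ^ CARD('n)"
    and "emeasure lborel (half_open_cube l :: (real ^ 'n) set) < \<infinity>"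
proof -
  let ?Q = "half_open_cube l :: (real ^ 'n) set"
  let ?L = "(\<chi> k. l) :: real ^ 'n"
  show Q: "?Q \<in> sets borel" unfolding half_open_cube_def by measurable
  have prod: "(\<Prod>b\<in>Basis. (?L - 0) \<bullet> b) = l ^ CARD('n)"
  proof -
    have "(\<Prod>b\<in>Basis. (?L - 0) \<bullet> b) = (\<Prod>b\<in>(Basis :: (real ^ 'n) set). l)"
      by (rule prod.cong) (auto simp: Basis_vec_def inner_axis)
    then show ?thesis by simp
  qed
  have nn: "0 \<bullet> b \<le> ?L \<bullet> b" if "b \<in> Basis" for b using that assms by (auto simp: Basis_vec_def inner_axis)
  have "emeasure lborel (box 0 ?L) \<le> emeasure lborel ?Q"
    using Q by (intro emeasure_mono) (auto simp: half_open_cube_def mem_box_cart less_imp_le)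
  then have 1: "ennreal (l ^ CARD('n)) \<le> emeasure lborel ?Q"
    using emeasure_lborel_box[of 0 ?L] nn prod by simp
  have "emeasure lborel ?Q \<le> emeasure lborel (cbox 0 ?L)"
    using Q by (intro emeasure_mono) (auto simp: half_open_cube_def mem_box_cart less_imp_le)
  then have 2: "emeasure lborel ?Q \<le> ennreal (l ^ CARD('n))"
    using emeasure_lborel_cbox[of 0 ?L] nn prod by simp
  from 1 2 have e: "emeasure lborel ?Q = ennreal (l ^ CARD('n))" by simp
  then show "emeasure lborel ?Q < \<infinity>" by simp
  have "measure lebesgue ?Q = measure lborel ?Q" using Q by simp
  also have "\<dots> = l ^ CARD('n)" using e assms by (simp add: measure_def)
  finally show "measure lebesgue ?Q = l ^ CARD('n)" .
qed

text \<open>The infimum need not be attained, hence the strict inequality. Of the competitor found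
  in this way only its dependence on the single coordinate j is kept, and the volume of the cube
  cancels.\<close>

lemma stripe_dist_lessE:
  fixes E :: "(real ^ 'n::finite) set"
  assumes dist: "stripe_dist j \<eta> E (half_open_cube l) < \<delta> / l ^ CARD('n)" and "l > 0"
    and E': "E' \<in> sets borel" "AE x in lborel. (x \<in> E') = (x \<in> E)"
  obtains B where "B \<in> sets borel"
    "emeasure lborel {y \<in> half_open_cube l. (y \<in> E') \<noteq> (y $ j \<in> B)} \<le> ennreal \<delta>"
proof -
  let ?Q = "half_open_cube l :: (real ^ 'n) set"
  note Q = half_open_cube[OF \<open>l > 0\<close>, where 'n='n]
  note [measurable] = E'(1) Q(1)
  let ?I = "\<lambda>F. LINT x:?Q|lebesgue. \<bar>indicat_real E x - indicat_real F x\<bar>"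
  have "(\<lambda>F. 1 / measure lebesgue ?Q * ?I F) ` stripes j \<eta> \<noteq> {}" using empty_in_stripes by blast
  from cInf_lessD[OF this, of "\<delta> / l ^ CARD('n)"] dist obtain F where F: "F \<in> stripes j \<eta>"
    and less: "1 / measure lebesgue ?Q * ?I F < \<delta> / l ^ CARD('n)"
    unfolding stripe_dist_def by auto
  have I: "?I F < \<delta>" using less \<open>l > 0\<close> by (simp add: Q(2) field_simps)
  from F obtain B where B: "locally_finite_perimeter B"
    "sym_diff F {x. x \<bullet> unit_vec j \<in> B} \<in> null_sets lebesgue" unfolding stripes_def by auto
  from B(1) have "B \<in> sets lebesgue" by (simp add: locally_finite_perimeter_def)
  from lebesgue_AE_borel[OF this] obtain B' where B': "B' \<in> sets borel" "AE x in lborel. (x \<in> B') = (x \<in> B)" by blast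
  note [measurable] = B'(1)
  have FB: "AE x in lborel. (x \<in> F) = (x $ j \<in> B')"
  proof -
    have "AE x in lborel. x \<notin> sym_diff F {x. x \<bullet> unit_vec j \<in> B}"
      using AE_not_in[OF B(2)] by (simp add: AE_completion_iff)
    then show ?thesis using AE_coord[OF B'(2), of j]
      by eventually_elim (auto simp: inner_axis)
  qed
  let ?D = "{y. (y \<in> E') \<noteq> (y $ j \<in> B')}"
  have [measurable]: "?D \<in> sets borel"
  proof -
    have "Measurable.pred borel (\<lambda>y. (y \<in> E') \<noteq> (y $ j \<in> B'))" by measurable
    then show ?thesis by (simp add: pred_def)
  qed
  have "ennreal (?I F) = (\<integral>\<^sup>+y. indicator ?D y * indicator ?Q y \<partial>lborel)"
  proof (rule set_LINT_lebesgue_eq)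
    show "AE u in lborel. u \<in> ?Q \<longrightarrow> ennreal \<bar>indicat_real E u - indicat_real F u\<bar> = indicator ?D u"
      using FB E'(2) by eventually_elim (auto split: split_indicator)
    have "(\<integral>\<^sup>+y. indicator ?D y * indicator ?Q y \<partial>lborel) \<le> (\<integral>\<^sup>+y. indicator ?Q y \<partial>lborel)"
      by (intro nn_integral_mono) (auto split: split_indicator)
    also have "\<dots> = emeasure lborel ?Q" by simp
    finally show "(\<integral>\<^sup>+y. indicator ?D y * indicator ?Q y \<partial>lborel) < \<infinity>" using Q(3) by (rule order_le_less_trans)
  qed auto
  also have "\<dots> = (\<integral>\<^sup>+y. indicator {y \<in> ?Q. (y \<in> E') \<noteq> (y $ j \<in> B')} y \<partial>lborel)"
    by (intro nn_integral_cong) (auto split: split_indicator)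
  also have "\<dots> = emeasure lborel {y \<in> ?Q. (y \<in> E') \<noteq> (y $ j \<in> B')}"
  proof -
    have "{y \<in> ?Q. (y \<in> E') \<noteq> (y $ j \<in> B')} = ?Q \<inter> ?D" by auto
    then show ?thesis by simp
  qed
  finally show ?thesis using that[OF B'(1)] I by (metis ennreal_leI less_imp_le)
qed

lemma nn_integral_insert_coord':
  assumes [measurable]: "f \<in> borel_measurable borel"
  shows "(\<integral>\<^sup>+x. f x \<partial>lborel) = (\<integral>\<^sup>+g. \<integral>\<^sup>+z. f (insert_coord i z g) \<partial>lborel \<partial>perp_measure i)"
proof -
  interpret H: sigma_finite_measure "perp_measure i" by (rule sigma_finite_perp_measure)
  interpret P: pair_sigma_finite lborel "perp_measure i" ..
  have "(\<integral>\<^sup>+x. f x \<partial>lborel) = (\<integral>\<^sup>+z. \<integral>\<^sup>+g. f (insert_coord i z g) \<partial>perp_measure i \<partial>lborel)"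
    by (rule nn_integral_insert_coord) fact
  also have "\<dots> = (\<integral>\<^sup>+g. \<integral>\<^sup>+z. f (insert_coord i z g) \<partial>lborel \<partial>perp_measure i)"
    by (rule P.Fubini'[symmetric]) measurable
  finally show ?thesis .
qed

lemma insert_coord_eq: "insert_coord i u (perp_coords i x) = u *\<^sub>R unit_vec i + perp i x"
  by (auto simp: vec_eq_iff perp_coords_def perp_def par_def axis_def)

lemma perp_insert_coord: "u *\<^sub>R unit_vec i + perp i (insert_coord i z g) = insert_coord i u g"
  by (auto simp: vec_eq_iff perp_def par_def axis_def)

text \<open>Only one of the values of E that enter f lies off the line of the slice. In
  \<open>v_term_ge\<close> that value is read from a Borel version of E, the others from a Borel
  version of the slice.\<close>

lemma f_set_eq:
  assumes "S = slice i E t"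
  shows "f_set E t (u *\<^sub>R unit_vec i) (perp i \<zeta>) (par i \<zeta>)
    = \<bar>indicat_real S (u + \<zeta> $ i) - indicat_real S u\<bar> *
      \<bar>indicat_real E (t + (u *\<^sub>R unit_vec i + perp i \<zeta>)) - indicat_real S u\<bar>"
proof -
  have "u *\<^sub>R unit_vec i + t + par i \<zeta> = (u + \<zeta> $ i) *\<^sub>R unit_vec i + t"
    by (simp add: par_def scaleR_add_left)
  then show ?thesis
    unfolding f_set_def assms slice_def by (simp add: indicator_def add_ac)
qed

text \<open>
  At least three eighths of a small box around the jump point \<open>s\<close> disagree with the slice: a
  stripe orthogonal to \<open>j \<noteq> i\<close> is constant on lines in direction \<open>i\<close>, while the slice
  takes both values on half of each such line.
\<close>
lemma mismatch_measure_ge: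
  fixes i j :: "'n::finite" and h :: real
  assumes [measurable]: "E' \<in> sets borel" "S' \<in> sets borel" "B \<in> sets borel" and "j \<noteq> i" and h: "h > 0"
    and left: "AE u in lborel. s - h < u \<and> u < s \<longrightarrow> (u \<in> S') = c"
    and right: "AE u in lborel. s < u \<and> u < s + h \<longrightarrow> (u \<in> S') = (\<not> c)"
    and a: "\<And>k. k \<noteq> i \<Longrightarrow> 0 \<le> t $ k + a k \<and> t $ k + a k + 2 * h \<le> l" and "t $ i = 0" "0 \<le> s - h" "s + h \<le> l"
    and small: "emeasure lborel {y \<in> half_open_cube l. (y \<in> E') \<noteq> (y $ j \<in> B)} \<le> ennreal (\<delta>)"
    and "0 \<le> \<delta>" "\<delta> \<le> (2 * h) ^ CARD('n) / 2"
  shows "ennreal ((2 * h) ^ CARD('n) / 2 - \<delta>) \<le> emeasure lborel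
    {x. s - h < x $ i \<and> x $ i < s + h \<and> (\<forall>k. k \<noteq> i \<longrightarrow> a k < x $ k \<and> x $ k < a k + 2 * h) \<and> (t + x \<in> E') \<noteq> (x $ i \<in> S')}"
    (is "_ \<le> emeasure lborel ?X")
proof -
  interpret PS: product_sigma_finite "\<lambda>_ :: 'n. lborel :: real measure" ..
  let ?Q = "\<lambda>x. s - h < x $ i \<and> x $ i < s + h \<and> (\<forall>k. k \<noteq> i \<longrightarrow> a k < x $ k \<and> x $ k < a k + 2 * h)"
  let ?C = "\<Pi>\<^sub>E k\<in>UNIV - {i}. {a k<..<a k + 2 * h}"
  have C [measurable]: "?C \<in> sets (perp_measure i)" by measurable
  have eC: "emeasure (perp_measure i) ?C = ennreal ((2 * h) ^ (CARD('n) - 1))"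
    using h by (subst PS.emeasure_PiM) (auto simp: ennreal_power card_Diff_singleton)
  \<comment> \<open>Where slice and stripe disagree, \<open>E'\<close> differs from the slice or
    from the stripe, so Z is covered by \<open>?X\<close> and D.\<close>
  define Z where "Z = {x. ?Q x \<and> (x $ i \<in> S') \<noteq> ((t + x) $ j \<in> B)}"
  define D where "D = {x. ?Q x \<and> (t + x \<in> E') \<noteq> ((t + x) $ j \<in> B)}"
  have mQ: "Measurable.pred borel ?Q" by measurable
  have [measurable]: "?X \<in> sets borel" "Z \<in> sets borel" "D \<in> sets borel"
    unfolding Z_def D_def using mQ by measurable
  have "emeasure lborel Z = (\<integral>\<^sup>+x. indicator Z x \<partial>lborel)" by simp
  also have "\<dots> = (\<integral>\<^sup>+g. \<integral>\<^sup>+z. indicator Z (insert_coord i z g) \<partial>lborel \<partial>perp_measure i)"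
    by (rule nn_integral_insert_coord') simp
  also have "\<dots> = (\<integral>\<^sup>+g. ennreal h * indicator ?C g \<partial>perp_measure i)"
  proof (rule nn_integral_cong)
    fix g assume g: "g \<in> space (perp_measure i)"
    define b where "b \<longleftrightarrow> t $ j + g j \<in> B"
    show "(\<integral>\<^sup>+z. indicator Z (insert_coord i z g) \<partial>lborel) = ennreal h * indicator ?C g"
    proof (cases "g \<in> ?C")
      case True
      \<comment> \<open>The half of the segment on which the slice takes the value opposite to b,
        the constant value of the stripe on this line.\<close>
      define K where "K = (if b = c then {s<..<s + h} else {s - h<..<s})"
      have gk: "a k < g k \<and> g k < a k + 2 * h" if "k \<noteq> i" for k
        using True that by (auto simp: PiE_iff)
      have "(\<integral>\<^sup>+z. indicator Z (insert_coord i z g) \<partial>lborel) = (\<integral>\<^sup>+z. indicator K z \<partial>lborel)"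
      proof (rule nn_integral_cong_AE)
        show "AE z in lborel. indicator Z (insert_coord i z g) = (indicator K z :: ennreal)"
          using left right AE_lborel_singleton[of s]
        proof eventually_elim
          fix z assume z: "s - h < z \<and> z < s \<longrightarrow> (z \<in> S') = c" "s < z \<and> z < s + h \<longrightarrow> (z \<in> S') = (\<not> c)" "z \<noteq> s"
          have "insert_coord i z g \<in> Z \<longleftrightarrow> s - h < z \<and> z < s + h \<and> (z \<in> S') \<noteq> b"
            using gk \<open>j \<noteq> i\<close> by (auto simp: Z_def b_def)
          also have "\<dots> \<longleftrightarrow> z \<in> K" using z h by (cases "z < s") (auto simp: K_def)
          finally show "indicator Z (insert_coord i z g) = (indicator K z :: ennreal)" by (simp add: indicator_def)
        qed
      qed
      also have "\<dots> = ennreal h" using h by (auto simp: K_def)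
      finally show ?thesis using True by simp
    next
      case False
      then obtain k where "k \<noteq> i" "\<not> (a k < g k \<and> g k < a k + 2 * h)"
        using g by (auto simp: PiE_iff space_PiM)
      then have "insert_coord i z g \<notin> Z" for z by (auto simp: Z_def intro!: exI[of _ k])
      then show ?thesis using False by simp
    qed
  qed
  also have "\<dots> = ennreal h * emeasure (perp_measure i) ?C" by (rule nn_integral_cmult_indicator) simp
  also have "\<dots> = ennreal ((2 * h) ^ CARD('n) / 2)"
  proof -
    have "CARD('n) = Suc (CARD('n) - 1)" by simp
    then have "(2 * h) ^ CARD('n) = 2 * h * (2 * h) ^ (CARD('n) - 1)" by (metis power_Suc)
    then show ?thesis unfolding eC using h by (simp add: ennreal_mult[symmetric])
  qed
  finally have eZ: "emeasure lborel Z = ennreal ((2 * h) ^ CARD('n) / 2)" .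
  have "emeasure lborel D \<le> ennreal \<delta>"
  proof -
    let ?Y = "{y \<in> half_open_cube l. (y \<in> E') \<noteq> (y $ j \<in> B)}"
    have Y [measurable]: "?Y \<in> sets borel"
    proof -
      have "l > 0" using \<open>0 \<le> s - h\<close> \<open>s + h \<le> l\<close> h by linarith
      note [measurable] = half_open_cube(1)[OF this, where 'n='n]
      show ?thesis by measurable
    qed
    have "D \<subseteq> (+) t -` ?Y"
    proof
      fix x assume x: "x \<in> D"
      have "0 \<le> (t + x) $ k \<and> (t + x) $ k < l" for k
      proof (cases "k = i")
        case True then show ?thesis using x assms by (auto simp: D_def)
      next
        case False
        then have "a k < x $ k \<and> x $ k < a k + 2 * h" using x by (auto simp: D_def)
        then show ?thesis using a[OF False] by simp
      qed
      then show "x \<in> (+) t -` ?Y" using x by (auto simp: D_def half_open_cube_def)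
    qed
    moreover have "(+) t -` ?Y \<in> sets lborel"
      unfolding sets_lborel by (rule measurable_sets_borel[of "(+) t" borel]) (use Y in simp_all)
    ultimately have "emeasure lborel D \<le> emeasure lborel ((+) t -` ?Y)"
      by (rule emeasure_mono)
    also have "\<dots> = emeasure (distr lborel borel ((+) t)) ?Y" using Y by (subst emeasure_distr) simp_all
    also have "\<dots> \<le> ennreal \<delta>" using small by (simp add: lborel_distr_plus)
    finally show ?thesis .
  qed
  moreover have "emeasure lborel Z \<le> emeasure lborel (?X \<union> D)"
    by (intro emeasure_mono) (auto simp: Z_def D_def)
  moreover have "emeasure lborel (?X \<union> D) \<le> emeasure lborel ?X + emeasure lborel D"
    by (rule emeasure_subadditive) auto
  ultimately have *: "ennreal ((2 * h) ^ CARD('n) / 2) \<le> emeasure lborel ?X + ennreal \<delta>"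
    unfolding eZ by (meson add_left_mono order_trans)
  have "ennreal ((2 * h) ^ CARD('n) / 2 - \<delta>) = ennreal ((2 * h) ^ CARD('n) / 2) - ennreal \<delta>"
    using \<open>0 \<le> \<delta>\<close> by (simp add: ennreal_minus)
  also have "\<dots> \<le> emeasure lborel ?X" using * by (simp add: ennreal_minus_le_iff add.commute)
  finally show ?thesis .
qed

section \<open>Lower bounds for the cross interaction\<close>

lemma v_term_nonneg: "0 \<le> v_term i \<alpha> \<tau> E t s"
proof -
  have "prev_bd (slice i E t) s \<le> next_bd (slice i E t) s"
    using prev_bd_le next_bd_ge by (rule order_trans)
  then show ?thesis
    unfolding v_term_def Let_def interval_lebesgue_integral_def set_lebesgue_integral_def
    by (auto intro!: mult_nonneg_nonneg integral_nonneg_AE simp: f_set_def kernel_nonneg)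
qed

text \<open>For u within \<epsilon>/2 of s, an interval of shifts of length \<epsilon>/2 carries u
  to the other side of s; the perpendicular shifts are those after which E disagrees with the slice.
  All coordinates of such a shift are at most \<epsilon>, which bounds the kernel from below. The
  product consists of this kernel bound, the length of the interval and the measure of the mismatch
  set.\<close>

lemma v_term_ge:
  fixes i j :: "'n::finite" and E :: "(real ^ 'n) set" and t :: "real ^ 'n" and s :: real
  defines "S \<equiv> slice i E t"
  assumes at: "\<alpha> < 1" "\<tau> > 0" and E: "E \<in> sets lebesgue" and S: "locally_finite_perimeter S"
    and sS: "s \<in> reduced_boundary S" and "\<epsilon> > 0"
    and gap: "prev_bd S s \<le> ereal (s - \<epsilon> / 2)" "ereal (s + \<epsilon> / 2) \<le> next_bd S s"
    and E' [measurable]: "E' \<in> sets borel" and EE': "AE x in lborel. (x \<in> E') = (x \<in> E)"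
    and B [measurable]: "B \<in> sets borel" and "j \<noteq> i"
    and small: "emeasure lborel {y \<in> half_open_cube l. (y \<in> E') \<noteq> (y $ j \<in> B)} \<le> ennreal (\<epsilon> ^ CARD('n) / 8)"
    and l: "0 \<le> s - \<epsilon> / 2" "s + \<epsilon> / 2 \<le> l" "2 * \<epsilon> \<le> l" and ti: "t $ i = 0" and t: "\<And>k. 0 \<le> t $ k \<and> t $ k < l"
    and \<tau>\<epsilon>: "\<tau> powr (1 / beta_exp \<alpha>) \<le> \<epsilon>"
  shows "1 / (2 * real CARD('n)) *
      (((real CARD('n) + 1) * \<epsilon>) powr - p_exp CARD('n) \<alpha> * (\<epsilon> / 2) * (3 * \<epsilon> ^ CARD('n) / 8)) \<le> v_term i \<alpha> \<tau> E t s"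
proof -
  define h where "h = \<epsilon> / 2"
  have h: "h > 0" "2 * h = \<epsilon>" using \<open>\<epsilon> > 0\<close> by (auto simp: h_def)
  define I where "I = einterval (prev_bd S s) (next_bd S s)"
  define L R where "L = einterval (prev_bd S s) (ereal s)" and "R = einterval (ereal s) (next_bd S s)"
  have [measurable]: "I \<in> sets borel" by (simp add: I_def)
  have "S \<in> sets lebesgue" using S by (simp add: locally_finite_perimeter_def)
  \<comment> \<open>\<open>S'\<close> is a Borel version of S itself and not a slice of
    \<open>E'\<close>: a single line is a null set, on which \<open>E'\<close> need not agree with
    E.\<close>
  from lebesgue_AE_borel[OF this] obtain S' where S' [measurable]: "S' \<in> sets borel" and SS': "AE x in lborel. (x \<in> S') = (x \<in> S)" by blast
  obtain c1 where c1: "AE x in lborel. x \<in> L \<longrightarrow> (x \<in> S) = c1"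
    using neighbours_AE_const(1)[OF S, of s] unfolding L_def by blast
  obtain c2 where c2: "AE x in lborel. x \<in> R \<longrightarrow> (x \<in> S) = c2"
    using neighbours_AE_const(2)[OF S, of s] unfolding R_def by blast
  have inL: "x \<in> L" if "s - h < x" "x < s" for x
  proof -
    have "prev_bd S s \<le> ereal (s - h)" using gap by (simp add: h_def)
    also have "\<dots> < ereal x" using that by simp
    finally show ?thesis using that by (simp add: L_def einterval_iff)
  qed
  have inR: "x \<in> R" if "s < x" "x < s + h" for x
  proof -
    have "ereal x < ereal (s + h)" using that by simp
    also have "\<dots> \<le> next_bd S s" using gap by (simp add: h_def)
    finally show ?thesis using that by (simp add: R_def einterval_iff)
  qed
  have "c1 \<noteq> c2"
  proof
    assume "c1 = c2"
    have "AE x in lborel. x \<in> ball s h \<longrightarrow> (x \<in> S) = c1"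
      using c1 c2 AE_lborel_singleton[of s]
    proof eventually_elim
      fix x assume x: "x \<in> L \<longrightarrow> (x \<in> S) = c1" "x \<in> R \<longrightarrow> (x \<in> S) = c2" "x \<noteq> s"
      show "x \<in> ball s h \<longrightarrow> (x \<in> S) = c1"
        using x inL[of x] inR[of x] \<open>c1 = c2\<close> by (cases "x < s") (auto simp: dist_real_def)
    qed
    with AE_const_notin_reduced_boundary[OF \<open>S \<in> sets lebesgue\<close> h(1)] sS show False by blast
  qed
  have c1': "AE x in lborel. x \<in> L \<longrightarrow> (x \<in> S') = c1" using c1 SS' by eventually_elim auto
  have c2': "AE x in lborel. x \<in> R \<longrightarrow> (x \<in> S') = (\<not> c1)" using c2 SS' by eventually_elim (use \<open>c1 \<noteq> c2\<close> in auto)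

  define F where "F u \<zeta> = \<bar>indicat_real S' (u + \<zeta> $ i) - indicat_real S' u\<bar> *
      \<bar>indicat_real E' (t + (u *\<^sub>R unit_vec i + perp i \<zeta>)) - indicat_real S' u\<bar> * kernel \<alpha> \<tau> \<zeta>" for u and \<zeta> :: "real ^ 'n"
  define G where "G u = (\<integral>\<^sup>+\<zeta>. ennreal (F u \<zeta>) \<partial>lborel)" for u
  have F0: "0 \<le> F u \<zeta>" for u \<zeta> by (simp add: F_def kernel_nonneg)
  have Fle: "F u \<zeta> \<le> \<bar>indicat_real S' (u + \<zeta> $ i) - indicat_real S' u\<bar> * kernel \<alpha> \<tau> \<zeta>" for u \<zeta>
    unfolding F_def by (intro mult_right_mono) (auto simp: kernel_nonneg split: split_indicator)
  have mF: "(\<lambda>x. F (fst x) (snd x)) \<in> borel_measurable (borel \<Otimes>\<^sub>M lborel)"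
    unfolding F_def perp_def par_def by measurable
  have mFu [measurable]: "F u \<in> borel_measurable borel" for u
    unfolding F_def perp_def par_def by measurable
  have [measurable]: "G \<in> borel_measurable borel"
    unfolding G_def using mF by (intro lborel.borel_measurable_nn_integral) (simp add: case_prod_unfold)
  note [measurable] = measurable_kernel_hat[OF at]

  let ?g = "\<lambda>u. LINT \<zeta>|lebesgue. f_set E t (u *\<^sub>R unit_vec i) (perp i \<zeta>) (par i \<zeta>) * kernel \<alpha> \<tau> \<zeta>"
  have g0: "0 \<le> ?g u" for u by (intro integral_nonneg_AE AE_I2) (simp add: f_set_def kernel_nonneg)
  \<comment> \<open>For almost every u the sets E and \<open>E'\<close> agree almost everywhere on
    the hyperplane at height u, which is where the perpendicular shifts land.\<close>
  have gG: "AE u in lborel. u \<in> I \<longrightarrow> ennreal (?g u) = G u"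
    using SS' AE_insert_coord[OF AE_translate[OF EE', of t], of i]
  proof eventually_elim
    fix u assume u: "(u \<in> S') = (u \<in> S)"
      and E2: "AE g in perp_measure i. (t + insert_coord i u g \<in> E') = (t + insert_coord i u g \<in> E)"
    have "ennreal (LINT \<zeta>:UNIV|lebesgue. f_set E t (u *\<^sub>R unit_vec i) (perp i \<zeta>) (par i \<zeta>) * kernel \<alpha> \<tau> \<zeta>)
      = (\<integral>\<^sup>+\<zeta>. ennreal (F u \<zeta>) * indicator UNIV \<zeta> \<partial>lborel)"
    proof (rule set_LINT_lebesgue_eq)
      show "0 \<le> f_set E t (u *\<^sub>R unit_vec i) (perp i \<zeta>) (par i \<zeta>) * kernel \<alpha> \<tau> \<zeta>" for \<zeta>
        by (simp add: f_set_def kernel_nonneg)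
      show "AE \<zeta> in lborel. \<zeta> \<in> UNIV \<longrightarrow>
        ennreal (f_set E t (u *\<^sub>R unit_vec i) (perp i \<zeta>) (par i \<zeta>) * kernel \<alpha> \<tau> \<zeta>) = ennreal (F u \<zeta>)"
        using AE_coord[OF AE_translate[OF SS', of u], of i] AE_perp_coords[OF E2]
        by eventually_elim (use u in \<open>simp add: F_def f_set_eq[OF S_def[THEN meta_eq_to_obj_eq]] insert_coord_eq indicator_def\<close>)
      have "(\<integral>\<^sup>+\<zeta>. ennreal (F u \<zeta>) * indicator UNIV \<zeta> \<partial>lborel) \<le> (\<integral>\<^sup>+\<zeta>. ennreal (kernel \<alpha> \<tau> (\<zeta> :: real ^ 'n)) \<partial>lborel)"
      proof (rule nn_integral_mono)
        fix \<zeta> :: "real ^ 'n"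
        have "F u \<zeta> \<le> 1 * kernel \<alpha> \<tau> \<zeta>"
          by (rule order_trans[OF Fle]) (intro mult_right_mono, auto simp: kernel_nonneg split: split_indicator)
        then show "ennreal (F u \<zeta>) * indicator UNIV \<zeta> \<le> ennreal (kernel \<alpha> \<tau> \<zeta>)" by (simp add: ennreal_leI)
      qed
      then show "(\<integral>\<^sup>+\<zeta>. ennreal (F u \<zeta>) * indicator UNIV \<zeta> \<partial>lborel) < \<infinity>"
        using nn_integral_kernel_finite[OF at] by (rule order_le_less_trans)
    qed auto
    then show "u \<in> I \<longrightarrow> ennreal (?g u) = G u" by (simp add: set_lebesgue_integral_def G_def)
  qed

  \<comment> \<open>\<open>I\<close> may be unbounded, and without integrability the outer Bochner integral would be \<open>0\<close>.
    If a neighbour of \<open>s\<close> is infinite, \<open>ra\<close> or \<open>rb\<close> is the junk value \<open>0\<close>, which only adds a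
    superfluous finite term.\<close>
  have "(\<integral>\<^sup>+u. G u * indicator I u \<partial>lborel) < \<infinity>"
  proof -
    define ra rb where "ra = real_of_ereal (prev_bd S s)" and "rb = real_of_ereal (next_bd S s)"
    \<comment> \<open>\<open>T q u\<close> is the mass of the shifts at least as long as the
      distance from u to q. A shift that changes the value of the slice leaves the gap of u through
      an endpoint, hence has such a length for q one of s, \<open>ra\<close>,
      \<open>rb\<close>.\<close>
    define T where "T q u = (\<integral>\<^sup>+z. ennreal (kernel_hat i \<alpha> \<tau> z) * indicator {z. \<bar>u - q\<bar> \<le> \<bar>z\<bar>} z \<partial>lborel)" for q u
    have mT [measurable]: "T q \<in> borel_measurable borel" for q
    proof -
      have "T q = (\<lambda>u. \<integral>\<^sup>+z. ennreal (kernel_hat i \<alpha> \<tau> z) * indicator {x. \<bar>fst x - q\<bar> \<le> \<bar>snd x\<bar>} (u, z) \<partial>lborel)"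
        unfolding T_def by (intro ext nn_integral_cong) (auto split: split_indicator)
      also have "\<dots> \<in> borel_measurable borel" by (rule lborel.borel_measurable_nn_integral) simp
      finally show ?thesis .
    qed
    have far: "\<bar>u - s\<bar> \<le> \<bar>z\<bar> \<or> \<bar>u - ra\<bar> \<le> \<bar>z\<bar> \<or> \<bar>u - rb\<bar> \<le> \<bar>z\<bar>"
      if "u \<in> L \<and> u + z \<notin> L \<or> u \<in> R \<and> u + z \<notin> R" for u z
    proof (cases "u \<in> L \<and> u + z \<notin> L")
      case True
      then show ?thesis
        unfolding L_def ra_def by (cases "prev_bd S s") (auto simp: einterval_iff)
    next
      case False
      with that have "u \<in> R \<and> u + z \<notin> R" by blast
      then show ?thesis
        unfolding R_def rb_def by (cases "next_bd S s") (auto simp: einterval_iff)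
    qed
    have "AE u in lborel. G u * indicator I u \<le> T s u + T ra u + T rb u"
      using c1' c2' AE_lborel_singleton[of s]
    proof eventually_elim
      fix u assume u: "u \<in> L \<longrightarrow> (u \<in> S') = c1" "u \<in> R \<longrightarrow> (u \<in> S') = (\<not> c1)" "u \<noteq> s"
      show "G u * indicator I u \<le> T s u + T ra u + T rb u"
      proof (cases "u \<in> I")
        case True
        then have uLR: "u \<in> L \<or> u \<in> R" using \<open>u \<noteq> s\<close> by (auto simp: I_def L_def R_def einterval_iff)
        let ?i = "\<lambda>q z. indicator {z. \<bar>u - q\<bar> \<le> \<bar>z\<bar>} z :: ennreal"
        have "G u \<le> (\<integral>\<^sup>+\<zeta>. (?i s (\<zeta> $ i) + ?i ra (\<zeta> $ i) + ?i rb (\<zeta> $ i)) * ennreal (kernel \<alpha> \<tau> \<zeta>) \<partial>lborel)"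
          unfolding G_def
        proof (rule nn_integral_mono_AE)
          show "AE \<zeta> in lborel. ennreal (F u \<zeta>) \<le> (?i s (\<zeta> $ i) + ?i ra (\<zeta> $ i) + ?i rb (\<zeta> $ i)) * ennreal (kernel \<alpha> \<tau> \<zeta>)"
            using AE_coord[OF AE_translate[OF c1', of u], of i] AE_coord[OF AE_translate[OF c2', of u], of i]
          proof eventually_elim
            fix \<zeta> :: "real ^ 'n"
            assume z: "u + \<zeta> $ i \<in> L \<longrightarrow> (u + \<zeta> $ i \<in> S') = c1" "u + \<zeta> $ i \<in> R \<longrightarrow> (u + \<zeta> $ i \<in> S') = (\<not> c1)"
            show "ennreal (F u \<zeta>) \<le> (?i s (\<zeta> $ i) + ?i ra (\<zeta> $ i) + ?i rb (\<zeta> $ i)) * ennreal (kernel \<alpha> \<tau> \<zeta>)"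
            proof (cases "(u + \<zeta> $ i \<in> S') = (u \<in> S')")
              case True
              then have "F u \<zeta> = 0" by (simp add: F_def indicator_def)
              then show ?thesis by simp
            next
              case False
              then have "u \<in> L \<and> u + \<zeta> $ i \<notin> L \<or> u \<in> R \<and> u + \<zeta> $ i \<notin> R" using uLR u z by blast
              from far[OF this] have 1: "1 \<le> ?i s (\<zeta> $ i) + ?i ra (\<zeta> $ i) + ?i rb (\<zeta> $ i)"
                by (auto simp: indicator_def)
              have "ennreal (F u \<zeta>) \<le> 1 * ennreal (kernel \<alpha> \<tau> \<zeta>)"
                using Fle[of u \<zeta>] False by (auto intro!: ennreal_leI simp: indicator_def split: if_splits)
              also have "\<dots> \<le> (?i s (\<zeta> $ i) + ?i ra (\<zeta> $ i) + ?i rb (\<zeta> $ i)) * ennreal (kernel \<alpha> \<tau> \<zeta>)"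
                by (rule mult_right_mono[OF 1]) simp
              finally show ?thesis .
            qed
          qed
        qed
        also have "\<dots> = (\<integral>\<^sup>+z. (?i s z + ?i ra z + ?i rb z) * ennreal (kernel_hat i \<alpha> \<tau> z) \<partial>lborel)"
          by (rule nn_integral_kernel_hat[OF at, symmetric]) measurable
        also have "\<dots> = (\<integral>\<^sup>+z. ennreal (kernel_hat i \<alpha> \<tau> z) * ?i s z + ennreal (kernel_hat i \<alpha> \<tau> z) * ?i ra z
            + ennreal (kernel_hat i \<alpha> \<tau> z) * ?i rb z \<partial>lborel)"
          by (intro nn_integral_cong) (simp add: distrib_left mult.commute)
        also have "\<dots> = T s u + T ra u + T rb u"
          unfolding T_def by (simp add: nn_integral_add)
        finally show ?thesis using True by simp
      qed simp
    qed
    then have "(\<integral>\<^sup>+u. G u * indicator I u \<partial>lborel) \<le> (\<integral>\<^sup>+u. T s u + T ra u + T rb u \<partial>lborel)"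
      by (rule nn_integral_mono_AE)
    also have "\<dots> = (\<integral>\<^sup>+u. T s u \<partial>lborel) + (\<integral>\<^sup>+u. T ra u \<partial>lborel) + (\<integral>\<^sup>+u. T rb u \<partial>lborel)"
      by (simp add: nn_integral_add)
    also have "\<dots> < \<infinity>" unfolding T_def using nn_integral_strip_finite[OF at, of i] by simp
    finally show ?thesis .
  qed
  with gG g0 have V: "ennreal (LINT u:I|lebesgue. ?g u) = (\<integral>\<^sup>+u. G u * indicator I u \<partial>lborel)"
    by (intro set_LINT_lebesgue_eq) auto

  define n where "n = CARD('n)"
  define m where "m = ((real n + 1) * \<epsilon>) powr - p_exp n \<alpha>"
  \<comment> \<open>In each coordinate the box extends from t upwards if that stays inside the cube,
    and downwards otherwise. The assumption \<open>2 * \<epsilon> \<le> l\<close> makes one of the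
    two directions fit.\<close>
  define a where "a k = (if t $ k + \<epsilon> \<le> l then 0 else - \<epsilon>)" for k
  define X where "X = {x. s - h < x $ i \<and> x $ i < s + h \<and> (\<forall>k. k \<noteq> i \<longrightarrow> a k < x $ k \<and> x $ k < a k + 2 * h) \<and> (t + x \<in> E') \<noteq> (x $ i \<in> S')}"
  have X [measurable]: "X \<in> sets borel"
    unfolding X_def by measurable
  \<comment> \<open>To the base of the power the n coordinates contribute at most n \<epsilon>, and
    the term with \<tau> at most \<epsilon>.\<close>
  have kernel_ge: "m \<le> kernel \<alpha> \<tau> \<zeta>" if "\<And>k. \<bar>\<zeta> $ k\<bar> \<le> \<epsilon>" for \<zeta> :: "real ^ 'n"
  proof -
    have "l1_norm \<zeta> \<le> (\<Sum>k\<in>(UNIV :: 'n set). \<epsilon>)" unfolding l1_norm_def by (intro sum_mono that)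
    then have "l1_norm \<zeta> + \<tau> powr (1 / beta_exp \<alpha>) \<le> (real n + 1) * \<epsilon>" using \<tau>\<epsilon> by (simp add: n_def algebra_simps)
    moreover have "0 < l1_norm \<zeta> + \<tau> powr (1 / beta_exp \<alpha>)"
      using l1_norm_nonneg[of \<zeta>] at by (simp add: add_nonneg_pos)
    moreover have "- p_exp n \<alpha> \<le> 0" using at by (simp add: p_exp_def)
    ultimately show ?thesis unfolding kernel_eq_powr[OF at] m_def n_def[symmetric] by (intro powr_mono2') auto
  qed
  have lower: "AE u in lborel. ennreal (m * h) * (\<integral>\<^sup>+g. indicator X (insert_coord i u g) \<partial>perp_measure i) \<le> G u * indicator I u"
    using c1' c2' AE_lborel_singleton[of s]
  proof eventually_elim
    fix u assume u: "u \<in> L \<longrightarrow> (u \<in> S') = c1" "u \<in> R \<longrightarrow> (u \<in> S') = (\<not> c1)" "u \<noteq> s"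
    show "ennreal (m * h) * (\<integral>\<^sup>+g. indicator X (insert_coord i u g) \<partial>perp_measure i) \<le> G u * indicator I u"
    proof (cases "s - h < u \<and> u < s + h")
      case False
      then have "insert_coord i u g \<notin> X" for g by (auto simp: X_def)
      then show ?thesis by simp
    next
      case uJ: True
      then have "u \<in> L \<or> u \<in> R" using inL inR \<open>u \<noteq> s\<close> by (meson linorder_neqE)
      have uI: "u \<in> I"
      proof -
        have "prev_bd S s \<le> ereal s" "ereal s \<le> next_bd S s" by (rule prev_bd_le next_bd_ge)+
        with \<open>u \<in> L \<or> u \<in> R\<close> show ?thesis
          unfolding I_def L_def R_def einterval_iff by (meson order_less_le_trans order_le_less_trans)
      qed
      \<comment> \<open>The shifts that carry u across s to a point within h of s. As u itself is
        within h of s, they are shorter than 2 h = \<epsilon>.\<close>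
      define K where "K = (if u < s then {s - u<..<s - u + h} else {s - u - h<..<s - u})"
      have [measurable]: "K \<in> sets borel" by (simp add: K_def)
      have eK: "emeasure lborel K = ennreal h" using h by (simp add: K_def)
      have "ennreal (m * h) * (\<integral>\<^sup>+g. indicator X (insert_coord i u g) \<partial>perp_measure i)
        = (\<integral>\<^sup>+z. (ennreal m * (\<integral>\<^sup>+g. indicator X (insert_coord i u g) \<partial>perp_measure i)) * indicator K z \<partial>lborel)"
        using h by (subst nn_integral_cmult_indicator) (auto simp: eK ennreal_mult m_def mult_ac)
      also have "\<dots> = (\<integral>\<^sup>+z. \<integral>\<^sup>+g. ennreal m * indicator X (insert_coord i u g) * indicator K z \<partial>perp_measure i \<partial>lborel)"
        by (simp add: nn_integral_cmult nn_integral_multc)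
      also have "\<dots> \<le> (\<integral>\<^sup>+z. \<integral>\<^sup>+g. ennreal (F u (insert_coord i z g)) \<partial>perp_measure i \<partial>lborel)"
      proof (rule nn_integral_mono_AE)
        show "AE z in lborel. (\<integral>\<^sup>+g. ennreal m * indicator X (insert_coord i u g) * indicator K z \<partial>perp_measure i)
            \<le> (\<integral>\<^sup>+g. ennreal (F u (insert_coord i z g)) \<partial>perp_measure i)"
          using AE_translate[OF c1', of u] AE_translate[OF c2', of u]
        proof eventually_elim
          fix z assume z: "u + z \<in> L \<longrightarrow> (u + z \<in> S') = c1" "u + z \<in> R \<longrightarrow> (u + z \<in> S') = (\<not> c1)"
          show "(\<integral>\<^sup>+g. ennreal m * indicator X (insert_coord i u g) * indicator K z \<partial>perp_measure i)
            \<le> (\<integral>\<^sup>+g. ennreal (F u (insert_coord i z g)) \<partial>perp_measure i)"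
          proof (rule nn_integral_mono)
            fix g
            show "ennreal m * indicator X (insert_coord i u g) * indicator K z \<le> ennreal (F u (insert_coord i z g))"
            proof (cases "z \<in> K \<and> insert_coord i u g \<in> X")
              case True
              have "(u + z \<in> S') \<noteq> (u \<in> S')"
              proof (cases "u < s")
                case True
                then show ?thesis using \<open>z \<in> K \<and> _\<close> u z inL[of u] inR[of "u + z"] uJ by (auto simp: K_def)
              next
                case False
                then show ?thesis using \<open>z \<in> K \<and> _\<close> u z inR[of u] inL[of "u + z"] uJ by (auto simp: K_def)
              qed
              moreover have "(t + insert_coord i u g \<in> E') \<noteq> (u \<in> S')" using True by (auto simp: X_def)
              ultimately have "F u (insert_coord i z g) = kernel \<alpha> \<tau> (insert_coord i z g)"
                by (auto simp: F_def perp_insert_coord indicator_def)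
              moreover have "m \<le> kernel \<alpha> \<tau> (insert_coord i z g)"
              proof (rule kernel_ge)
                fix k show "\<bar>insert_coord i z g $ k\<bar> \<le> \<epsilon>"
                proof (cases "k = i")
                  case True
                  then show ?thesis using \<open>z \<in> K \<and> _\<close> uJ h by (auto simp: K_def split: if_splits)
                next
                  case False
                  then have "a k < g k \<and> g k < a k + 2 * h" using True by (auto simp: X_def)
                  then show ?thesis using False h by (auto simp: a_def split: if_splits)
                qed
              qed
              ultimately show ?thesis using True by (simp add: ennreal_leI)
            qed auto
          qed
        qed
      qed
      also have "\<dots> = G u" unfolding G_def by (rule nn_integral_insert_coord[symmetric]) simp
      finally show ?thesis using uI by simp
    qed
  qed
  have "ennreal (m * h * (3 * \<epsilon> ^ n / 8)) = ennreal (m * h) * ennreal ((2 * h) ^ CARD('n) / 2 - \<epsilon> ^ n / 8)"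
    using h \<open>\<epsilon> > 0\<close> unfolding h n_def[symmetric] by (subst ennreal_mult[symmetric]) (auto simp: m_def)
  also have "\<dots> \<le> ennreal (m * h) * emeasure lborel X"
    unfolding X_def
  proof (intro mult_left_mono mismatch_measure_ge[where l=l and B=B and j=j])
    show "AE u in lborel. s - h < u \<and> u < s \<longrightarrow> (u \<in> S') = c1" using c1' by eventually_elim (use inL in blast)
    show "AE u in lborel. s < u \<and> u < s + h \<longrightarrow> (u \<in> S') = (\<not> c1)" using c2' by eventually_elim (use inR in blast)
    show "0 \<le> t $ k + a k \<and> t $ k + a k + 2 * h \<le> l" if "k \<noteq> i" for k
      using t[of k] l h by (auto simp: a_def)
    show "emeasure lborel {y \<in> half_open_cube l. (y \<in> E') \<noteq> (y $ j \<in> B)} \<le> ennreal (\<epsilon> ^ n / 8)"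
      using small by (simp add: n_def)
  qed (use h l ti \<open>j \<noteq> i\<close> \<open>\<epsilon> > 0\<close> in \<open>auto simp: n_def h_def\<close>)
  also have "\<dots> = ennreal (m * h) * (\<integral>\<^sup>+u. \<integral>\<^sup>+g. indicator X (insert_coord i u g) \<partial>perp_measure i \<partial>lborel)"
    by (subst nn_integral_insert_coord[symmetric]) auto
  also have "\<dots> = (\<integral>\<^sup>+u. ennreal (m * h) * (\<integral>\<^sup>+g. indicator X (insert_coord i u g) \<partial>perp_measure i) \<partial>lborel)"
  proof (rule nn_integral_cmult[symmetric])
    interpret H: sigma_finite_measure "perp_measure i" by (rule sigma_finite_perp_measure)
    show "(\<lambda>u. \<integral>\<^sup>+g. indicator X (insert_coord i u g) \<partial>perp_measure i) \<in> borel_measurable lborel" by measurable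
  qed
  also have "\<dots> \<le> (\<integral>\<^sup>+u. G u * indicator I u \<partial>lborel)" using lower by (rule nn_integral_mono_AE)
  finally have "ennreal (m * h * (3 * \<epsilon> ^ n / 8)) \<le> ennreal (LINT u:I|lebesgue. ?g u)" unfolding V .
  moreover have "0 \<le> (LINT u:I|lebesgue. ?g u)"
    unfolding set_lebesgue_integral_def using g0 by (intro integral_nonneg_AE AE_I2) auto
  ultimately have le: "m * h * (3 * \<epsilon> ^ n / 8) \<le> (LINT u:I|lebesgue. ?g u)" by (simp add: ennreal_le_iff)
  have "prev_bd S s \<le> next_bd S s" using prev_bd_le next_bd_ge by (rule order_trans)
  then have v: "v_term i \<alpha> \<tau> E t s = 1 / (2 * real n) * (LINT u:I|lebesgue. ?g u)"
    unfolding v_term_def Let_def S_def[symmetric] interval_lebesgue_integral_def I_def n_def by simp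
  show ?thesis
    unfolding v n_def[symmetric] by (rule mult_left_mono[OF le[unfolded m_def h_def]]) simp
qed

text \<open>With p = n + 2 - \<alpha> the powers of e combine to the exponent -(1 - \<alpha>) and
  the numbers to 3 / (32 n). Since \<alpha> is nonnegative, \<open>(n + 1) powr - p\<close> is at
  least \<open>(n + 1) powr - (n + 2)\<close>; since e is at most 1,
  \<open>e powr - (1 - \<alpha>)\<close> is at least \<open>e powr - (1 - \<alpha>\<^sub>0)\<close>.
  This removes \<alpha>, and solving the remaining inequality for e gives the last
  assumption.\<close>

lemma box_bound_ge_1:
  fixes n e \<alpha> \<alpha>\<^sub>0 :: real and N :: nat
  assumes n: "n = real N" "N > 0" and e: "0 < e" "e \<le> 1" and \<alpha>: "0 \<le> \<alpha>" "\<alpha> < \<alpha>\<^sub>0" "\<alpha>\<^sub>0 < 1"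
    and eC: "e \<le> (3 / (32 * n) * (n + 1) powr - (n + 2)) powr (1 / (1 - \<alpha>\<^sub>0))"
  shows "1 \<le> 1 / (2 * n) * (((n + 1) * e) powr - p_exp N \<alpha> * (e / 2) * (3 * e ^ N / 8))"
proof -
  define C where "C = 3 / (32 * n) * (n + 1) powr - (n + 2)"
  have n0: "n > 0" using n by simp
  then have C: "C > 0" by (simp add: C_def)
  define p where "p = p_exp N \<alpha>"
  have p: "p = n + 2 - \<alpha>" by (simp add: p_def p_exp_def n)
  have "e powr (1 - \<alpha>\<^sub>0) \<le> (C powr (1 / (1 - \<alpha>\<^sub>0))) powr (1 - \<alpha>\<^sub>0)"
    using eC e \<alpha> by (intro powr_mono2) (auto simp: C_def)
  also have "\<dots> = C" using C \<alpha> by (simp add: powr_powr)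
  finally have "1 \<le> C * e powr - (1 - \<alpha>\<^sub>0)"
    using e by (simp only: powr_minus) (simp add: divide_inverse[symmetric])
  also have "\<dots> \<le> C * e powr - (1 - \<alpha>)"
    using C e \<alpha> by (intro mult_left_mono powr_mono') auto
  also have "\<dots> \<le> (3 / (32 * n) * (n + 1) powr - p) * e powr - (1 - \<alpha>)"
    unfolding C_def using n0 \<alpha> p by (intro mult_right_mono mult_left_mono powr_mono) auto
  also have "e powr - (1 - \<alpha>) = e powr - p * (e * e ^ N)"
  proof -
    have "e * e ^ N = e powr (n + 1)" using e by (simp add: powr_add powr_realpow n)
    then have "e powr - p * (e * e ^ N) = e powr (- p + (n + 1))" by (simp only: powr_add)
    also have "- p + (n + 1) = - (1 - \<alpha>)" by (simp add: p)
    finally show ?thesis by simp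
  qed
  also have "(3 / (32 * n) * (n + 1) powr - p) * (e powr - p * (e * e ^ N))
     = 1 / (2 * n) * (((n + 1) * e) powr - p * (e / 2) * (3 * e ^ N / 8))"
    using n0 e by (simp add: powr_mult)
  finally show ?thesis unfolding p_def .
qed

theorem proposition5p5:
  fixes \<alpha>\<^sub>0 \<eta>\<^sub>0 \<tau>\<^sub>0 :: real
  assumes "\<alpha>\<^sub>0 < 1" and "\<eta>\<^sub>0 > 0" and "\<tau>\<^sub>0 > 0"
    and "property_P TYPE('n::finite) \<alpha>\<^sub>0 \<eta>\<^sub>0 \<tau>\<^sub>0"
  shows "\<exists>\<tau>\<^sub>2>0. \<exists>\<epsilon>\<^sub>2>0.
    \<forall>\<tau> \<alpha> \<epsilon> l. 0 < \<tau> \<and> \<tau> < \<tau>\<^sub>2 \<and> 0 \<le> \<alpha> \<and> \<alpha> < \<alpha>\<^sub>0 \<and> 0 < \<epsilon> \<and> \<epsilon> < \<epsilon>\<^sub>2 \<and> 0 < l \<longrightarrow>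
      (\<forall>(E :: (real ^ 'n) set) (i :: 'n) (t :: real ^ 'n) (s :: real).
        locally_finite_perimeter E \<and>
        t $ i = 0 \<and>
        t + s *\<^sub>R unit_vec i \<in> reduced_boundary E \<inter> half_open_cube l \<and>
        locally_finite_perimeter (slice i E t) \<and>
        s \<in> reduced_boundary (slice i E t) \<and>
        min \<bar>s - l\<bar> \<bar>s\<bar> > \<eta>\<^sub>0 \<and>
        (\<exists>\<eta>>0. \<exists>j. j \<noteq> i \<and>
           stripe_dist j \<eta> E (half_open_cube l) \<le> \<epsilon> ^ CARD('n) / (16 * l ^ CARD('n)))
        \<longrightarrow> r_term i \<alpha> \<tau> E t s + v_term i \<alpha> \<tau> E t s \<ge> 0)"
proof -
  define n where "n = real CARD('n)"
  define C where "C = 3 / (32 * n) * (n + 1) powr - (n + 2)"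
  \<comment> \<open>The value of \<open>\<epsilon>\<^sub>2\<close>. The bound by
    \<open>\<eta>\<^sub>0\<close> makes the interval of half-width e / 2 around s fit into both gaps
    and into the cube; the other two are what \<open>box_bound_ge_1\<close> requires for v \<ge>
    1.\<close>
  define e where "e = Min {\<eta>\<^sub>0, 1, C powr (1 / (1 - \<alpha>\<^sub>0))}"
  have n: "n > 0" by (simp add: n_def)
  then have "C > 0" by (simp add: C_def)
  then have e: "e > 0" "e \<le> \<eta>\<^sub>0" "e \<le> 1" "e \<le> C powr (1 / (1 - \<alpha>\<^sub>0))"
    using assms by (auto simp: e_def)
  have "r_term i \<alpha> \<tau> E t s + v_term i \<alpha> \<tau> E t s \<ge> 0"
    if \<tau>: "0 < \<tau>" "\<tau> < Min {\<tau>\<^sub>0, e, 1}" and \<alpha>: "0 \<le> \<alpha>" "\<alpha> < \<alpha>\<^sub>0" and \<epsilon>: "0 < \<epsilon>" "\<epsilon> < e" and "0 < l"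
      and E: "locally_finite_perimeter E" and ti: "t $ i = 0"
      and mem: "t + s *\<^sub>R unit_vec i \<in> half_open_cube l"
      and S: "locally_finite_perimeter (slice i E t)" and s: "s \<in> reduced_boundary (slice i E t)"
      and far: "min \<bar>s - l\<bar> \<bar>s\<bar> > \<eta>\<^sub>0" and "j \<noteq> i"
      and dist: "stripe_dist j \<eta> E (half_open_cube l) \<le> \<epsilon> ^ CARD('n) / (16 * l ^ CARD('n))"
    for \<tau> \<alpha> \<epsilon> l \<eta> s and E :: "(real ^ 'n) set" and i j :: 'n and t :: "real ^ 'n"
  proof -
    let ?a = "prev_bd (slice i E t) s" and ?b = "next_bd (slice i E t) s"
    have \<tau>': "\<tau> < \<tau>\<^sub>0" "\<tau> \<le> e" "\<tau> \<le> 1" using \<tau> by auto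
    have at: "\<alpha> < 1" "\<tau> > 0" using \<alpha> \<tau> assms by auto
    have "CARD('n) \<noteq> 1"
    proof
      assume "CARD('n) = 1"
      then have "card {i, j} \<le> 1" using card_mono[of UNIV "{i, j}"] by simp
      with \<open>j \<noteq> i\<close> show False by simp
    qed
    let ?D = "{v. 0 < v \<and> ?a < ereal (s - v)}" and ?D' = "{v. 0 < v \<and> ereal (s + v) < ?b}"
    note r = r_term_ge[OF at S, of s]
    have mono: "enn2real (tail_mass i \<alpha> \<tau> X) \<le> enn2real (tail_mass i \<alpha> \<tau> Y)" if "X \<subseteq> Y" "Y \<subseteq> {0<..}" for X Y
      using tail_mass_mono[OF at that(1)] tail_mass_finite[OF at that(2)] by (intro enn2real_mono) auto
    have full: "enn2real (tail_mass i \<alpha> \<tau> ?D) \<le> enn2real (tail_mass i \<alpha> \<tau> {0<..})"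
      "enn2real (tail_mass i \<alpha> \<tau> ?D') \<le> enn2real (tail_mass i \<alpha> \<tau> {0<..})" by (auto intro!: mono)
    have short: "1 + enn2real (tail_mass i \<alpha> \<tau> X) \<le> enn2real (tail_mass i \<alpha> \<tau> {0<..})"
      if "X \<subseteq> {0<..<\<delta>}" "\<delta> < \<eta>\<^sub>0" for X \<delta>
    proof -
      \<comment> \<open>The gap lengths inserted for \<delta> below may be 0, since
        \<open>prev_bd\<close> and \<open>next_bd\<close> are only known to be weakly on their side
        of s, while (P) is exploited for a positive length.\<close>
      define \<delta>' where "\<delta>' = max \<delta> (\<eta>\<^sub>0 / 2)"
      have \<delta>': "0 < \<delta>'" "\<delta>' < \<eta>\<^sub>0" "\<delta> \<le> \<delta>'" using that assms(2) by (auto simp: \<delta>'_def)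
      then have X: "X \<subseteq> {0<..<\<delta>'}" using that(1) by (meson greaterThanLessThan_subseteq_greaterThanLessThan order_refl order_trans)
      let ?m = "tail_mass i \<alpha> \<tau> {0<..<\<delta>'}" and ?M = "tail_mass i \<alpha> \<tau> {0<..}"
      have fin: "?m < \<infinity>" "?M < \<infinity>"  by (rule tail_mass_finite[OF at]; force)+
      from property_P_tail_mass[OF at assms(4) \<open>CARD('n) \<noteq> 1\<close> \<alpha> \<tau>'(1) \<delta>'(1,2), of i]
      have "enn2real (1 + ?m + ?M) \<le> enn2real (2 * ?M)"
        using fin(2) by (intro enn2real_mono) (auto simp: ennreal_mult_less_top)
      then have "1 + enn2real ?m + enn2real ?M \<le> 2 * enn2real ?M"
        using fin by (simp add: enn2real_plus enn2real_mult)
      moreover have "enn2real (tail_mass i \<alpha> \<tau> X) \<le> enn2real ?m"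
        using X by (intro mono) auto
      ultimately show ?thesis by linarith
    qed
    consider "ereal (s - \<eta>\<^sub>0) < ?a" | "?b < ereal (s + \<eta>\<^sub>0)" | "?a \<le> ereal (s - \<eta>\<^sub>0)" "ereal (s + \<eta>\<^sub>0) \<le> ?b"
      by (meson linorder_not_less)
    then show ?thesis
    proof cases
      case 1
      then obtain p where p: "?a = ereal p" using prev_bd_le[of "slice i E t" s] by (cases ?a) auto
      have "1 + enn2real (tail_mass i \<alpha> \<tau> ?D) \<le> enn2real (tail_mass i \<alpha> \<tau> {0<..})"
        using 1 by (intro short[of _ "s - p"]) (auto simp: p)
      with r full v_term_nonneg[of i \<alpha> \<tau> E t s] show ?thesis by linarith
    next
      case 2
      then obtain p where p: "?b = ereal p" using next_bd_ge[of s "slice i E t"] by (cases ?b) auto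
      have "1 + enn2real (tail_mass i \<alpha> \<tau> ?D') \<le> enn2real (tail_mass i \<alpha> \<tau> {0<..})"
        using 2 by (intro short[of _ "p - s"]) (auto simp: p)
      with r full v_term_nonneg[of i \<alpha> \<tau> E t s] show ?thesis by linarith
    next
      case 3
      have cube: "0 \<le> (t + s *\<^sub>R unit_vec i) $ k \<and> (t + s *\<^sub>R unit_vec i) $ k < l" for k
        using mem by (simp add: half_open_cube_def)
      have s0: "0 \<le> s" "s < l" using cube[of i] ti by auto
      then have sl: "\<eta>\<^sub>0 < s" "\<eta>\<^sub>0 < l - s" using far by auto
      have t: "0 \<le> t $ k \<and> t $ k < l" for k
        using cube[of k] ti s0 by (cases "k = i") (auto simp: axis_def)
      have "E \<in> sets lebesgue" using E by (simp add: locally_finite_perimeter_def)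
      then obtain E' where E': "E' \<in> sets borel" "AE x in lborel. (x \<in> E') = (x \<in> E)"
        by (rule lebesgue_AE_borel)
      have "\<epsilon> ^ CARD('n) \<le> e ^ CARD('n)" using \<epsilon> by (intro power_mono) auto
      \<comment> \<open>The slack between 1/16 and 1/8 provides the strict inequality that
        \<open>stripe_dist_lessE\<close> needs, and 1/8 is the error that \<open>v_term_ge\<close>
        tolerates.\<close>
      then have "\<epsilon> ^ CARD('n) / 16 < e ^ CARD('n) / 8" using zero_less_power[OF e(1), of "CARD('n)"] by linarith
      then have "\<epsilon> ^ CARD('n) / 16 / l ^ CARD('n) < e ^ CARD('n) / 8 / l ^ CARD('n)"
        using \<open>0 < l\<close> by (intro divide_strict_right_mono) auto
      then have "stripe_dist j \<eta> E (half_open_cube l) < e ^ CARD('n) / 8 / l ^ CARD('n)"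
        using dist by simp
      from stripe_dist_lessE[OF this \<open>0 < l\<close> E'] obtain B where B: "B \<in> sets borel"
        "emeasure lborel {y \<in> half_open_cube l. (y \<in> E') \<noteq> (y $ j \<in> B)} \<le> ennreal (e ^ CARD('n) / 8)" .
      have gap: "?a \<le> ereal (s - e / 2)" "ereal (s + e / 2) \<le> ?b"
      proof -
        have "ereal (s - \<eta>\<^sub>0) \<le> ereal (s - e / 2)" "ereal (s + e / 2) \<le> ereal (s + \<eta>\<^sub>0)"
          using e(1,2) by auto
        with 3 show "?a \<le> ereal (s - e / 2)" "ereal (s + e / 2) \<le> ?b" by (blast intro: order_trans)+
      qed
      \<comment> \<open>The exponent is at least 1 because \<alpha> is nonnegative, and \<tau> is at
        most 1.\<close>
      have "\<tau> powr (1 / beta_exp \<alpha>) \<le> \<tau> powr 1"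
        using \<alpha> at \<tau>' by (intro powr_mono') (auto simp: beta_exp_def)
      then have \<tau>e: "\<tau> powr (1 / beta_exp \<alpha>) \<le> e" using \<tau>'(2) at(2) by simp
      \<comment> \<open>By hypothesis (a) the side l exceeds \<open>2 * \<eta>\<^sub>0\<close>,
        hence also \<open>2 * e\<close>.\<close>
      have sl': "0 \<le> s - e / 2" "s + e / 2 \<le> l" "2 * e \<le> l" using sl e(1,2) by linarith+
      have "1 \<le> 1 / (2 * real CARD('n)) *
          (((real CARD('n) + 1) * e) powr - p_exp CARD('n) \<alpha> * (e / 2) * (3 * e ^ CARD('n) / 8))"
        using e(1,3,4) \<alpha> assms(1) unfolding C_def n_def by (intro box_bound_ge_1) auto
      also have "\<dots> \<le> v_term i \<alpha> \<tau> E t s"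
        by (rule v_term_ge[OF at \<open>E \<in> sets lebesgue\<close> S s e(1) gap E' B(1) \<open>j \<noteq> i\<close> B(2) sl' ti t \<tau>e])
      finally have "1 \<le> v_term i \<alpha> \<tau> E t s" .
      with r full show ?thesis by linarith
    qed
  qed
  note main = this
  show ?thesis
    by (rule exI[of _ "Min {\<tau>\<^sub>0, e, 1}"], rule conjI, use assms e in simp, rule exI[of _ e], rule conjI, use e in simp)
       (use main in blast)
qed

end
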